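(* Let $\Gamma$ be the graph of a Robinson triangle tiling of $\mathbb{R}^2$ (as defined in the context), with integrated density of states $k_\Gamma$, and let $k_\Gamma(E\pm)$ denote the one-sided limits of $k_\Gamma$ at $E$. Then for each $E\in\{2,4\}$, $$k_\Gamma(E+)-k_\Gamma(E-)\ \ge\ \frac{65-29\sqrt5}{20}.$$
   Context: **Graphs, Laplacian, IDS.** The graph $\Gamma=(\mathcal{V},\mathcal{E})$ of a tiling of $\mathbb{R}^2$ by polygons has one vertex per tile; two vertices are joined ($u\sim v$) iff the corresponding (distinct) tiles share at least one edge. The Laplacian on $\ell^2(\mathcal{V})$ is $[\Delta_\Gamma\psi](v)=\sum_{u\sim v}(\psi(v)-\psi(u))$; the same formula defines the Laplacian of a finite graph. Let $\mathcal{V}_n\subseteq\mathcal{V}$ be the finite set of tiles meeting the closed ball of radius $n$ about the origin, $\Gamma_n$ the subgraph induced on $\mathcal{V}_n$, $\Delta_n$ its Laplacian, and $\nu_n(B)=\frac{1}{\#\mathcal{V}_n}\mathrm{Tr}\,\chi_B(\Delta_n)$ for Borel $B\subseteq\mathbb{R}$. For the tilings below it is known that $\nu_n$ converges weak-$*$ to a probability measure $\nu_\Gamma$ (the density of states measure), independent of the choice of suitable exhaustion. The integrated density of states is $k_\Gamma(E)=\nu_\Gamma((-\infty,E])$. **Robinson triangle tilings.** Let $\varphi=(1+\sqrt5)/2$. Tiles: acute triangles $A(a,b,c)$ with $|ab|=|ac|=1$, $|bc|=1/\varphi$, and obtuse triangles $O(a,b,c)$ with $|ab|=|ac|=1$,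 $|bc|=\varphi$, with ordered vertices; each shape occurs in two colors, namely the two orientations of $(a,b,c)$. The substitution $S$ enlarges a tile by the factor $\varphi$ and dissects it as follows (written before enlarging). $A(a,b,c)$ becomes $A(c,p,b)$ and $O(p,c,a)$, where $p=a+(b-a)/\varphi$. $O(a,b,c)$ becomes $O(r,c,a)$, $O(q,r,b)$ and $A(r,q,a)$, where $q=b+(a-b)/\varphi$ and $r=b+(c-b)/\varphi$. A Robinson triangle tiling is a tiling of $\mathbb{R}^2$ by such (colored) triangles every finite patch of which occurs, up to rotation and translation, in $S^n(P)$ for some tile $P$ and some $n\in\mathbb{N}$. *)

theory Defs
  imports "HOL-Probability.Probability"
begin

text \<open>
  The plane \<open>\<real>\<^sup>2\<close> is the type \<^typ>\<open>complex\<close>, so that the rotations are the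
  multiplications by complex numbers of modulus 1.
\<close>

subsection \<open>Laplacian of a graph and its spectral calculus\<close>

text \<open>
  A graph is given by its vertex set \<open>V\<close> and its adjacency relation \<open>adj\<close>; only the adjacencies
  between elements of \<open>V\<close> matter, so passing to a subset of \<open>V\<close> means passing to the induced subgraph.
\<close>

definition laplacian :: "'v set \<Rightarrow> ('v \<Rightarrow> 'v \<Rightarrow> bool) \<Rightarrow> ('v \<Rightarrow> complex) \<Rightarrow> 'v \<Rightarrow> complex" where
  "laplacian V adj \<psi> v = (\<Sum>u | u \<in> V \<and> adj u v. \<psi> v - \<psi> u)"

text \<open>
  From here on \<open>V\<close> is meant to be finite. Elements of \<open>\<ell>\<^sup>2(V)\<close> are represented by
  functions on the whole type that vanish outside \<open>V\<close>.
\<close>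

definition l2 :: "'v set \<Rightarrow> ('v \<Rightarrow> complex) set" where
  "l2 V = {\<psi>. \<forall>v. v \<notin> V \<longrightarrow> \<psi> v = 0}"

definition l2_inner :: "'v set \<Rightarrow> ('v \<Rightarrow> complex) \<Rightarrow> ('v \<Rightarrow> complex) \<Rightarrow> complex" where
  "l2_inner V \<phi> \<psi> = (\<Sum>v\<in>V. cnj (\<phi> v) * \<psi> v)"

definition eigenspace :: "'v set \<Rightarrow> ('v \<Rightarrow> 'v \<Rightarrow> bool) \<Rightarrow> real \<Rightarrow> ('v \<Rightarrow> complex) set" where
  "eigenspace V adj E =
     {\<psi> \<in> l2 V. \<forall>v\<in>V. laplacian V adj \<psi> v = complex_of_real E * \<psi> v}"

text \<open>The Laplacian is self-adjoint when \<open>adj\<close> is symmetric, so only real eigenvalues are considered.\<close>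

definition spectrum :: "'v set \<Rightarrow> ('v \<Rightarrow> 'v \<Rightarrow> bool) \<Rightarrow> real set" where
  "spectrum V adj = {E. \<exists>\<psi>\<in>eigenspace V adj E. \<psi> \<noteq> (\<lambda>_. 0)}"

definition orth_proj :: "'v set \<Rightarrow> ('v \<Rightarrow> complex) set \<Rightarrow> ('v \<Rightarrow> complex) \<Rightarrow> 'v \<Rightarrow> complex" where
  "orth_proj V W \<psi> = (THE \<eta>. \<eta> \<in> W \<and> (\<forall>\<omega>\<in>W. l2_inner V \<omega> (\<lambda>v. \<psi> v - \<eta> v) = 0))"

text \<open>
  The functional calculus \<open>f(\<Delta>) = \<Sum>\<^sub>E f(E) P\<^sub>E\<close>, where \<open>P\<^sub>E\<close> is the
  orthogonal projection onto the eigenspace of \<open>E\<close>.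
\<close>

definition fun_calculus ::
  "'v set \<Rightarrow> ('v \<Rightarrow> 'v \<Rightarrow> bool) \<Rightarrow> (real \<Rightarrow> real) \<Rightarrow> ('v \<Rightarrow> complex) \<Rightarrow> 'v \<Rightarrow> complex" where
  "fun_calculus V adj f \<psi> v =
     (\<Sum>E\<in>spectrum V adj. complex_of_real (f E) * orth_proj V (eigenspace V adj E) \<psi> v)"

definition op_trace :: "'v set \<Rightarrow> (('v \<Rightarrow> complex) \<Rightarrow> 'v \<Rightarrow> complex) \<Rightarrow> complex" where
  "op_trace V L = (\<Sum>v\<in>V. L (indicator {v}) v)"

definition eigenvalue_measure :: "'v set \<Rightarrow> ('v \<Rightarrow> 'v \<Rightarrow> bool) \<Rightarrow> real measure" where
  "eigenvalue_measure V adj = measure_of UNIV (sets borel)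
     (\<lambda>B. ennreal (Re (op_trace V (fun_calculus V adj (indicator B))) / real (card V)))"

subsection \<open>Robinson triangles\<close>

definition golden :: real where
  "golden = (1 + sqrt 5) / 2"

text \<open>
  The vertices are ordered. The apex of an isosceles triangle being determined by its
  shape, a triangle with unordered vertices gives rise to exactly two values, which differ by
  exchanging the last two vertices, hence by the orientation: these are the two colors.
\<close>

datatype 'p triangle = Acute 'p 'p 'p | Obtuse 'p 'p 'p

type_synonym tile = "complex triangle"

fun is_tile :: "tile \<Rightarrow> bool" where
  "is_tile (Acute a b c) \<longleftrightarrow> dist a b = 1 \<and> dist a c = 1 \<and> dist b c = 1 / golden"
| "is_tile (Obtuse a b c) \<longleftrightarrow> dist a b = 1 \<and> dist a c = 1 \<and> dist b c = golden"

fun region :: "tile \<Rightarrow> complex set" where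
  "region (Acute a b c) = convex hull {a, b, c}"
| "region (Obtuse a b c) = convex hull {a, b, c}"

fun edges :: "tile \<Rightarrow> complex set set" where
  "edges (Acute a b c) = {closed_segment a b, closed_segment b c, closed_segment c a}"
| "edges (Obtuse a b c) = {closed_segment a b, closed_segment b c, closed_segment c a}"

fun dissect :: "tile \<Rightarrow> tile set" where
  "dissect (Acute a b c) =
     (let p = a + (b - a) /\<^sub>R golden
      in {Acute c p b, Obtuse p c a})"
| "dissect (Obtuse a b c) =
     (let q = b + (a - b) /\<^sub>R golden; r = b + (c - b) /\<^sub>R golden
      in {Obtuse r c a, Obtuse q r b, Acute r q a})"

definition subst :: "tile set \<Rightarrow> tile set" where
  "subst P = (\<Union>t\<in>P. map_triangle (\<lambda>z. golden *\<^sub>R z) ` dissect t)"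

subsection \<open>Tilings\<close>

definition tiling :: "tile set \<Rightarrow> bool" where
  "tiling T \<longleftrightarrow> (\<forall>t\<in>T. is_tile t) \<and> (\<Union>t\<in>T. region t) = UNIV \<and>
     (\<forall>s\<in>T. \<forall>t\<in>T. s \<noteq> t \<longrightarrow> interior (region s) \<inter> interior (region t) = {})"

definition occurs_in :: "tile set \<Rightarrow> tile set \<Rightarrow> bool" where
  "occurs_in F P \<longleftrightarrow> (\<exists>w u. cmod w = 1 \<and> map_triangle (\<lambda>z. w * z + u) ` F \<subseteq> P)"

definition robinson_tiling :: "tile set \<Rightarrow> bool" where
  "robinson_tiling T \<longleftrightarrow> tiling T \<and>
     (\<forall>F. finite F \<and> F \<subseteq> T \<longrightarrow> (\<exists>P n. is_tile P \<and> occurs_in F ((subst ^^ n) {P})))"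

subsection \<open>Density of states\<close>

definition adjacent :: "tile \<Rightarrow> tile \<Rightarrow> bool" where
  "adjacent s t \<longleftrightarrow> s \<noteq> t \<and> edges s \<inter> edges t \<noteq> {}"

definition tiles_in_ball :: "tile set \<Rightarrow> nat \<Rightarrow> tile set" where
  "tiles_in_ball T n = {t \<in> T. region t \<inter> cball 0 (real n) \<noteq> {}}"

text \<open>
  Weak-\<open>*\<close> convergence is tested against the continuous functions vanishing at infinity.
\<close>

definition is_dos_measure :: "tile set \<Rightarrow> real measure \<Rightarrow> bool" where
  "is_dos_measure T \<nu> \<longleftrightarrow> real_distribution \<nu> \<and>
     (\<forall>f :: real \<Rightarrow> real. continuous_on UNIV f \<and> (f \<longlongrightarrow> 0) at_infinity \<longrightarrow>
        (\<lambda>n. \<integral>x. f x \<partial>eigenvalue_measure (tiles_in_ball T n) adjacent) \<longlonglongrightarrow> (\<integral>x. f x \<partial>\<nu>))"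

text \<open>The integrated density of states is then the distribution function \<^term>\<open>cdf \<nu>\<close>.\<close>

end

theory Submission
  imports Defs
begin

text \<open>
  The graph of a Robinson triangle tiling carries finitely supported eigenfunctions. Let ten obtuse
  tiles meet at a point, each with its second corner; call them a star. In a large enough
  neighbourhood the star is surrounded by twenty tiles, its wings, ten of them acute and ten obtuse,
  permuted by the symmetries of the star. A wing has three neighbours: its mirror image in a line
  through the centre, which is a wing of the same shape, and two tiles called links. A link touches
  one acute and one obtuse wing. Therefore a function that is supported on the wings, and takes
  opposite values on the acute and the obtuse wing at each link, has a Laplacian that vanishes on the
  links. If moreover it is invariant under the reflections, it is an eigenfunction of
  eigenvalue \<open>3 - 1 = 2\<close>; if it changes sign under them, of eigenvalue \<open>3 + 1 = 4\<close>. The functions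
  of different stars have disjoint supports, so the multiplicity of either eigenvalue of a finite
  piece of the tiling is at least the number of stars whose surroundings lie in that piece
  (\<open>flower_fun_eigenfunction\<close>, \<open>eigenvalue_measure_flowers\<close>).
\<close>

text \<open>
  It remains to count stars. Two observations suffice. If two tiles are glued along a side \<open>AB\<close>, or
  along the side \<open>BC\<close> of obtuse tiles, then five substitutions produce a star centred on that side;
  and two further substitutions turn every star into a larger patch containing a star with the same
  centre. Let \<open>a\<^sub>n\<close> and \<open>o\<^sub>n\<close> be the numbers of acute and obtuse tiles after \<open>n\<close> substitutions.
  Counting every star ten times, once for each of its tiles, and ignoring the sides on the boundary,
  the number \<open>f\<^sub>n\<close> of star tiles satisfies \<open>f\<^sub>n \<ge> f\<^bsub>n-2\<^esub> + 5 (a\<^bsub>n-5\<^esub> + 2 o\<^bsub>n-5\<^esub>)\<close>, whose solution is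
  \<open>18 a\<^sub>n - 11 o\<^sub>n\<close> (\<open>card_blooms\<close>). As \<open>o\<^sub>n / a\<^sub>n\<close> tends to \<open>\<phi>\<close>, this is asymptotically
  \<open>\<surd>5 \<phi>\<^sup>-\<^sup>7 = (65 - 29 \<surd>5) / 2\<close> per tile, and a tenth of it is the asserted bound. The boundary
  does no harm: the number of sides that are not glued at most doubles under a substitution, while the
  number of tiles grows by the factor \<open>\<phi>\<^sup>2 > 2\<close>.
\<close>

text \<open>
  The tiles of \<open>T\<close> that meet a large disc form a patch of some \<open>S\<^sup>m(P)\<close>, which is cut into the
  patches \<open>S\<^sup>k(X)\<close> for a fixed \<open>k\<close>. The incomplete ones lie near the boundary circle and contribute an
  error proportional to the radius, by comparison of areas (\<open>flowers_in_disc\<close>). So the eigenvalue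
  measures have atoms at 2 and 4 that are bounded below in the limit, and such atoms persist under weak
  convergence (\<open>atom_of_weak_limit_ge\<close>).
\<close>

text \<open>
  All incidence statements about bounded patches are invariant under affine maps. In coordinates relative to one
  of the tiles all corners lie in \<open>\<int>[\<phi>]\<^sup>2\<close>, which makes these statements finite computations with integers.
\<close>



section \<open>Eigenvalue measures of finite graphs\<close>

definition orthonormal :: "'v set \<Rightarrow> ('v \<Rightarrow> complex) set \<Rightarrow> bool" where
  "orthonormal V B \<longleftrightarrow> (\<forall>b\<in>B. \<forall>c\<in>B. l2_inner V b c = (if b = c then 1 else 0))"

lemma l2_inner_self: "l2_inner V \<phi> \<phi> = of_real (\<Sum>v\<in>V. (cmod (\<phi> v))\<^sup>2)"
  unfolding l2_inner_def of_real_sum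
  by (intro sum.cong refl) (simp add: complex_norm_square[symmetric] mult.commute)

lemma l2_inner_eq_0_iff:
  assumes "finite V" "\<phi> \<in> l2 V"
  shows "l2_inner V \<phi> \<phi> = 0 \<longleftrightarrow> \<phi> = (\<lambda>_. 0)"
proof -
  have "l2_inner V \<phi> \<phi> = 0 \<longleftrightarrow> (\<forall>v\<in>V. \<phi> v = 0)"
    unfolding l2_inner_self of_real_eq_0_iff
    by (subst sum_nonneg_eq_0_iff) (use assms in auto)
  then show ?thesis using assms(2) by (auto simp: l2_def fun_eq_iff)
qed

lemma l2_inner_commute: "l2_inner V \<psi> \<phi> = cnj (l2_inner V \<phi> \<psi>)"
  by (simp add: l2_inner_def mult.commute)

lemma l2_inner_sum_right:
  "l2_inner V \<phi> (\<lambda>v. \<Sum>b\<in>B. k b * b v) = (\<Sum>b\<in>B. k b * l2_inner V \<phi> b)"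
  unfolding l2_inner_def sum_distrib_left by (subst sum.swap) (simp add: mult_ac)

lemma l2_inner_diff_right:
  "l2_inner V \<phi> (\<lambda>v. \<psi> v - \<eta> v) = l2_inner V \<phi> \<psi> - l2_inner V \<phi> \<eta>"
  by (simp add: l2_inner_def algebra_simps sum_subtractf)

lemma l2_inner_cmult_right:
  "l2_inner V \<phi> (\<lambda>v. k * \<psi> v) = k * l2_inner V \<phi> \<psi>"
  by (simp add: l2_inner_def algebra_simps sum_distrib_left)

lemma l2_inner_cmult_left:
  "l2_inner V (\<lambda>v. k * \<phi> v) \<psi> = cnj k * l2_inner V \<phi> \<psi>"
  by (simp add: l2_inner_def algebra_simps sum_distrib_left)

lemma l2_inner_indicator:
  assumes "finite V" "v \<in> V" shows "l2_inner V \<phi> (indicator {v}) = cnj (\<phi> v)"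
proof -
  have "l2_inner V \<phi> (indicator {v}) = (\<Sum>x\<in>V. if x = v then cnj (\<phi> v) else 0)"
    unfolding l2_inner_def by (intro sum.cong) (auto simp: indicator_def)
  then show ?thesis using assms by simp
qed

lemma orthonormal_expansion_inner:
  assumes "orthonormal V B" "finite B" "c \<in> B"
  shows "l2_inner V c (\<lambda>v. \<Sum>b\<in>B. k b * b v) = k c"
proof -
  have "l2_inner V c (\<lambda>v. \<Sum>b\<in>B. k b * b v) = (\<Sum>b\<in>B. if b = c then k c else 0)"
    unfolding l2_inner_sum_right using assms
    by (intro sum.cong) (auto simp: orthonormal_def)
  then show ?thesis using assms by simp
qed

text \<open>
  Bessel's inequality for the point mass at \<open>v\<close>: its projection \<open>\<eta>\<close> onto the span of \<open>B\<close> satisfies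
  \<open>\<eta> v = \<parallel>\<eta>\<parallel>\<^sup>2\<close>, and \<open>\<bar>\<eta> v\<bar> \<le> \<parallel>\<eta>\<parallel>\<close>.
\<close>

lemma orthonormal_bessel:
  assumes V: "finite V" "v \<in> V" and B: "orthonormal V B" "finite B"
  shows "(\<Sum>b\<in>B. (cmod (b v))\<^sup>2) \<le> 1"
proof -
  define s where "s = (\<Sum>b\<in>B. (cmod (b v))\<^sup>2)"
  define \<eta> where "\<eta> = (\<lambda>x. \<Sum>b\<in>B. cnj (b v) * b x)"
  have \<eta>v: "\<eta> v = of_real s"
    unfolding \<eta>_def s_def of_real_sum
    by (intro sum.cong refl) (simp add: complex_norm_square[symmetric] mult.commute)
  have "l2_inner V \<eta> \<eta> = (\<Sum>b\<in>B. cnj (b v) * l2_inner V \<eta> b)"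
    by (subst (2) \<eta>_def) (rule l2_inner_sum_right)
  also have "\<dots> = (\<Sum>b\<in>B. cnj (b v) * b v)"
  proof (intro sum.cong refl)
    fix b assume b: "b \<in> B"
    have "l2_inner V \<eta> b = cnj (l2_inner V b \<eta>)" by (rule l2_inner_commute)
    also have "l2_inner V b \<eta> = cnj (b v)"
      unfolding \<eta>_def by (rule orthonormal_expansion_inner[OF B b])
    finally show "cnj (b v) * l2_inner V \<eta> b = cnj (b v) * b v" by simp
  qed
  also have "\<dots> = of_real s" using \<eta>v by (simp add: \<eta>_def)
  finally have "(\<Sum>x\<in>V. (cmod (\<eta> x))\<^sup>2) = s" unfolding l2_inner_self of_real_eq_iff .
  moreover have "(cmod (\<eta> v))\<^sup>2 \<le> (\<Sum>x\<in>V. (cmod (\<eta> x))\<^sup>2)"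
    by (rule member_le_sum) (use V in auto)
  moreover have "cmod (\<eta> v) = s"
    unfolding \<eta>v norm_of_real using sum_nonneg[of B "\<lambda>b. (cmod (b v))\<^sup>2"] by (simp add: s_def)
  ultimately have "s * s \<le> s * 1" by (simp add: power2_eq_square)
  moreover have "s \<ge> 0" by (simp add: s_def sum_nonneg)
  ultimately show ?thesis unfolding s_def[symmetric]
    by (metis mult_le_cancel_left_pos order_le_less zero_le_one)
qed

lemma orthonormal_sum_norm:
  assumes "orthonormal V B" "b \<in> B" shows "(\<Sum>v\<in>V. (cmod (b v))\<^sup>2) = 1"
proof -
  have "complex_of_real (\<Sum>v\<in>V. (cmod (b v))\<^sup>2) = 1"
    using assms by (simp only: l2_inner_self[symmetric] orthonormal_def) auto
  then show ?thesis using of_real_eq_1_iff by blast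
qed

lemma orthonormal_card_le_finite:
  assumes V: "finite V" and B: "orthonormal V B" "finite B"
  shows "card B \<le> card V"
proof -
  have "real (card B) = (\<Sum>b\<in>B. \<Sum>v\<in>V. (cmod (b v))\<^sup>2)"
    using orthonormal_sum_norm[OF B(1)] by simp
  also have "\<dots> = (\<Sum>v\<in>V. \<Sum>b\<in>B. (cmod (b v))\<^sup>2)" by (rule sum.swap)
  also have "\<dots> \<le> (\<Sum>v\<in>V. 1)" by (intro sum_mono orthonormal_bessel[OF V _ B])
  finally show ?thesis by simp
qed

lemma orthonormal_subset: "orthonormal V B \<Longrightarrow> C \<subseteq> B \<Longrightarrow> orthonormal V C"
  unfolding orthonormal_def by (meson subsetD)

lemma orthonormal_finite:
  assumes V: "finite V" and B: "orthonormal V B"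
  shows "finite B"
proof (rule ccontr)
  assume "infinite B"
  then obtain C where C: "C \<subseteq> B" "finite C" "card C = Suc (card V)"
    by (meson infinite_arbitrarily_large)
  with orthonormal_card_le_finite[OF V orthonormal_subset[OF B C(1)] C(2)] show False by simp
qed

definition l2_subspace :: "'v set \<Rightarrow> ('v \<Rightarrow> complex) set \<Rightarrow> bool" where
  "l2_subspace V W \<longleftrightarrow> W \<subseteq> l2 V \<and> (\<lambda>_. 0) \<in> W \<and>
     (\<forall>\<phi>\<in>W. \<forall>\<psi>\<in>W. \<forall>k. (\<lambda>v. \<phi> v + k * \<psi> v) \<in> W)"

lemma l2_subspace_add_cmult:
  "l2_subspace V W \<Longrightarrow> \<phi> \<in> W \<Longrightarrow> \<psi> \<in> W \<Longrightarrow> (\<lambda>v. \<phi> v + k * \<psi> v) \<in> W"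
  by (simp add: l2_subspace_def)

lemma l2_subspace_zero: "l2_subspace V W \<Longrightarrow> (\<lambda>_. 0) \<in> W"
  by (simp add: l2_subspace_def)

lemma l2_subspace_sum:
  assumes W: "l2_subspace V W" and "finite B" "B \<subseteq> W"
  shows "(\<lambda>v. \<Sum>b\<in>B. k b * b v) \<in> W"
  using assms(2,3)
proof (induction B rule: finite_induct)
  case empty
  then show ?case using W by (simp add: l2_subspace_def)
next
  case (insert b B)
  then have "(\<lambda>v. (\<Sum>b\<in>B. k b * b v) + k b * b v) \<in> W"
    by (intro l2_subspace_add_cmult[OF W]) auto
  then show ?case using insert by (simp add: add.commute)
qed

lemma l2_subspace_cmult:
  assumes "l2_subspace V W" "\<psi> \<in> W" shows "(\<lambda>v. k * \<psi> v) \<in> W"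
proof -
  have "(\<lambda>v. 0 + k * \<psi> v) \<in> W"
    by (rule l2_subspace_add_cmult[OF assms(1) l2_subspace_zero[OF assms(1)] assms(2)])
  then show ?thesis by simp
qed

lemma l2_subspace_diff:
  assumes "l2_subspace V W" "\<phi> \<in> W" "\<psi> \<in> W" shows "(\<lambda>v. \<phi> v - \<psi> v) \<in> W"
proof -
  have "(\<lambda>v. \<phi> v + (- 1) * \<psi> v) \<in> W" by (rule l2_subspace_add_cmult[OF assms])
  then show ?thesis by simp
qed

definition normalized :: "'v set \<Rightarrow> ('v \<Rightarrow> complex) \<Rightarrow> 'v \<Rightarrow> complex" where
  "normalized V \<phi> = (\<lambda>v. of_real (1 / sqrt (\<Sum>x\<in>V. (cmod (\<phi> x))\<^sup>2)) * \<phi> v)"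

lemma normalized_in_subspace:
  "l2_subspace V W \<Longrightarrow> \<psi> \<in> W \<Longrightarrow> normalized V \<psi> \<in> W"
  unfolding normalized_def by (rule l2_subspace_cmult)

lemma l2_inner_normalized_self:
  assumes V: "finite V" and \<phi>: "\<phi> \<in> l2 V" "\<phi> \<noteq> (\<lambda>_. 0)"
  shows "l2_inner V (normalized V \<phi>) (normalized V \<phi>) = 1"
proof -
  define s where "s = (\<Sum>v\<in>V. (cmod (\<phi> v))\<^sup>2)"
  have s: "l2_inner V \<phi> \<phi> = of_real s" unfolding s_def by (rule l2_inner_self)
  have "s \<noteq> 0" using l2_inner_eq_0_iff[OF V \<phi>(1)] \<phi>(2) s by auto
  then have s0: "s > 0" using sum_nonneg[of V "\<lambda>v. (cmod (\<phi> v))\<^sup>2"] by (simp add: s_def)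
  have "l2_inner V (normalized V \<phi>) (normalized V \<phi>) = of_real (1 / sqrt s * (1 / sqrt s) * s)"
    unfolding normalized_def s_def[symmetric]
    by (simp only: l2_inner_cmult_left l2_inner_cmult_right s complex_cnj_complex_of_real of_real_mult mult.assoc)
  also have "1 / sqrt s * (1 / sqrt s) * s = 1" using s0 by (simp add: field_simps)
  finally show ?thesis by (simp only: of_real_1)
qed

lemma l2_inner_normalized_eq_0:
  "l2_inner V \<phi> \<psi> = 0 \<Longrightarrow> l2_inner V (normalized V \<phi>) (normalized V \<psi>) = 0"
  unfolding normalized_def by (simp only: l2_inner_cmult_left l2_inner_cmult_right mult_zero_right)

lemma l2_inner_normalized_right:
  "l2_inner V \<phi> \<psi> = 0 \<Longrightarrow> l2_inner V \<phi> (normalized V \<psi>) = 0"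
  unfolding normalized_def by (simp only: l2_inner_cmult_right mult_zero_right)

lemma orthonormal_normalized_image:
  assumes V: "finite V" and l2: "\<And>i. i \<in> I \<Longrightarrow> \<psi> i \<in> l2 V"
    and nz: "\<And>i. i \<in> I \<Longrightarrow> \<psi> i \<noteq> (\<lambda>_. 0)"
    and orth: "\<And>i j. i \<in> I \<Longrightarrow> j \<in> I \<Longrightarrow> i \<noteq> j \<Longrightarrow> l2_inner V (\<psi> i) (\<psi> j) = 0"
  shows "orthonormal V ((\<lambda>i. normalized V (\<psi> i)) ` I)" "inj_on (\<lambda>i. normalized V (\<psi> i)) I"
proof -
  have 1: "l2_inner V (normalized V (\<psi> i)) (normalized V (\<psi> i)) = 1" if "i \<in> I" for i
    by (rule l2_inner_normalized_self[OF V l2[OF that] nz[OF that]])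
  have 0: "l2_inner V (normalized V (\<psi> i)) (normalized V (\<psi> j)) = 0" if "i \<in> I" "j \<in> I" "i \<noteq> j" for i j
    by (rule l2_inner_normalized_eq_0[OF orth[OF that]])
  show inj: "inj_on (\<lambda>i. normalized V (\<psi> i)) I"
  proof (rule inj_onI, rule ccontr)
    fix i j assume ij: "i \<in> I" "j \<in> I" "normalized V (\<psi> i) = normalized V (\<psi> j)" "i \<noteq> j"
    show False using 0[OF ij(1,2,4)] 1[OF ij(1)] ij(3) by simp
  qed
  show "orthonormal V ((\<lambda>i. normalized V (\<psi> i)) ` I)"
    unfolding orthonormal_def
  proof (intro ballI, elim imageE)
    fix b c i j assume "b = normalized V (\<psi> i)" "i \<in> I" "c = normalized V (\<psi> j)" "j \<in> I"
    then show "l2_inner V b c = (if b = c then 1 else 0)"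
      using 0[of i j] 1[of i] by (cases "i = j") auto
  qed
qed

definition expansion :: "'v set \<Rightarrow> ('v \<Rightarrow> complex) set \<Rightarrow> ('v \<Rightarrow> complex) \<Rightarrow> 'v \<Rightarrow> complex" where
  "expansion V B \<psi> = (\<lambda>v. \<Sum>b\<in>B. l2_inner V b \<psi> * b v)"

definition orthonormal_basis :: "'v set \<Rightarrow> ('v \<Rightarrow> complex) set \<Rightarrow> ('v \<Rightarrow> complex) set \<Rightarrow> bool" where
  "orthonormal_basis V W B \<longleftrightarrow> finite B \<and> orthonormal V B \<and> B \<subseteq> W \<and> (\<forall>\<omega>\<in>W. expansion V B \<omega> = \<omega>)"

lemma inner_expansion_left:
  assumes "orthonormal V B" "finite B" "c \<in> B"
  shows "l2_inner V c (expansion V B \<psi>) = l2_inner V c \<psi>"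
  unfolding expansion_def by (rule orthonormal_expansion_inner[OF assms])

text \<open>
  An orthonormal set in \<open>W\<close> that is maximal under inclusion is a basis: what remains of a vector after
  subtracting its expansion could otherwise be normalized and added.
\<close>

lemma extend_to_orthonormal_basis:
  assumes V: "finite V" and W: "l2_subspace V W" and B0: "orthonormal V B0" "B0 \<subseteq> W"
  shows "\<exists>B. orthonormal_basis V W B \<and> B0 \<subseteq> B"
proof -
  let ?P = "\<lambda>B. orthonormal V B \<and> B0 \<subseteq> B \<and> B \<subseteq> W"
  have "?P B0" using B0 by simp
  moreover have "\<forall>B. ?P B \<longrightarrow> card B < Suc (card V)"
    using orthonormal_card_le_finite[OF V] orthonormal_finite[OF V] by (auto simp: less_Suc_eq_le)
  ultimately obtain B where B: "?P B" and max: "\<And>C. ?P C \<Longrightarrow> card C \<le> card B"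
    using ex_has_greatest_nat[of ?P B0 card "Suc (card V)"] by (metis less_imp_le)
  have fin: "finite B" using orthonormal_finite[OF V] B by blast
  have exp: "expansion V B \<omega> = \<omega>" if \<omega>: "\<omega> \<in> W" for \<omega>
  proof (rule ccontr)
    assume neq: "expansion V B \<omega> \<noteq> \<omega>"
    define \<rho> where "\<rho> = (\<lambda>v. \<omega> v - expansion V B \<omega> v)"
    have \<rho>W: "\<rho> \<in> W" unfolding \<rho>_def expansion_def
      by (intro l2_subspace_diff[OF W] \<omega> l2_subspace_sum[OF W fin]) (use B in blast)
    have \<rho>0: "\<rho> \<noteq> (\<lambda>_. 0)"
    proof
      assume "\<rho> = (\<lambda>_. 0)"
      then have "\<rho> v = 0" for v by simp
      then show False using neq by (auto simp: \<rho>_def fun_eq_iff)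
    qed
    have orth: "l2_inner V b \<rho> = 0" if "b \<in> B" for b
      unfolding \<rho>_def l2_inner_diff_right
      using inner_expansion_left[OF _ fin that, of V] B by simp
    have \<rho>l2: "\<rho> \<in> l2 V" using \<rho>W W by (auto simp: l2_subspace_def)
    define e where "e = normalized V \<rho>"
    have eo: "l2_inner V b e = 0" if "b \<in> B" for b
      unfolding e_def by (rule l2_inner_normalized_right[OF orth[OF that]])
    have eo': "l2_inner V e b = 0" if "b \<in> B" for b
      by (subst l2_inner_commute) (simp add: eo that)
    have e1: "l2_inner V e e = 1" unfolding e_def by (rule l2_inner_normalized_self[OF V \<rho>l2 \<rho>0])
    have enot: "e \<notin> B" using eo e1 by fastforce
    have "orthonormal V (insert e B)"
      using B eo eo' e1 enot unfolding orthonormal_def by (auto split: if_splits)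
    moreover have "e \<in> W" unfolding e_def by (rule normalized_in_subspace[OF W \<rho>W])
    ultimately have "card (insert e B) \<le> card B" using B by (intro max) auto
    then show False using fin enot by simp
  qed
  have "orthonormal_basis V W B"
    unfolding orthonormal_basis_def using fin B exp by simp
  moreover have "B0 \<subseteq> B" using B by simp
  ultimately show ?thesis by (intro exI conjI)
qed

text \<open>
  The projection is unique because the difference of two candidates lies in \<open>W\<close> and is orthogonal to
  \<open>W\<close>, in particular to itself. So the definite description in \<^const>\<open>orth_proj\<close> denotes the expansion.
\<close>

lemma orth_proj_eq_expansion:
  assumes V: "finite V" and W: "l2_subspace V W"
    and basis: "orthonormal_basis V W B"
  shows "orth_proj V W \<psi> = expansion V B \<psi>"
  unfolding orth_proj_def
proof (rule the_equality)
  have B: "finite B" "orthonormal V B" "B \<subseteq> W"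
    using basis by (auto simp: orthonormal_basis_def)
  define \<eta> where "\<eta> = expansion V B \<psi>"
  have \<eta>W: "\<eta> \<in> W" unfolding \<eta>_def expansion_def by (rule l2_subspace_sum[OF W B(1,3)])
  define \<rho> where "\<rho> = (\<lambda>v. \<psi> v - \<eta> v)"
  have orth: "l2_inner V \<omega> \<rho> = 0" if "\<omega> \<in> W" for \<omega>
  proof -
    have 0: "l2_inner V \<rho> b = 0" if "b \<in> B" for b
      unfolding \<rho>_def \<eta>_def
      by (subst l2_inner_commute)
        (simp only: l2_inner_diff_right inner_expansion_left[OF B(2,1) that] diff_self complex_cnj_zero)
    have "\<omega> = expansion V B \<omega>" using basis that by (simp add: orthonormal_basis_def)
    then have "l2_inner V \<rho> \<omega> = l2_inner V \<rho> (expansion V B \<omega>)" by (rule arg_cong)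
    also have "\<dots> = 0" unfolding expansion_def l2_inner_sum_right by (simp add: 0)
    finally show ?thesis by (subst l2_inner_commute) simp
  qed
  then show "expansion V B \<psi> \<in> W \<and> (\<forall>\<omega>\<in>W. l2_inner V \<omega> (\<lambda>v. \<psi> v - expansion V B \<psi> v) = 0)"
    using \<eta>W unfolding \<rho>_def \<eta>_def by simp
  fix \<eta>' assume \<eta>': "\<eta>' \<in> W \<and> (\<forall>\<omega>\<in>W. l2_inner V \<omega> (\<lambda>v. \<psi> v - \<eta>' v) = 0)"
  define \<delta> where "\<delta> = (\<lambda>v. \<eta> v - \<eta>' v)"
  have \<delta>W: "\<delta> \<in> W" unfolding \<delta>_def by (rule l2_subspace_diff[OF W \<eta>W]) (use \<eta>' in simp)
  have "l2_inner V \<delta> \<delta> = l2_inner V \<delta> (\<lambda>v. \<psi> v - \<eta>' v) - l2_inner V \<delta> \<rho>"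
    unfolding l2_inner_diff_right[symmetric] \<rho>_def by (simp add: \<delta>_def)
  also have "\<dots> = 0" using orth[OF \<delta>W] \<eta>' \<delta>W by simp
  finally have "\<delta> = (\<lambda>_. 0)"
    using l2_inner_eq_0_iff[OF V] \<delta>W W by (auto simp: l2_subspace_def)
  then have "\<delta> v = 0" for v by simp
  then have "\<eta> v = \<eta>' v" for v by (simp add: \<delta>_def)
  then show "\<eta>' = expansion V B \<psi>" unfolding \<eta>_def by (simp add: fun_eq_iff)
qed

text \<open>
  The diagonal entry of the projection at \<open>v\<close> is \<open>\<Sum>\<^sub>b \<bar>b v\<bar>\<^sup>2\<close>; summing over \<open>v\<close> first gives 1 for each \<open>b\<close>.
\<close>

lemma op_trace_orth_proj:
  assumes V: "finite V" and W: "l2_subspace V W"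
    and basis: "orthonormal_basis V W B"
  shows "op_trace V (orth_proj V W) = of_nat (card B)"
proof -
  have B: "orthonormal V B" using basis by (simp add: orthonormal_basis_def)
  have "op_trace V (orth_proj V W) = (\<Sum>v\<in>V. \<Sum>b\<in>B. cnj (b v) * b v)"
    unfolding op_trace_def orth_proj_eq_expansion[OF V W basis] expansion_def
    by (intro sum.cong refl) (simp add: l2_inner_indicator[OF V])
  also have "\<dots> = (\<Sum>b\<in>B. l2_inner V b b)"
    by (subst sum.swap) (simp add: l2_inner_def)
  also have "\<dots> = (\<Sum>b\<in>B. 1)" by (intro sum.cong refl) (use B in \<open>auto simp: orthonormal_def\<close>)
  finally show ?thesis by simp
qed

lemma eigenspace_subspace: "l2_subspace V (eigenspace V adj E)"
proof -
  have "laplacian V adj (\<lambda>v. \<phi> v + k * \<psi> v) v = laplacian V adj \<phi> v + k * laplacian V adj \<psi> v" for \<phi> \<psi> k v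
    by (simp add: laplacian_def algebra_simps sum.distrib sum_subtractf sum_distrib_left)
  moreover have "laplacian V adj (\<lambda>_. 0) v = 0" for v by (simp add: laplacian_def)
  ultimately show ?thesis
    by (simp add: l2_subspace_def eigenspace_def l2_def subset_iff algebra_simps)
qed

text \<open>
  Functions with disjoint supports are orthogonal, and after normalization they extend to an
  orthonormal basis of the eigenspace, whose size is the trace.
\<close>

lemma trace_eigenprojection_ge:
  assumes V: "finite V" and fin: "finite I"
    and eig: "\<And>i. i \<in> I \<Longrightarrow> \<psi> i \<in> eigenspace V adj E"
    and nz: "\<And>i. i \<in> I \<Longrightarrow> \<psi> i \<noteq> (\<lambda>_. 0)"
    and disj: "\<And>i j v. i \<in> I \<Longrightarrow> j \<in> I \<Longrightarrow> i \<noteq> j \<Longrightarrow> \<psi> i v = 0 \<or> \<psi> j v = 0"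
  shows "\<exists>d::nat. op_trace V (orth_proj V (eigenspace V adj E)) = of_nat d \<and> card I \<le> d"
proof -
  let ?W = "eigenspace V adj E"
  have W: "l2_subspace V ?W" by (rule eigenspace_subspace)
  define e where "e = (\<lambda>i. normalized V (\<psi> i))"
  have l2: "\<psi> i \<in> l2 V" if "i \<in> I" for i using eig[OF that] by (simp add: eigenspace_def)
  have orth: "l2_inner V (\<psi> i) (\<psi> j) = 0" if "i \<in> I" "j \<in> I" "i \<noteq> j" for i j
    unfolding l2_inner_def using disj[OF that] by (intro sum.neutral) auto
  have inj: "inj_on e I" and on: "orthonormal V (e ` I)"
    unfolding e_def by (rule orthonormal_normalized_image[OF V l2 nz orth]; assumption)+
  have sub: "e ` I \<subseteq> ?W" unfolding e_def using normalized_in_subspace[OF W eig] by auto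
  obtain B where B: "orthonormal_basis V ?W B" "e ` I \<subseteq> B"
    using extend_to_orthonormal_basis[OF V W on sub] by blast
  have "card I = card (e ` I)" using inj by (simp add: card_image)
  also have "\<dots> \<le> card B" by (rule card_mono) (use B in \<open>auto simp: orthonormal_basis_def\<close>)
  finally show ?thesis using op_trace_orth_proj[OF V W B(1)] by blast
qed

lemma laplacian_self_adjoint:
  assumes V: "finite V" and sym: "symp adj"
  shows "l2_inner V (laplacian V adj \<phi>) \<psi> = l2_inner V \<phi> (laplacian V adj \<psi>)"
proof -
  let ?a = "\<lambda>u v. if adj u v then 1 else (0::complex)"
  have L: "laplacian V adj \<theta> v = (\<Sum>u\<in>V. ?a u v * (\<theta> v - \<theta> u))" for \<theta> v
  proof -
    have "laplacian V adj \<theta> v = (\<Sum>u\<in>V. if adj u v then \<theta> v - \<theta> u else 0)"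
      unfolding laplacian_def by (subst sum.inter_filter[OF V, symmetric]) simp
    also have "\<dots> = (\<Sum>u\<in>V. ?a u v * (\<theta> v - \<theta> u))" by (intro sum.cong) auto
    finally show ?thesis .
  qed
  have a: "?a u v = ?a v u" for u v using sym by (metis sympD)
  have "l2_inner V (laplacian V adj \<phi>) \<psi>
      = (\<Sum>v\<in>V. \<Sum>u\<in>V. ?a u v * (cnj (\<phi> v) * \<psi> v)) - (\<Sum>v\<in>V. \<Sum>u\<in>V. ?a u v * (cnj (\<phi> u) * \<psi> v))"
    unfolding l2_inner_def L sum_subtractf[symmetric] cnj_sum sum_distrib_right
    by (intro sum.cong refl) (auto simp: algebra_simps)
  also have "(\<Sum>v\<in>V. \<Sum>u\<in>V. ?a u v * (cnj (\<phi> u) * \<psi> v)) = (\<Sum>v\<in>V. \<Sum>u\<in>V. ?a u v * (cnj (\<phi> v) * \<psi> u))"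
    by (subst sum.swap) (intro sum.cong refl, simp add: a)
  also have "(\<Sum>v\<in>V. \<Sum>u\<in>V. ?a u v * (cnj (\<phi> v) * \<psi> v)) - (\<Sum>v\<in>V. \<Sum>u\<in>V. ?a u v * (cnj (\<phi> v) * \<psi> u))
      = l2_inner V \<phi> (laplacian V adj \<psi>)"
    unfolding l2_inner_def L sum_subtractf[symmetric] sum_distrib_left
    by (intro sum.cong refl) (auto simp: algebra_simps)
  finally show ?thesis .
qed

lemma eigenspaces_orthogonal:
  assumes V: "finite V" and sym: "symp adj"
    and "\<phi> \<in> eigenspace V adj E" "\<psi> \<in> eigenspace V adj E'" "E \<noteq> E'"
  shows "l2_inner V \<phi> \<psi> = 0"
proof -
  have 1: "l2_inner V (laplacian V adj \<phi>) \<psi> = of_real E * l2_inner V \<phi> \<psi>"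
    using assms(3) by (simp add: l2_inner_def eigenspace_def sum_distrib_left mult_ac)
  have 2: "l2_inner V \<phi> (laplacian V adj \<psi>) = of_real E' * l2_inner V \<phi> \<psi>"
    using assms(4) by (simp add: l2_inner_def eigenspace_def sum_distrib_left mult_ac)
  have "of_real E * l2_inner V \<phi> \<psi> = of_real E' * l2_inner V \<phi> \<psi>"
    using laplacian_self_adjoint[where \<phi> = \<phi> and \<psi> = \<psi>, OF V sym] unfolding 1 2 .
  then show ?thesis using assms(5) by simp
qed

text \<open>
  Normalized eigenfunctions, one for each eigenvalue, form an orthonormal set, which is finite by
  Bessel's inequality. Without this the sum over the spectrum in \<^const>\<open>fun_calculus\<close> would be 0.
\<close>

lemma spectrum_finite:
  assumes V: "finite V" and sym: "symp adj"
  shows "finite (spectrum V adj)"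
proof -
  define \<psi> where "\<psi> E = (SOME \<psi>. \<psi> \<in> eigenspace V adj E \<and> \<psi> \<noteq> (\<lambda>_. 0))" for E
  have \<psi>: "\<psi> E \<in> eigenspace V adj E" "\<psi> E \<noteq> (\<lambda>_. 0)" if "E \<in> spectrum V adj" for E
  proof -
    have "\<exists>\<phi>. \<phi> \<in> eigenspace V adj E \<and> \<phi> \<noteq> (\<lambda>_. 0)" using that by (auto simp: spectrum_def)
    from someI_ex[OF this] show "\<psi> E \<in> eigenspace V adj E" "\<psi> E \<noteq> (\<lambda>_. 0)"
      by (simp_all add: \<psi>_def)
  qed
  have l2: "\<psi> E \<in> l2 V" if "E \<in> spectrum V adj" for E using \<psi>(1)[OF that] by (simp add: eigenspace_def)
  have orth: "l2_inner V (\<psi> E) (\<psi> E') = 0"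
    if "E \<in> spectrum V adj" "E' \<in> spectrum V adj" "E \<noteq> E'" for E E'
    by (rule eigenspaces_orthogonal[OF V sym \<psi>(1)[OF that(1)] \<psi>(1)[OF that(2)] that(3)])
  note e = orthonormal_normalized_image[OF V l2 \<psi>(2) orth]
  have "finite ((\<lambda>E. normalized V (\<psi> E)) ` spectrum V adj)"
    by (rule orthonormal_finite[OF V], rule e(1)) assumption+
  then show ?thesis by (rule finite_imageD) (rule e(2); assumption)
qed

text \<open>The values on which \<^const>\<open>eigenvalue_measure\<close> is built do form a measure: they are those of a
  finite sum of point masses.\<close>

lemma eigenvalue_measure_as_sum:
  assumes V: "finite V" and sym: "symp adj"
  obtains M d where "eigenvalue_measure V adj = distr (point_measure (spectrum V adj) M) borel (\<lambda>x. x)"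
    "\<And>E. M E = ennreal (real (d E) / real (card V))"
    "\<And>E. op_trace V (orth_proj V (eigenspace V adj E)) = of_nat (d E)"
proof -
  have "\<exists>d::nat. op_trace V (orth_proj V (eigenspace V adj E)) = of_nat d" for E
    using trace_eigenprojection_ge[OF V, of "{}" _ adj E] by auto
  then obtain d :: "real \<Rightarrow> nat"
    where d: "\<And>E. op_trace V (orth_proj V (eigenspace V adj E)) = of_nat (d E)" by metis
  define M where "M = (\<lambda>E. ennreal (real (d E) / real (card V)))"
  let ?S = "spectrum V adj"
  have fin: "finite ?S" by (rule spectrum_finite[OF V sym])
  let ?N = "distr (point_measure ?S M) borel (\<lambda>x::real. x)"
  have meas: "(\<lambda>x::real. x) \<in> point_measure ?S M \<rightarrow>\<^sub>M borel"
    by (simp add: measurable_point_measure_eq1)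
  have val: "ennreal (Re (op_trace V (fun_calculus V adj (indicator B))) / real (card V)) = emeasure ?N B"
    if B: "B \<in> sets borel" for B
  proof -
    have "op_trace V (fun_calculus V adj (indicator B))
        = (\<Sum>E\<in>?S. of_real (indicator B E) * op_trace V (orth_proj V (eigenspace V adj E)))"
      unfolding op_trace_def fun_calculus_def sum_distrib_left by (rule sum.swap)
    also have "\<dots> = of_real (\<Sum>E\<in>?S. indicator B E * real (d E))" by (simp add: d)
    finally have "Re (op_trace V (fun_calculus V adj (indicator B))) / real (card V)
        = (\<Sum>E\<in>?S. indicator B E * real (d E) / real (card V))"
      by (simp add: sum_divide_distrib)
    also have "\<dots> = (\<Sum>E\<in>?S \<inter> B. real (d E) / real (card V))"
      by (rule sum.mono_neutral_cong_right) (use fin in \<open>auto simp: indicator_def\<close>)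
    finally have "ennreal (Re (op_trace V (fun_calculus V adj (indicator B))) / real (card V))
        = (\<Sum>E\<in>?S \<inter> B. M E)" by (simp add: M_def sum_nonneg flip: sum_ennreal)
    also have "\<dots> = emeasure (point_measure ?S M) (?S \<inter> B)"
      using fin by (simp add: emeasure_point_measure_finite)
    also have "\<dots> = emeasure ?N B"
      using B by (subst emeasure_distr[OF meas]) (auto simp: space_point_measure Int_commute)
    finally show ?thesis .
  qed
  have "eigenvalue_measure V adj = measure_of UNIV (sets borel) (emeasure ?N)"
    unfolding eigenvalue_measure_def
    by (rule measure_of_eq) (auto intro!: val simp: sets.sigma_sets_eq[of borel, simplified])
  also have "\<dots> = ?N" using measure_of_of_measure[of ?N] by simp
  finally show ?thesis by (rule that) (use M_def d in auto)
qed

lemma finite_measure_eigenvalue_measure: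
  assumes V: "finite V" and sym: "symp adj"
  shows "finite_measure (eigenvalue_measure V adj)"
proof -
  obtain M d where M: "eigenvalue_measure V adj = distr (point_measure (spectrum V adj) M) borel (\<lambda>x. x)"
    "\<And>E. M E = ennreal (real (d E) / real (card V))"
    using eigenvalue_measure_as_sum[OF assms] by metis
  have "finite_measure (point_measure (spectrum V adj) M)"
    by (rule finite_measureI)
      (use spectrum_finite[OF assms] in \<open>auto simp: space_point_measure emeasure_point_measure_finite M(2)\<close>)
  then show ?thesis unfolding M(1)
    by (rule finite_measure.finite_measure_distr) (simp add: measurable_point_measure_eq1)
qed

lemma sets_eigenvalue_measure: "sets (eigenvalue_measure V adj) = sets borel"
  unfolding eigenvalue_measure_def
  by (metis sets.sets_measure_of_eq sets_measure_of_conv space_borel sets.space_closed)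

lemma eigenvalue_measure_singleton_ge:
  assumes V: "finite V" and sym: "symp adj" and fin: "finite I"
    and eig: "\<And>i. i \<in> I \<Longrightarrow> \<psi> i \<in> eigenspace V adj E"
    and nz: "\<And>i. i \<in> I \<Longrightarrow> \<psi> i \<noteq> (\<lambda>_. 0)"
    and disj: "\<And>i j v. i \<in> I \<Longrightarrow> j \<in> I \<Longrightarrow> i \<noteq> j \<Longrightarrow> \<psi> i v = 0 \<or> \<psi> j v = 0"
  shows "measure (eigenvalue_measure V adj) {E} \<ge> real (card I) / real (card V)"
proof (cases "I = {}")
  case False
  then have E: "E \<in> spectrum V adj" using eig nz unfolding spectrum_def by blast
  obtain M d where M: "eigenvalue_measure V adj = distr (point_measure (spectrum V adj) M) borel (\<lambda>x. x)"
    "\<And>E. M E = ennreal (real (d E) / real (card V))"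
    "\<And>E. op_trace V (orth_proj V (eigenspace V adj E)) = of_nat (d E)"
    using eigenvalue_measure_as_sum[OF V sym] by metis
  have "\<exists>k::nat. op_trace V (orth_proj V (eigenspace V adj E)) = of_nat k \<and> card I \<le> k"
    by (rule trace_eigenprojection_ge[where \<psi> = \<psi>, OF V fin eig nz disj])
  then have "card I \<le> d E" using M(3)[of E] by auto
  moreover have "measure (eigenvalue_measure V adj) {E} = real (d E) / real (card V)"
  proof -
    have "emeasure (eigenvalue_measure V adj) {E} = M E"
      unfolding M(1) using E spectrum_finite[OF V sym]
      by (subst emeasure_distr)
        (auto simp: measurable_point_measure_eq1 space_point_measure emeasure_point_measure_finite
          Int_insert_left cong: if_cong)
    then show ?thesis by (simp add: measure_def M(2))
  qed
  ultimately show ?thesis by (simp add: divide_right_mono)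
qed simp


section \<open>Atoms of weak limits\<close>

lemma cdf_jump_eq_atom:
  assumes "real_distribution \<nu>"
  shows "Lim (at_right E) (cdf \<nu>) - Lim (at_left E) (cdf \<nu>) = measure \<nu> {E}"
proof -
  interpret real_distribution \<nu> by fact
  have "(cdf \<nu> \<longlongrightarrow> cdf \<nu> E) (at_right E)"
    using cdf_is_right_cont by (simp add: continuous_within)
  then have R: "Lim (at_right E) (cdf \<nu>) = cdf \<nu> E" by (intro tendsto_Lim) auto
  have L: "Lim (at_left E) (cdf \<nu>) = measure \<nu> {..<E}"
    by (intro tendsto_Lim cdf_at_left) auto
  have "cdf \<nu> E = measure \<nu> ({..<E} \<union> {E})"
    unfolding cdf_def by (rule arg_cong[of _ _ "measure \<nu>"]) auto
  also have "\<dots> = measure \<nu> {..<E} + measure \<nu> {E}"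
    by (rule finite_measure_Union) auto
  finally show ?thesis by (simp add: R L)
qed

text \<open>
  Tent functions of height 1 at \<open>E\<close> dominate the indicator of \<open>E\<close>, and as their supports shrink to \<open>E\<close>
  their integrals decrease to the mass of \<open>E\<close>.
\<close>

lemma atom_of_weak_limit_ge:
  fixes \<mu> :: "nat \<Rightarrow> real measure"
  assumes \<nu>: "real_distribution \<nu>"
    and \<mu>: "\<And>n. finite_measure (\<mu> n)" "\<And>n. sets (\<mu> n) = sets borel"
    and conv: "\<And>f :: real \<Rightarrow> real. continuous_on UNIV f \<Longrightarrow> (f \<longlongrightarrow> 0) at_infinity \<Longrightarrow>
        (\<lambda>n. \<integral>x. f x \<partial>\<mu> n) \<longlonglongrightarrow> (\<integral>x. f x \<partial>\<nu>)"
    and ev: "\<forall>\<^sub>F n in sequentially. measure (\<mu> n) {E} \<ge> c"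
  shows "measure \<nu> {E} \<ge> c"
proof -
  interpret real_distribution \<nu> by fact
  have bd: "measure \<nu> {E - 1 / real (Suc k) .. E + 1 / real (Suc k)} \<ge> c" for k
  proof -
    define \<delta> where "\<delta> = 1 / real (Suc k)"
    have \<delta>: "\<delta> > 0" by (simp add: \<delta>_def)
    define f where "f = (\<lambda>x::real. max 0 (1 - \<bar>x - E\<bar> / \<delta>))"
    have cont: "continuous_on UNIV f" unfolding f_def using \<delta> by (intro continuous_intros) auto
    have meas: "f \<in> borel_measurable borel" by (rule borel_measurable_continuous_onI[OF cont])
    have f01: "0 \<le> f x" "f x \<le> 1" for x using \<delta> by (auto simp: f_def)
    have f0: "f x = 0" if "x \<notin> {E - \<delta>..E + \<delta>}" for x
      using that \<delta> by (auto simp: f_def field_simps abs_if)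
    have fE: "f E = 1" by (simp add: f_def)
    have "\<forall>\<^sub>F x in at_infinity. f x = 0"
      unfolding eventually_at_infinity
      by (rule exI[of _ "\<bar>E\<bar> + \<delta> + 1"]) (auto intro!: f0)
    then have "(f \<longlongrightarrow> 0) at_infinity" by (rule tendsto_eventually)
    from conv[OF cont this] have lim: "(\<lambda>n. \<integral>x. f x \<partial>\<mu> n) \<longlonglongrightarrow> (\<integral>x. f x \<partial>\<nu>)" .
    have le: "measure (\<mu> n) {E} \<le> (\<integral>x. f x \<partial>\<mu> n)" for n
    proof -
      interpret m: finite_measure "\<mu> n" by (rule \<mu>)
      have mb: "g \<in> borel_measurable (\<mu> n)" if "g \<in> borel_measurable borel" for g :: "real \<Rightarrow> real"
        using that measurable_cong_sets[OF \<mu>(2) refl] by blast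
      have sp: "space (\<mu> n) = UNIV" using sets_eq_imp_space_eq[OF \<mu>(2)] by simp
      have "measure (\<mu> n) {E} = (\<integral>x. indicator {E} x \<partial>\<mu> n)"
        using \<mu>(2) by (simp add: sp)
      also have "\<dots> \<le> (\<integral>x. f x \<partial>\<mu> n)"
      proof (rule integral_mono)
        show "integrable (\<mu> n) (\<lambda>x. indicator {E} x :: real)"
          by (rule m.integrable_const_bound[of _ 1]) (auto intro!: mb)
        show "integrable (\<mu> n) f"
          by (rule m.integrable_const_bound[of _ 1]) (auto intro!: mb meas simp: f01)
        show "\<And>x. indicator {E} x \<le> f x" using f01 fE by (auto simp: indicator_def)
      qed
      finally show ?thesis .
    qed
    have "c \<le> (\<integral>x. f x \<partial>\<nu>)"
      by (rule tendsto_lowerbound[OF lim _ sequentially_bot])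
        (use ev in eventually_elim, use le order_trans in blast)
    also have "\<dots> \<le> (\<integral>x. indicator {E - \<delta>..E + \<delta>} x \<partial>\<nu>)"
    proof (rule integral_mono)
      show "integrable \<nu> f"
        by (rule integrable_const_bound[of _ 1]) (use meas in \<open>auto simp: f01\<close>)
      show "integrable \<nu> (\<lambda>x. indicator {E - \<delta>..E + \<delta>} x :: real)"
        by (rule integrable_const_bound[of _ 1]) auto
      show "\<And>x. f x \<le> indicator {E - \<delta>..E + \<delta>} x" using f0 f01 by (auto simp: indicator_def)
    qed
    also have "\<dots> = measure \<nu> {E - \<delta>..E + \<delta>}" by simp
    finally show ?thesis by (simp add: \<delta>_def)
  qed
  let ?A = "\<lambda>k. {E - 1 / real (Suc k) .. E + 1 / real (Suc k)}"
  have "(\<Inter>k. ?A k) = {E}"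
  proof (intro equalityI subsetI)
    fix x assume x: "x \<in> (\<Inter>k. ?A k)"
    have "\<bar>x - E\<bar> \<le> 1 / real (Suc k)" for k using x by (auto simp: abs_le_iff algebra_simps)
    moreover have "(\<lambda>k. 1 / real (Suc k)) \<longlonglongrightarrow> 0" using LIMSEQ_inverse_real_of_nat by (simp add: inverse_eq_divide)
    ultimately have "\<bar>x - E\<bar> \<le> 0" using LIMSEQ_le_const by blast
    then show "x \<in> {E}" by simp
  qed auto
  moreover have "(\<lambda>k. measure \<nu> (?A k)) \<longlonglongrightarrow> measure \<nu> (\<Inter>k. ?A k)"
  proof (rule finite_Lim_measure_decseq)
    show "decseq ?A"
    proof (rule decseq_SucI)
      fix n
      have "1 / real (Suc (Suc n)) \<le> 1 / real (Suc n)" by (simp add: field_simps)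
      then show "?A (Suc n) \<subseteq> ?A n" by auto
    qed
  qed auto
  ultimately have "(\<lambda>k. measure \<nu> (?A k)) \<longlonglongrightarrow> measure \<nu> {E}" by simp
  then show ?thesis by (rule LIMSEQ_le_const) (use bd in blast)
qed


section \<open>Coordinates relative to a tile\<close>

text \<open>
  The pair \<open>(a, b)\<close> stands for \<open>a + b \<phi>\<close>, and a point \<open>(x, y)\<close> is relative to the frame of a tile:
  the origin is its first corner, the basis vectors lead to the second and the third corner. Dissection and
  reflection in a side are affine, so the resulting coordinates are the same for all tiles of one shape.
\<close>

type_synonym zphi = "int \<times> int"
type_synonym pt = "zphi \<times> zphi"

definition gval :: "zphi \<Rightarrow> real" where
  "gval z = of_int (fst z) + of_int (snd z) * golden"

fun gadd :: "zphi \<Rightarrow> zphi \<Rightarrow> zphi" where "gadd (a, b) (c, d) = (a + c, b + d)"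
fun gsub :: "zphi \<Rightarrow> zphi \<Rightarrow> zphi" where "gsub (a, b) (c, d) = (a - c, b - d)"
fun gmul :: "zphi \<Rightarrow> zphi \<Rightarrow> zphi" where
  "gmul (a, b) (c, d) = (a * c + b * d, a * d + b * c + b * d)"

fun padd :: "pt \<Rightarrow> pt \<Rightarrow> pt" where "padd (x, y) (x', y') = (gadd x x', gadd y y')"
fun psub :: "pt \<Rightarrow> pt \<Rightarrow> pt" where "psub (x, y) (x', y') = (gsub x x', gsub y y')"
fun pscale :: "zphi \<Rightarrow> pt \<Rightarrow> pt" where "pscale k (x, y) = (gmul k x, gmul k y)"

fun ca :: "'p triangle \<Rightarrow> 'p" where "ca (Acute a b c) = a" | "ca (Obtuse a b c) = a"
fun cb :: "'p triangle \<Rightarrow> 'p" where "cb (Acute a b c) = b" | "cb (Obtuse a b c) = b"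
fun cc :: "'p triangle \<Rightarrow> 'p" where "cc (Acute a b c) = c" | "cc (Obtuse a b c) = c"

fun corners :: "'p triangle \<Rightarrow> 'p list" where
  "corners (Acute a b c) = [a, b, c]" | "corners (Obtuse a b c) = [a, b, c]"

fun acute :: "'p triangle \<Rightarrow> bool" where
  "acute (Acute a b c) = True" | "acute (Obtuse a b c) = False"

definition pos :: "tile \<Rightarrow> pt \<Rightarrow> complex" where
  "pos s p = ca s + gval (fst p) *\<^sub>R (cb s - ca s) + gval (snd p) *\<^sub>R (cc s - ca s)"

definition lpos :: "pt triangle \<Rightarrow> pt \<Rightarrow> pt" where
  "lpos s p = padd (ca s) (padd (pscale (fst p) (psub (cb s) (ca s))) (pscale (snd p) (psub (cc s) (ca s))))"

text \<open>
  \<open>place s f\<close> is the tile with coordinates \<open>f\<close> relative to \<open>s\<close>. If \<open>f\<close> has coordinates relative to \<open>s\<close>,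
  and \<open>g\<close> relative to \<open>f\<close>, then \<open>lplace f g\<close> has coordinates relative to \<open>s\<close>.
\<close>

definition place :: "tile \<Rightarrow> pt triangle \<Rightarrow> tile" where "place s = map_triangle (pos s)"
definition lplace :: "pt triangle \<Rightarrow> pt triangle \<Rightarrow> pt triangle" where "lplace s = map_triangle (lpos s)"

definition PA :: pt where "PA = ((0, 0), (0, 0))"
definition PB :: pt where "PB = ((1, 0), (0, 0))"
definition PC :: pt where "PC = ((0, 0), (1, 0))"

definition std :: "bool \<Rightarrow> pt triangle" where
  "std k = (if k then Acute PA PB PC else Obtuse PA PB PC)"

text \<open>
  The dissection in coordinates; \<open>(-1, 1)\<close> is \<open>\<phi> - 1 = 1 / \<phi>\<close>.
\<close>

fun lchildren :: "pt triangle \<Rightarrow> pt triangle list" where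
  "lchildren (Acute a b c) =
     (let p = padd a (pscale (-1, 1) (psub b a)) in [Acute c p b, Obtuse p c a])"
| "lchildren (Obtuse a b c) =
     (let q = padd b (pscale (-1, 1) (psub a b)); r = padd b (pscale (-1, 1) (psub c b))
      in [Obtuse r c a, Obtuse q r b, Acute r q a])"

definition lsubst :: "pt triangle list \<Rightarrow> pt triangle list" where
  "lsubst L = concat (map lchildren L)"

fun ldesc :: "nat list \<Rightarrow> pt triangle \<Rightarrow> pt triangle" where
  "ldesc [] f = f"
| "ldesc (i # w) f = ldesc w (lchildren f ! i)"

datatype side = AB | BC | CA

text \<open>
  The tiles that can lie on the other side of a side of a tile, acute in the case \<open>True\<close>. Sides carry the same
  name in both tiles. The possible partners are the mirror image, except at the side \<open>AB\<close> of acute tiles, and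
  across the sides of length 1 also a tile of the other shape; then sides \<open>AB\<close> are
  traversed in opposite directions and sides \<open>CA\<close> in the same direction. By \<open>glue_inner\<close> and \<open>glue_outer\<close>
  below this list is closed under substitution.
\<close>

fun across :: "bool \<Rightarrow> side \<Rightarrow> pt triangle list" where
  "across True AB = [Obtuse PB PA ((1, 1), (0, -1))]"
| "across True BC = [Acute ((1, 0), (1, 0)) PB PC]"
| "across True CA = [Acute PA ((-1, 0), (0, 1)) PC, Obtuse PA ((0, -1), (1, 0)) PC]"
| "across False AB = [Acute PB PA ((0, 0), (1, -1)), Obtuse PA PB ((1, -1), (-1, 0))]"
| "across False BC = [Obtuse ((1, 0), (1, 0)) PB PC]"
| "across False CA = [Acute PA ((1, -1), (-1, 1)) PC, Obtuse PA ((-1, 0), (1, -1)) PC]"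

text \<open>
  The sides of children that a side of the dissected tile is composed of, each given by the
  index of the child and the name of the side.
\<close>
fun subsides :: "bool \<Rightarrow> side \<Rightarrow> (nat \<times> side) list" where
  "subsides True AB = [(1, CA), (0, BC)]"
| "subsides True BC = [(0, CA)]"
| "subsides True CA = [(1, BC)]"
| "subsides False AB = [(1, CA), (2, BC)]"
| "subsides False BC = [(1, BC), (0, AB)]"
| "subsides False CA = [(0, BC)]"

definition flipAB :: "pt triangle" where "flipAB = across False AB ! 1"
definition flipBC :: "pt triangle" where "flipBC = across False BC ! 0"

text \<open>
  Reflecting an obtuse tile alternately in its sides \<open>AB\<close> and \<open>BC\<close> turns it around its second corner. The angle
  there is 36 degrees, so that the tenth reflection closes up the star.
\<close>

fun turn :: "nat \<Rightarrow> pt triangle" where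
  "turn 0 = std False"
| "turn (Suc n) = lplace (turn n) (if even n then flipAB else flipBC)"

definition lstar :: "pt triangle list" where "lstar = map turn [0..<10]"

text \<open>
  A flower consists of ten cells, one for each tile of the star and mirror images of each other: the cell of a
  star tile contains that tile, an acute and an obtuse wing and the two links between these wings.
\<close>

definition link1 where "link1 = across False CA ! 0"
definition obtuse_wing_coords where "obtuse_wing_coords = lplace link1 (across True AB ! 0)"
definition acute_wing_coords where "acute_wing_coords = lplace link1 (across True BC ! 0)"
definition link2 where "link2 = lplace acute_wing_coords (across True AB ! 0)"

definition lcell :: "pt triangle list" where
  "lcell = [std False, link1, obtuse_wing_coords, acute_wing_coords, link2]"

text \<open>
  Every tile of a star determines the same star.
\<close>

lemma star_closed: "\<forall>f\<in>set lstar. set (map (lplace f) lstar) = set lstar"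
  unfolding lstar_def by code_simp

text \<open>
  Partners of a child across a side that lies inside the dissected tile are found among the other
  children.
\<close>

lemma glue_inner:
  "\<forall>k\<in>{True,False}. \<forall>i<length (lchildren (std k)). \<forall>e\<in>{AB,BC,CA}.
     (\<exists>e0\<in>{AB,BC,CA}. (i, e) \<in> set (subsides k e0)) \<or>
     (\<exists>m\<in>set (across (acute (lchildren (std k) ! i)) e). lplace (lchildren (std k) ! i) m \<in> set (lchildren (std k)))"
  by code_simp

text \<open>
  Partners of a child across a side that lies on the boundary of the dissected tile are found among the
  children of the partner of that tile.
\<close>

lemma glue_outer:
  "\<forall>k\<in>{True,False}. \<forall>e\<in>{AB,BC,CA}. \<forall>f\<in>set (across k e). \<forall>(i, e1)\<in>set (subsides k e).
     (\<exists>m\<in>set (across (acute (lchildren (std k) ! i)) e1). lplace (lchildren (std k) ! i) m \<in> set (lchildren f))"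
  by code_simp

text \<open>
  Under two substitutions the second corner of an obtuse tile becomes the third corner of its second child and
  then again the second corner of a grandchild. This is how a star reproduces itself.
\<close>

definition llift :: "pt triangle" where "llift = ldesc [1, 0] (std False)"

lemma lift_cell: "set (map (lplace llift) lcell) \<subseteq> set (lsubst (lsubst [std False]))"
  by code_simp

text \<open>
  The addresses of those tiles among the descendants after five substitutions which belong to the star centred
  on a side: five on either side of the line, found by enumeration. The centre divides the side in the golden ratio.
\<close>

fun words :: "bool \<Rightarrow> side \<Rightarrow> nat list list" where
  "words True AB = [[0,0,0,1,0],[0,0,1,1,0],[1,0,0,1,0],[1,2,0,1,0],[1,2,1,1,0]]"
| "words False AB = [[1,0,0,1,0],[1,2,0,1,0],[1,2,1,1,0],[2,0,0,1,0],[2,0,1,1,0]]"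
| "words False BC = [[0,0,0,1,0],[0,2,0,1,0],[0,2,1,1,0],[1,1,0,1,0],[2,1,0,1,0]]"
| "words _ _ = []"

definition seeds :: "bool \<Rightarrow> side \<Rightarrow> pt triangle list" where
  "seeds k e = map (\<lambda>w. ldesc w (std k)) (words k e)"

text \<open>
  The star of a seed consists of the seeds of the tile and of the seeds of its partner \<open>m\<close> across the
  same side, for every possible partner.
\<close>

lemma seed_star:
  "\<forall>k\<in>{True,False}. \<forall>e\<in>{AB,BC,CA}. \<forall>m\<in>set (across k e). \<forall>s\<in>set (seeds k e).
    set (map (lplace s) lstar) \<subseteq> set (seeds k e) \<union> set (map (lplace m) (seeds (acute m) e))"
  by code_simp

text \<open>
  The line of the side is a mirror of the flower and does not cut its cells, so every cell is
  contained in the fivefold substitution of a single tile.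
\<close>

lemma seed_cell:
  "\<forall>k\<in>{True,False}. \<forall>e\<in>{AB,BC,CA}. \<forall>s\<in>set (seeds k e).
    set (map (lplace s) lcell) \<subseteq> set ((lsubst ^^ 5) [std k])"
  by code_simp


lemma golden_sq: "golden * golden = golden + 1"
  by (simp add: golden_def field_simps)

lemma golden_gt_1: "golden > 1"
  by (simp add: golden_def)

lemma golden_lt_2: "golden < 2"
proof -
  have "sqrt 5 < sqrt (3\<^sup>2)" by (subst real_sqrt_less_iff) simp
  then show ?thesis by (simp add: golden_def)
qed

lemma inverse_golden: "inverse golden = golden - 1"
  using golden_sq golden_gt_1 by (simp add: field_simps)

lemma gval_simps:
  "gval (gadd x y) = gval x + gval y" "gval (gsub x y) = gval x - gval y"
  "gval (gmul x y) = gval x * gval y"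
  "gval (0, 0) = 0" "gval (1, 0) = 1" "gval (-1, 1) = inverse golden"
proof -
  obtain a b c d where xy: "x = (a, b)" "y = (c, d)" by fastforce
  show "gval (gadd x y) = gval x + gval y" "gval (gsub x y) = gval x - gval y"
    by (simp_all add: xy gval_def algebra_simps)
  have "gval x * gval y = of_int (a * c) + of_int (a * d + b * c) * golden + of_int (b * d) * (golden * golden)"
    by (simp add: xy gval_def algebra_simps)
  then show "gval (gmul x y) = gval x * gval y"
    unfolding golden_sq by (simp add: xy gval_def algebra_simps)
qed (simp_all add: gval_def inverse_golden)

text \<open>The form \<open>x\<^sup>2 - x y - y\<^sup>2\<close> is the norm of \<open>x + y \<phi>\<close>. It is odd unless both arguments are even.\<close>

lemma golden_norm_form_eq_0:
  fixes x y :: int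
  assumes "x * x - x * y - y * y = 0"
  shows "x = 0 \<and> y = 0"
  using assms
proof (induction "nat \<bar>x\<bar> + nat \<bar>y\<bar>" arbitrary: x y rule: less_induct)
  case less
  have "even (x * x - x * y - y * y)" using less.prems by simp
  then have "even x" "even y" by auto
  then obtain a b where ab: "x = 2 * a" "y = 2 * b" by (auto elim!: evenE)
  have "a * a - a * b - b * b = 0" using less.prems unfolding ab by (simp add: algebra_simps)
  show ?case
  proof (cases "a = 0 \<and> b = 0")
    case False
    then have "nat \<bar>a\<bar> + nat \<bar>b\<bar> < nat \<bar>x\<bar> + nat \<bar>y\<bar>" unfolding ab by linarith
    from less.hyps[OF this \<open>a * a - a * b - b * b = 0\<close>] show ?thesis by (simp add: ab)
  qed (simp add: ab)
qed

lemma gval_eq_0: "gval z = 0 \<longleftrightarrow> z = (0, 0)"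
proof
  assume 0: "gval z = 0"
  obtain x y where z: "z = (x, y)" by fastforce
  have "real_of_int (x * x + x * y - y * y)
      = (of_int x + of_int y * golden) * (of_int x + of_int y * (1 - golden))
        + of_int y * of_int y * (golden * golden - golden - 1)"
    by (simp add: algebra_simps)
  also have "\<dots> = 0" using 0 by (simp add: z gval_def golden_sq)
  finally have "(- x) * (- x) - (- x) * y - y * y = 0"
    by (metis (no_types, opaque_lifting) diff_minus_eq_add minus_mult_commute minus_mult_minus mult_minus_left of_int_eq_0_iff)
  from golden_norm_form_eq_0[OF this] show "z = (0, 0)" by (simp add: z)
qed (simp add: gval_def)

lemma gval_inj: "gval z = gval z' \<longleftrightarrow> z = z'"
proof -
  have "gval z = gval z' \<longleftrightarrow> gval (gsub z z') = 0" by (simp add: gval_simps)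
  also have "\<dots> \<longleftrightarrow> z = z'" unfolding gval_eq_0 by (cases z; cases z') auto
  finally show ?thesis .
qed

section \<open>Tiles and packings\<close>

definition rpos :: "tile \<Rightarrow> real \<Rightarrow> real \<Rightarrow> complex" where
  "rpos s x y = ca s + x *\<^sub>R (cb s - ca s) + y *\<^sub>R (cc s - ca s)"

lemma pos_rpos: "pos s p = rpos s (gval (fst p)) (gval (snd p))"
  by (simp add: pos_def rpos_def)

text \<open>
  The cosine of the apex angle, which is 36 degrees for acute and 108 degrees for obtuse tiles.
\<close>

definition apex_cos :: "bool \<Rightarrow> real" where
  "apex_cos k = (if k then golden / 2 else (1 - golden) / 2)"

lemma is_tile_iff:
  "is_tile s \<longleftrightarrow> (cb s - ca s) \<bullet> (cb s - ca s) = 1 \<and> (cc s - ca s) \<bullet> (cc s - ca s) = 1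
     \<and> (cb s - ca s) \<bullet> (cc s - ca s) = apex_cos (acute s)"
proof -
  have d: "dist a b = d \<longleftrightarrow> (b - a) \<bullet> (b - a) = d\<^sup>2" if "d \<ge> 0" for a b :: complex and d
  proof -
    have "dist a b = d \<longleftrightarrow> (norm (b - a))\<^sup>2 = d\<^sup>2"
      using that by (simp add: dist_norm norm_minus_commute)
    then show ?thesis by (simp add: power2_norm_eq_inner)
  qed
  have bc: "(c - b) \<bullet> (c - b) = (b - a) \<bullet> (b - a) + (c - a) \<bullet> (c - a) - 2 * ((b - a) \<bullet> (c - a))"
    for a b c :: complex by (simp add: inner_diff inner_commute)
  have gs: "golden\<^sup>2 = golden + 1" by (simp add: power2_eq_square golden_sq)
  have ig: "(1 / golden)\<^sup>2 = 2 - golden"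
    using golden_gt_1 golden_sq inverse_golden
    by (simp add: power2_eq_square field_simps)
  have pos: "golden \<ge> 0" "1 / golden \<ge> 0" using golden_gt_1 by auto
  show ?thesis
  proof (cases s)
    case (Acute a b c)
    show ?thesis
      unfolding Acute is_tile.simps d[OF pos(2)] d[OF zero_le_one] bc[of c b a] ig
      by (auto simp: apex_cos_def)
  next
    case (Obtuse a b c)
    show ?thesis
      unfolding Obtuse is_tile.simps d[OF pos(1)] d[OF zero_le_one] bc[of c b a] gs
      by (auto simp: apex_cos_def field_simps)
  qed
qed

lemma apex_cos_bound: "\<bar>apex_cos k\<bar> \<le> golden / 2"
  using golden_gt_1 by (auto simp: apex_cos_def)

text \<open>The two legs at the apex span the plane, with the constant \<open>1 - \<phi>/2\<close> for both shapes.\<close>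

lemma norm_leg_combination:
  assumes "is_tile s"
  shows "(norm (x *\<^sub>R (cb s - ca s) + y *\<^sub>R (cc s - ca s)))\<^sup>2 = x\<^sup>2 + y\<^sup>2 + 2 * x * y * apex_cos (acute s)"
    (is "_ = ?r")
    and "(norm (x *\<^sub>R (cb s - ca s) + y *\<^sub>R (cc s - ca s)))\<^sup>2 \<ge> (1 - golden / 2) * (x\<^sup>2 + y\<^sup>2)"
proof -
  define u v where uv: "u = cb s - ca s" "v = cc s - ca s"
  have "u \<bullet> u = 1" "v \<bullet> v = 1" "u \<bullet> v = apex_cos (acute s)"
    using assms unfolding is_tile_iff uv by auto
  then show 1: "(norm (x *\<^sub>R (cb s - ca s) + y *\<^sub>R (cc s - ca s)))\<^sup>2 = ?r"
    unfolding uv[symmetric] power2_norm_eq_inner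
    by (simp add: inner_add inner_commute[of v u] power2_eq_square algebra_simps)
  have "\<bar>2 * x * y * apex_cos (acute s)\<bar> = \<bar>2 * x * y\<bar> * \<bar>apex_cos (acute s)\<bar>" by (simp add: abs_mult)
  also have "\<dots> \<le> (x\<^sup>2 + y\<^sup>2) * (golden / 2)"
  proof (rule mult_mono)
    show "\<bar>2 * x * y\<bar> \<le> x\<^sup>2 + y\<^sup>2"
      using sum_squares_bound[of x y] sum_squares_bound[of x "-y"] by (simp add: abs_le_iff)
  qed (rule apex_cos_bound, simp_all)
  finally show "(norm (x *\<^sub>R (cb s - ca s) + y *\<^sub>R (cc s - ca s)))\<^sup>2 \<ge> (1 - golden / 2) * (x\<^sup>2 + y\<^sup>2)"
    unfolding 1 by (simp add: algebra_simps abs_le_iff)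
qed

lemma leg_combination_eq_0:
  assumes "is_tile s" "x *\<^sub>R (cb s - ca s) + y *\<^sub>R (cc s - ca s) = 0"
  shows "x = 0 \<and> y = 0"
proof -
  have "(1 - golden / 2) * (x\<^sup>2 + y\<^sup>2) \<le> 0"
    using norm_leg_combination(2)[OF assms(1), of x y] assms(2) by simp
  moreover have "1 - golden / 2 > 0" using golden_lt_2 by simp
  ultimately have "x\<^sup>2 + y\<^sup>2 \<le> 0" by (simp add: mult_le_0_iff)
  then show ?thesis by (simp add: sum_power2_le_zero_iff)
qed

lemma rpos_inj:
  assumes "is_tile s" "rpos s x y = rpos s x' y'" shows "x = x' \<and> y = y'"
proof -
  have "(x - x') *\<^sub>R (cb s - ca s) + (y - y') *\<^sub>R (cc s - ca s) = 0"
    using assms(2) by (simp add: rpos_def algebra_simps)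
  from leg_combination_eq_0[OF assms(1) this] show ?thesis by simp
qed

lemma pos_inj: "is_tile s \<Longrightarrow> pos s p = pos s p' \<longleftrightarrow> p = p'"
  unfolding pos_rpos using rpos_inj gval_inj by (metis prod.collapse)

lemma region_hull: "region s = convex hull {ca s, cb s, cc s}"
  by (cases s) auto

lemma rpos_affine:
  assumes "u + v + w = 1"
  shows "u *\<^sub>R rpos s x y + v *\<^sub>R rpos s x' y' + w *\<^sub>R rpos s x'' y''
    = rpos s (u * x + v * x' + w * x'') (u * y + v * y' + w * y'')"
proof -
  have "ca s = (u + v + w) *\<^sub>R ca s" using assms by simp
  then show ?thesis unfolding rpos_def by (simp add: algebra_simps)
qed

lemma corner_rpos: "ca s = rpos s 0 0" "cb s = rpos s 1 0" "cc s = rpos s 0 1"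
  by (simp_all add: rpos_def)

lemma barycentric_rpos:
  assumes "u + v + w = 1" shows "u *\<^sub>R ca s + v *\<^sub>R cb s + w *\<^sub>R cc s = rpos s v w"
  using rpos_affine[OF assms, of s 0 0 1 0 0 1] by (simp add: corner_rpos[symmetric])

lemma region_rpos: "region s = {rpos s x y | x y. 0 \<le> x \<and> 0 \<le> y \<and> x + y \<le> 1}"
proof -
  have "region s = {u *\<^sub>R ca s + v *\<^sub>R cb s + w *\<^sub>R cc s | u v w. 0 \<le> u \<and> 0 \<le> v \<and> 0 \<le> w \<and> u + v + w = 1}"
    unfolding region_hull convex_hull_3 by simp
  also have "\<dots> = {rpos s x y | x y. 0 \<le> x \<and> 0 \<le> y \<and> x + y \<le> 1}"
  proof (intro equalityI subsetI; clarify)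
    fix u v w :: real assume "0 \<le> u" "0 \<le> v" "0 \<le> w" "u + v + w = 1"
    then show "\<exists>x y. u *\<^sub>R ca s + v *\<^sub>R cb s + w *\<^sub>R cc s = rpos s x y \<and> 0 \<le> x \<and> 0 \<le> y \<and> x + y \<le> 1"
      by (intro exI[of _ v] exI[of _ w]) (simp add: barycentric_rpos)
  next
    fix x y :: real assume "0 \<le> x" "0 \<le> y" "x + y \<le> 1"
    then show "\<exists>u v w. rpos s x y = u *\<^sub>R ca s + v *\<^sub>R cb s + w *\<^sub>R cc s \<and> 0 \<le> u \<and> 0 \<le> v \<and> 0 \<le> w \<and> u + v + w = 1"
      by (intro exI[of _ "1 - x - y"] exI[of _ x] exI[of _ y]) (simp add: barycentric_rpos)
  qed
  finally show ?thesis .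
qed

lemma tile_not_collinear:
  assumes "is_tile s" shows "\<not> collinear {ca s, cb s, cc s}"
proof
  assume "collinear {ca s, cb s, cc s}"
  then consider "ca s = cc s" | u where "cb s = u *\<^sub>R ca s + (1 - u) *\<^sub>R cc s"
    unfolding collinear_3_expand by blast
  then show False
  proof cases
    case 1
    then have "rpos s 0 0 = rpos s 0 1" by (simp add: corner_rpos[symmetric])
    from rpos_inj[OF assms this] show False by simp
  next
    case 2
    then have "rpos s 1 0 = rpos s 0 (1 - u)"
      using barycentric_rpos[of u 0 "1 - u" s] by (simp add: corner_rpos[symmetric])
    from rpos_inj[OF assms this] show False by simp
  qed
qed

lemma interior_region_rpos:
  assumes "is_tile s"
  shows "interior (region s) = {rpos s x y | x y. 0 < x \<and> 0 < y \<and> x + y < 1}"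
proof -
  have "interior (region s) = {z. \<exists>u v w. 0 < u \<and> 0 < v \<and> 0 < w \<and> u + v + w = 1 \<and>
      u *\<^sub>R ca s + v *\<^sub>R cb s + w *\<^sub>R cc s = z}"
    unfolding region_hull by (rule interior_convex_hull_3_minimal[OF tile_not_collinear[OF assms]]) simp
  also have "\<dots> = {rpos s x y | x y. 0 < x \<and> 0 < y \<and> x + y < 1}"
  proof (intro equalityI subsetI; clarify)
    fix u v w :: real assume "0 < u" "0 < v" "0 < w" "u + v + w = 1"
    then show "\<exists>x y. u *\<^sub>R ca s + v *\<^sub>R cb s + w *\<^sub>R cc s = rpos s x y \<and> 0 < x \<and> 0 < y \<and> x + y < 1"
      by (intro exI[of _ v] exI[of _ w]) (simp add: barycentric_rpos)
  next
    fix x y :: real assume "0 < x" "0 < y" "x + y < 1"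
    then show "\<exists>u v w. 0 < u \<and> 0 < v \<and> 0 < w \<and> u + v + w = 1 \<and> u *\<^sub>R ca s + v *\<^sub>R cb s + w *\<^sub>R cc s = rpos s x y"
      by (intro exI[of _ "1 - x - y"] exI[of _ x] exI[of _ y]) (simp add: barycentric_rpos)
  qed
  finally show ?thesis .
qed

definition inflate :: "nat \<Rightarrow> tile \<Rightarrow> tile" where
  "inflate n = map_triangle (\<lambda>z. golden ^ n *\<^sub>R z)"

lemma corner_map [simp]:
  "ca (map_triangle f t) = f (ca t)" "cb (map_triangle f t) = f (cb t)" "cc (map_triangle f t) = f (cc t)"
  "acute (map_triangle f t) = acute t" "corners (map_triangle f t) = map f (corners t)"
  by (cases t; simp)+

lemma rpos_inflate: "rpos (inflate n s) x y = golden ^ n *\<^sub>R rpos s x y"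
  by (simp add: inflate_def rpos_def algebra_simps)

lemma pos_inflate: "pos (inflate n s) p = golden ^ n *\<^sub>R pos s p"
  by (simp add: pos_rpos rpos_inflate)

lemma inflate_inflate: "inflate m (inflate n s) = inflate (m + n) s"
  by (simp add: inflate_def triangle.map_comp comp_def power_add)

lemma inflate_0 [simp]: "inflate 0 s = s"
  by (simp add: inflate_def triangle.map_ident)

lemma subst_eq: "subst P = (\<Union>t\<in>P. inflate 1 ` dissect t)"
  by (simp add: subst_def inflate_def)

lemma is_tile_child:
  assumes s: "is_tile s" and c: "c \<in> dissect s"
  shows "is_tile (inflate 1 c)"
proof -
  define h where "h = golden - 1"
  define a u v where auv: "a = ca s" "u = cb s - ca s" "v = cc s - ca s"
  define k where "k = u \<bullet> v"
  have uv: "u \<bullet> u = 1" "v \<bullet> v = 1" "u \<bullet> v = k" "v \<bullet> u = k" and k: "k = apex_cos (acute s)"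
    using s unfolding is_tile_iff auv k_def by (auto simp: inner_commute)
  have scale: "(golden *\<^sub>R x - golden *\<^sub>R y) \<bullet> (golden *\<^sub>R z - golden *\<^sub>R w)
      = (golden + 1) * ((x - y) \<bullet> (z - w))" for x y z w :: complex
    unfolding golden_sq[symmetric] by (simp add: algebra_simps inner_diff)
  have g: "golden = h + 1" "h * h = 1 - h" using golden_sq by (simp_all add: h_def algebra_simps)
  have lin: "(x1 *\<^sub>R u + y1 *\<^sub>R v) \<bullet> (x2 *\<^sub>R u + y2 *\<^sub>R v) = x1 * x2 + y1 * y2 + (x1 * y2 + x2 * y1) * k"
    for x1 y1 x2 y2 by (simp add: inner_add uv algebra_simps)
  show ?thesis
  proof (cases s)
    case (Acute a' b' c')
    then have abc: "a' = a" "b' = a + u" "c' = a + v" by (auto simp: auv)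
    have k: "2 * k = h + 1" using k Acute by (simp add: apex_cos_def g)
    consider "c = Acute (a + v) (a + h *\<^sub>R u) (a + u)" | "c = Obtuse (a + h *\<^sub>R u) (a + v) a"
      using c unfolding Acute abc by (auto simp: Let_def inverse_golden h_def)
    then show ?thesis
    proof cases
      case 1
      have d: "a + h *\<^sub>R u - (a + v) = h *\<^sub>R u + (-1) *\<^sub>R v" "a + u - (a + v) = 1 *\<^sub>R u + (-1) *\<^sub>R v"
        by simp_all
      show ?thesis unfolding 1 is_tile_iff inflate_def
        unfolding corner_map ca.simps cb.simps cc.simps acute.simps power_one_right scale d lin apex_cos_def if_True
        using k g by algebra
    next
      case 2
      have d: "a + v - (a + h *\<^sub>R u) = (-h) *\<^sub>R u + 1 *\<^sub>R v" "a - (a + h *\<^sub>R u) = (-h) *\<^sub>R u + 0 *\<^sub>R v"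
        by simp_all
      show ?thesis unfolding 2 is_tile_iff inflate_def
        unfolding corner_map ca.simps cb.simps cc.simps acute.simps power_one_right scale d lin apex_cos_def if_False
        using k g by algebra
    qed
  next
    case (Obtuse a' b' c')
    then have abc: "a' = a" "b' = a + u" "c' = a + v" by (auto simp: auv)
    have k: "2 * k = - h" using k Obtuse by (simp add: apex_cos_def g)
    let ?q = "a + (1 - h) *\<^sub>R u" and ?r = "a + (1 - h) *\<^sub>R u + h *\<^sub>R v"
    have "a + u + (a - (a + u)) /\<^sub>R golden = ?q" "a + u + (a + v - (a + u)) /\<^sub>R golden = ?r"
      by (simp_all add: inverse_golden h_def scaleR_conv_of_real algebra_simps)
    then consider "c = Obtuse ?r (a + v) a" | "c = Obtuse ?q ?r (a + u)" | "c = Acute ?r ?q a"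
      using c unfolding Obtuse abc dissect.simps Let_def by auto
    then show ?thesis
    proof cases
      case 1
      have d: "a + v - ?r = (h - 1) *\<^sub>R u + (1 - h) *\<^sub>R v" "a - ?r = (h - 1) *\<^sub>R u + (- h) *\<^sub>R v"
        by (simp_all add: algebra_simps)
      show ?thesis unfolding 1 is_tile_iff inflate_def
        unfolding corner_map ca.simps cb.simps cc.simps acute.simps power_one_right scale d lin apex_cos_def if_False
        using k g by algebra
    next
      case 2
      have d: "?r - ?q = 0 *\<^sub>R u + h *\<^sub>R v" "a + u - ?q = h *\<^sub>R u + 0 *\<^sub>R v"
        by (simp_all add: algebra_simps)
      show ?thesis unfolding 2 is_tile_iff inflate_def
        unfolding corner_map ca.simps cb.simps cc.simps acute.simps power_one_right scale d lin apex_cos_def if_False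
        using k g by algebra
    next
      case 3
      have d: "?q - ?r = 0 *\<^sub>R u + (- h) *\<^sub>R v" "a - ?r = (h - 1) *\<^sub>R u + (- h) *\<^sub>R v"
        by (simp_all add: algebra_simps)
      show ?thesis unfolding 3 is_tile_iff inflate_def
        unfolding corner_map ca.simps cb.simps cc.simps acute.simps power_one_right scale d lin apex_cos_def if_True
        using k g by algebra
    qed
  qed
qed

text \<open>
  The dissection in real coordinates relative to the tile.
\<close>

definition rchildren :: "bool \<Rightarrow> (real \<times> real) triangle set" where
  "rchildren k = (let h = golden - 1 in
     if k then {Acute (0, 1) (h, 0) (1, 0), Obtuse (h, 0) (0, 1) (0, 0)}
     else {Obtuse (1 - h, h) (0, 1) (0, 0), Obtuse (1 - h, 0) (1 - h, h) (1, 0), Acute (1 - h, h) (1 - h, 0) (0, 0)})"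

lemma dissect_rchildren:
  "dissect s = map_triangle (\<lambda>(x, y). rpos s x y) ` rchildren (acute s)"
  by (cases s)
    (auto simp: rchildren_def Let_def rpos_def inverse_golden scaleR_conv_of_real algebra_simps)

text \<open>
  The point with coordinates \<open>(x, y)\<close> relative to \<open>f\<close>, expressed in the coordinates that \<open>f\<close> itself is given in.
\<close>

definition comb3 :: "(real \<times> real) triangle \<Rightarrow> real \<Rightarrow> real \<Rightarrow> real \<times> real" where
  "comb3 f x y = ca f + x *\<^sub>R (cb f - ca f) + y *\<^sub>R (cc f - ca f)"

lemma rpos_map_rpos:
  "rpos (map_triangle (\<lambda>(x, y). rpos s x y) f) X Y = rpos s (fst (comb3 f X Y)) (snd (comb3 f X Y))"
  by (cases "ca f"; cases "cb f"; cases "cc f")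
    (simp add: rpos_def comb3_def scaleR_conv_of_real algebra_simps)

lemma comb3_rchildren:
  assumes "f \<in> rchildren k" "0 \<le> x" "0 \<le> y" "x + y \<le> 1"
  shows "0 \<le> fst (comb3 f x y)" "0 \<le> snd (comb3 f x y)" "fst (comb3 f x y) + snd (comb3 f x y) \<le> 1"
proof -
  define h where "h = golden - 1"
  have h: "0 < h" "h < 1" using golden_gt_1 golden_lt_2 by (auto simp: h_def)
  have p: "0 \<le> x * h" "0 \<le> y * h" "0 \<le> x * (1 - h)" "0 \<le> y * (1 - h)"
    "0 \<le> (1 - x - y) * h" "0 \<le> (1 - x - y) * (1 - h)"
    using assms h by simp_all
  show "0 \<le> fst (comb3 f x y)" "0 \<le> snd (comb3 f x y)" "fst (comb3 f x y) + snd (comb3 f x y) \<le> 1"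
    using assms(1) p assms(2-) h unfolding rchildren_def h_def[symmetric] Let_def comb3_def
    by (auto split: if_splits simp: algebra_simps)
qed

lemma comb3_rchildren_interior:
  assumes "f \<in> rchildren k" "0 < x" "0 < y" "x + y < 1"
  shows "0 < fst (comb3 f x y)" "0 < snd (comb3 f x y)" "fst (comb3 f x y) + snd (comb3 f x y) < 1"
proof -
  define h where "h = golden - 1"
  have h: "0 < h" "h < 1" using golden_gt_1 golden_lt_2 by (auto simp: h_def)
  define X Y where XY: "X = h * x" "Y = h * y"
  have "0 < h * x" "0 < h * y" "0 < x * (1 - h)" "0 < y * (1 - h)"
    "0 < (1 - x - y) * h" "0 < (1 - x - y) * (1 - h)"
    using assms h by simp_all
  then have p: "0 < X" "0 < Y" "X < x" "Y < y" "X + Y < h" "h + x + y < 1 + X + Y"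
    by (simp_all add: XY algebra_simps)
  show "0 < fst (comb3 f x y)" "0 < snd (comb3 f x y)" "fst (comb3 f x y) + snd (comb3 f x y) < 1"
    using assms(1) p assms(2-) h unfolding rchildren_def h_def[symmetric] Let_def comb3_def
    by (auto split: if_splits simp: algebra_simps XY[symmetric])
qed

text \<open>The pieces of a dissected tile are separated by the lines \<open>\<phi> x + y = 1\<close> (acute), and
  \<open>\<phi> x = y\<close> and \<open>x = 1 - 1/\<phi>\<close> (obtuse).\<close>

lemma comb3_rchildren_disjoint:
  assumes f: "f \<in> rchildren k" "f' \<in> rchildren k" "f \<noteq> f'"
    and x: "0 < x" "0 < y" "x + y < 1" and x': "0 < x'" "0 < y'" "x' + y' < 1"
  shows "comb3 f x y \<noteq> comb3 f' x' y'"
proof -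
  define h where "h = golden - 1"
  have h: "0 < h" "h < 1" using golden_gt_1 golden_lt_2 by (auto simp: h_def)
  have hh: "h * h = 1 - h" using golden_sq by (simp add: h_def algebra_simps)
  have hh': "h * (h * z) = z - h * z" for z
    by (metis hh left_diff_distrib mult.assoc mult_1)
  have L: "(h + 1) * fst (comb3 g X Y) = fst (comb3 g X Y) + h * fst (comb3 g X Y)" for g X Y
    by (simp add: algebra_simps)
  have p: "0 < h * x" "0 < h * y" "0 < h * x'" "0 < h * y'"
    using x x' h by simp_all
  show ?thesis
  proof (cases k)
    case True
    have 1: "(h + 1) * fst (comb3 (Acute (0, 1) (h, 0) (1, 0)) X Y) + snd (comb3 (Acute (0, 1) (h, 0) (1, 0)) X Y) = 1 + h * Y"
     and 2: "(h + 1) * fst (comb3 (Obtuse (h, 0) (0, 1) (0, 0)) X Y) + snd (comb3 (Obtuse (h, 0) (0, 1) (0, 0)) X Y) = 1 - Y"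
     for X Y by (simp_all add: comb3_def algebra_simps hh hh')
    from f True consider "f = Acute (0, 1) (h, 0) (1, 0)" "f' = Obtuse (h, 0) (0, 1) (0, 0)"
      | "f' = Acute (0, 1) (h, 0) (1, 0)" "f = Obtuse (h, 0) (0, 1) (0, 0)"
      by (auto simp: rchildren_def h_def Let_def)
    then show ?thesis using 1[of x y] 1[of x' y'] 2[of x y] 2[of x' y'] p x x' by cases auto
  next
    case False
    let ?f0 = "Obtuse (1 - h, h) (0, 1) (0, 0)" and ?f1 = "Obtuse (1 - h, 0) (1 - h, h) (1, 0)"
      and ?f2 = "Acute (1 - h, h) (1 - h, 0) (0, 0)"
    let ?L = "\<lambda>g X Y. (h + 1) * fst (comb3 g X Y) - snd (comb3 g X Y)"
    have 0: "?L ?f0 X Y = - X" and 1: "?L ?f1 X Y = h * (1 - X) + Y" "fst (comb3 ?f1 X Y) = 1 - h + h * Y"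
      and 2: "?L ?f2 X Y = h * X" "fst (comb3 ?f2 X Y) = (1 - h) * (1 - Y)" for X Y
      by (simp_all add: comb3_def algebra_simps hh hh')
    have "0 < h * (1 - x)" "0 < h * (1 - x')" using x x' h by simp_all
    then have L1: "?L ?f1 x y > 0" "?L ?f1 x' y' > 0" using 1 x x' by auto
    have L2: "?L ?f2 x y > 0" "?L ?f2 x' y' > 0" using 2 p by auto
    have L0: "?L ?f0 x y < 0" "?L ?f0 x' y' < 0" using 0 x x' by auto
    have F1: "fst (comb3 ?f1 x y) > 1 - h" "fst (comb3 ?f1 x' y') > 1 - h" using 1 p by auto
    have "(1 - h) * (1 - y) < (1 - h) * 1" "(1 - h) * (1 - y') < (1 - h) * 1"
      using x x' h by (auto intro!: mult_strict_left_mono)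
    then have F2: "fst (comb3 ?f2 x y) < 1 - h" "fst (comb3 ?f2 x' y') < 1 - h" using 2 by auto
    have "f \<in> {?f0, ?f1, ?f2}" "f' \<in> {?f0, ?f1, ?f2}"
      using f False by (auto simp: rchildren_def h_def Let_def)
    then show ?thesis using f(3) L0 L1 L2 F1 F2
      by (elim insertE emptyE) (metis less_asym)+
  qed
qed


definition packing :: "tile set \<Rightarrow> bool" where
  "packing R \<longleftrightarrow> (\<forall>t\<in>R. is_tile t) \<and>
     (\<forall>s\<in>R. \<forall>t\<in>R. s \<noteq> t \<longrightarrow> interior (region s) \<inter> interior (region t) = {})"

lemma packing_subset: "packing R \<Longrightarrow> Q \<subseteq> R \<Longrightarrow> packing Q"
  unfolding packing_def by blast

lemma packing_tile: "packing R \<Longrightarrow> t \<in> R \<Longrightarrow> is_tile t"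
  unfolding packing_def by blast

lemma packing_eqI:
  "packing R \<Longrightarrow> s \<in> R \<Longrightarrow> t \<in> R \<Longrightarrow> z \<in> interior (region s) \<Longrightarrow> z \<in> interior (region t) \<Longrightarrow> s = t"
  unfolding packing_def by blast

lemma tiling_packing: "tiling T \<Longrightarrow> packing T"
  by (auto simp: tiling_def packing_def)

lemma tile_interior_nonempty: "is_tile s \<Longrightarrow> interior (region s) \<noteq> {}"
  unfolding interior_region_rpos by (auto intro!: exI[of _ "1/3::real"])

lemma child_coords:
  assumes "is_tile s" "c \<in> dissect s"
  obtains f where "f \<in> rchildren (acute s)" "c = map_triangle (\<lambda>(x, y). rpos s x y) f"
  using assms unfolding dissect_rchildren by blast

lemma child_region:
  assumes s: "is_tile s" and c: "c \<in> dissect s"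
  shows "region (inflate 1 c) \<subseteq> (\<lambda>z. golden *\<^sub>R z) ` region s"
proof
  fix z assume "z \<in> region (inflate 1 c)"
  then obtain x y where xy: "0 \<le> x" "0 \<le> y" "x + y \<le> 1" and z: "z = golden *\<^sub>R rpos c x y"
    unfolding region_rpos rpos_inflate by auto
  obtain f where f: "f \<in> rchildren (acute s)" "c = map_triangle (\<lambda>(x, y). rpos s x y) f"
    using child_coords[OF s c] by blast
  have "rpos c x y \<in> region s"
    unfolding f(2) rpos_map_rpos region_rpos using comb3_rchildren[OF f(1) xy] by blast
  then show "z \<in> (\<lambda>z. golden *\<^sub>R z) ` region s" using z by blast
qed

lemma child_interior:
  assumes s: "is_tile s" and c: "c \<in> dissect s"
  shows "interior (region (inflate 1 c)) \<subseteq> (\<lambda>z. golden *\<^sub>R z) ` interior (region s)"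
proof
  fix z assume "z \<in> interior (region (inflate 1 c))"
  then obtain x y where xy: "0 < x" "0 < y" "x + y < 1" and z: "z = golden *\<^sub>R rpos c x y"
    unfolding interior_region_rpos[OF is_tile_child[OF s c]] rpos_inflate by auto
  obtain f where f: "f \<in> rchildren (acute s)" "c = map_triangle (\<lambda>(x, y). rpos s x y) f"
    using child_coords[OF s c] by blast
  have "rpos c x y \<in> interior (region s)"
    unfolding f(2) rpos_map_rpos interior_region_rpos[OF s]
    using comb3_rchildren_interior[OF f(1) xy] by blast
  then show "z \<in> (\<lambda>z. golden *\<^sub>R z) ` interior (region s)" using z by blast
qed

lemma children_disjoint:
  assumes s: "is_tile s" and c: "c \<in> dissect s" "c' \<in> dissect s" "c \<noteq> c'"
  shows "interior (region (inflate 1 c)) \<inter> interior (region (inflate 1 c')) = {}"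
proof (rule ccontr)
  assume "interior (region (inflate 1 c)) \<inter> interior (region (inflate 1 c')) \<noteq> {}"
  then obtain z where z: "z \<in> interior (region (inflate 1 c))" "z \<in> interior (region (inflate 1 c'))"
    by blast
  obtain x y where xy: "0 < x" "0 < y" "x + y < 1" and zx: "z = golden *\<^sub>R rpos c x y"
    using z(1) unfolding interior_region_rpos[OF is_tile_child[OF s c(1)]] rpos_inflate by auto
  obtain x' y' where xy': "0 < x'" "0 < y'" "x' + y' < 1" and zy: "z = golden *\<^sub>R rpos c' x' y'"
    using z(2) unfolding interior_region_rpos[OF is_tile_child[OF s c(2)]] rpos_inflate by auto
  obtain f where f: "f \<in> rchildren (acute s)" "c = map_triangle (\<lambda>(x, y). rpos s x y) f"
    using child_coords[OF s c(1)] by blast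
  obtain f' where f': "f' \<in> rchildren (acute s)" "c' = map_triangle (\<lambda>(x, y). rpos s x y) f'"
    using child_coords[OF s c(2)] by blast
  have "rpos c x y = rpos c' x' y'" using zx zy golden_gt_1 by simp
  then have "comb3 f x y = comb3 f' x' y'"
    unfolding f(2) f'(2) rpos_map_rpos using rpos_inj[OF s] by (metis prod.collapse)
  moreover have "f \<noteq> f'" using c(3) f(2) f'(2) by blast
  ultimately show False using comb3_rchildren_disjoint[OF f(1) f'(1) _ xy xy'] by blast
qed

lemma packing_subst:
  assumes R: "packing R" shows "packing (subst R)"
  unfolding packing_def
proof (intro conjI ballI impI)
  fix t assume "t \<in> subst R"
  then show "is_tile t" unfolding subst_eq using is_tile_child packing_tile[OF R] by blast
next
  fix t t' assume t: "t \<in> subst R" "t' \<in> subst R" "t \<noteq> t'"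
  obtain s c where s: "s \<in> R" "c \<in> dissect s" "t = inflate 1 c" using t unfolding subst_eq by blast
  obtain s' c' where s': "s' \<in> R" "c' \<in> dissect s'" "t' = inflate 1 c'" using t unfolding subst_eq by blast
  show "interior (region t) \<inter> interior (region t') = {}"
  proof (cases "s = s'")
    case True
    then show ?thesis
      using children_disjoint[OF packing_tile[OF R s(1)] s(2)] s s' t(3) by blast
  next
    case False
    then have "interior (region s) \<inter> interior (region s') = {}"
      using R s s' unfolding packing_def by blast
    moreover have "inj (\<lambda>z::complex. golden *\<^sub>R z)" using golden_gt_1 by (simp add: inj_def)
    ultimately have "(\<lambda>z. golden *\<^sub>R z) ` interior (region s) \<inter> (\<lambda>z. golden *\<^sub>R z) ` interior (region s') = {}"
      by (metis image_Int image_empty)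
    then show ?thesis
      using child_interior[OF packing_tile[OF R s(1)] s(2)] child_interior[OF packing_tile[OF R s'(1)] s'(2)]
      unfolding s(3) s'(3) by blast
  qed
qed

lemma packing_subst_pow: "packing R \<Longrightarrow> packing ((subst ^^ n) R)"
  by (induction n) (auto intro: packing_subst)

lemma packing_single: "is_tile s \<Longrightarrow> packing {s}"
  by (simp add: packing_def)

lemma subst_UN: "subst (\<Union>i\<in>I. R i) = (\<Union>i\<in>I. subst (R i))"
  by (auto simp: subst_def)

lemma subst_pow_UN: "(subst ^^ n) (\<Union>i\<in>I. R i) = (\<Union>i\<in>I. (subst ^^ n) (R i))"
  by (induction n) (simp_all add: subst_UN)

lemma subst_pow_eq_UN: "(subst ^^ n) R = (\<Union>t\<in>R. (subst ^^ n) {t})"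
  using subst_pow_UN[of n "\<lambda>t. {t}" R] by simp

lemma subst_pow_mono: "Q \<subseteq> R \<Longrightarrow> (subst ^^ n) Q \<subseteq> (subst ^^ n) R"
  by (subst (1 2) subst_pow_eq_UN) auto

lemma subst_pow_add: "(subst ^^ (m + n)) R = (subst ^^ m) ((subst ^^ n) R)"
  by (simp add: funpow_add)

lemma finite_subst: "finite R \<Longrightarrow> finite (subst R)"
  unfolding subst_eq dissect_rchildren by (auto simp: rchildren_def Let_def)

lemma finite_subst_pow: "finite R \<Longrightarrow> finite ((subst ^^ n) R)"
  by (induction n) (auto intro: finite_subst)

lemma subst_pow_region:
  assumes s: "is_tile s" and t: "t \<in> (subst ^^ n) {s}"
  shows "region t \<subseteq> (\<lambda>z. golden ^ n *\<^sub>R z) ` region s"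
    and "interior (region t) \<subseteq> (\<lambda>z. golden ^ n *\<^sub>R z) ` interior (region s)"
  using t
proof (induction n arbitrary: t)
  case (Suc n)
  {
    case 1
    then have "t \<in> subst ((subst ^^ n) {s})" by simp
    then obtain u c where u: "u \<in> (subst ^^ n) {s}" "c \<in> dissect u" "t = inflate 1 c"
      unfolding subst_eq by blast
    have "is_tile u" using packing_tile[OF packing_subst_pow[OF packing_single[OF s]] u(1)] .
    from child_region[OF this u(2)] Suc(1)[OF u(1)] show ?case unfolding u(3)
      by (fastforce simp: image_iff subset_iff)
  next
    case 2
    then have "t \<in> subst ((subst ^^ n) {s})" by simp
    then obtain u c where u: "u \<in> (subst ^^ n) {s}" "c \<in> dissect u" "t = inflate 1 c"
      unfolding subst_eq by blast
    have "is_tile u" using packing_tile[OF packing_subst_pow[OF packing_single[OF s]] u(1)] .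
    from child_interior[OF this u(2)] Suc(2)[OF u(1)] show ?case unfolding u(3)
      by (fastforce simp: image_iff subset_iff)
  }
qed simp_all

text \<open>
  The descendants of different tiles of a packing are different, because they lie in disjoint inflated interiors.
\<close>

lemma ancestor_unique:
  assumes R: "packing R" and s: "s \<in> R" "s' \<in> R" and t: "t \<in> (subst ^^ n) {s}" "t \<in> (subst ^^ n) {s'}"
  shows "s = s'"
proof -
  have tile: "is_tile s" "is_tile s'" using packing_tile[OF R] s by auto
  have "is_tile t" using packing_tile[OF packing_subst_pow[OF packing_single[OF tile(1)]] t(1)] .
  then obtain z where z: "z \<in> interior (region t)" using tile_interior_nonempty by blast
  obtain x where x: "x \<in> interior (region s)" "z = golden ^ n *\<^sub>R x"
    using subst_pow_region(2)[OF tile(1) t(1)] z by blast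
  obtain y where y: "y \<in> interior (region s')" "z = golden ^ n *\<^sub>R y"
    using subst_pow_region(2)[OF tile(2) t(2)] z by blast
  have "x = y" using x(2) y(2) golden_gt_1 by simp
  then show ?thesis using packing_eqI[OF R s] x(1) y(1) by blast
qed

section \<open>Substitution in local coordinates\<close>

lemma corner_place [simp]:
  "ca (place s f) = pos s (ca f)" "cb (place s f) = pos s (cb f)" "cc (place s f) = pos s (cc f)"
  by (simp_all add: place_def)

lemma pos_lpos: "pos (place s f) p = pos s (lpos f p)"
proof -
  have lin: "pos s (padd p q) = pos s p + pos s q - ca s"
    "pos s (psub p q) = pos s p - pos s q + ca s"
    "pos s (pscale k p) = ca s + gval k *\<^sub>R (pos s p - ca s)" for p q k
  proof -
    obtain p1 p2 q1 q2 where "p = (p1, p2)" "q = (q1, q2)" by (metis surj_pair)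
    then show "pos s (padd p q) = pos s p + pos s q - ca s"
      "pos s (psub p q) = pos s p - pos s q + ca s"
      "pos s (pscale k p) = ca s + gval k *\<^sub>R (pos s p - ca s)"
      by (simp_all add: pos_def gval_simps algebra_simps)
  qed
  show ?thesis
    unfolding pos_def[of "place s f"] corner_place lpos_def lin by (simp add: algebra_simps)
qed

lemma place_place: "place (place s f) g = place s (lplace f g)"
proof -
  have 1: "pos (place s f) = pos s \<circ> lpos f" by (rule ext) (simp add: pos_lpos)
  have "place (place s f) g = map_triangle (pos (place s f)) g" by (rule fun_cong[OF place_def])
  also have "\<dots> = place s (lplace f g)"
    unfolding 1 by (simp add: place_def lplace_def triangle.map_comp)
  finally show ?thesis .
qed

lemma pos_corner: "pos s PA = ca s" "pos s PB = cb s" "pos s PC = cc s"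
  by (simp_all add: pos_def PA_def PB_def PC_def gval_simps)

lemma place_std: "place s (std (acute s)) = s"
  by (cases s) (simp_all add: place_def std_def pos_corner)

lemma acute_place [simp]: "acute (place s f) = acute f" "acute (lplace f g) = acute g"
  "acute (inflate n s) = acute s"
  by (simp_all add: place_def lplace_def inflate_def)

lemma place_inflate: "place (inflate n s) f = inflate n (place s f)"
proof -
  have 1: "pos (inflate n s) = (\<lambda>z. golden ^ n *\<^sub>R z) \<circ> pos s" by (rule ext) (simp add: pos_inflate)
  have "place (inflate n s) f = map_triangle (pos (inflate n s)) f" by (rule fun_cong[OF place_def])
  also have "\<dots> = inflate n (place s f)"
    unfolding 1 by (simp add: place_def inflate_def triangle.map_comp)
  finally show ?thesis .
qed

lemma place_inj: "is_tile s \<Longrightarrow> place (inflate n s) f = place (inflate n s) g \<longleftrightarrow> f = g"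
proof -
  assume s: "is_tile s"
  have "inj (pos (inflate n s))" using pos_inj[OF s] golden_gt_1 by (auto simp: inj_def pos_inflate)
  then show ?thesis unfolding place_def by (metis injD triangle.inj_map)
qed

lemma dissect_place: "dissect (place s f) = place s ` set (lchildren f)"
proof -
  have lin: "pos s (padd p (pscale (-1, 1) (psub q r))) = pos s p + (pos s q - pos s r) /\<^sub>R golden" for p q r
  proof -
    obtain p1 p2 q1 q2 r1 r2 where "p = (p1, p2)" "q = (q1, q2)" "r = (r1, r2)" by (metis surj_pair)
    then show ?thesis by (simp add: pos_def gval_simps algebra_simps)
  qed
  show ?thesis by (cases f) (simp_all add: place_def Let_def lin)
qed

lemma subst_place: "subst (place s ` set L) = place (inflate 1 s) ` set (lsubst L)"
  unfolding subst_eq lsubst_def by (auto simp: dissect_place place_inflate image_iff)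

lemma subst_pow_place: "(subst ^^ n) (place s ` set L) = place (inflate n s) ` set ((lsubst ^^ n) L)"
  by (induction n) (simp_all add: subst_place inflate_inflate)

lemma subst_pow_single: "(subst ^^ n) {s} = place (inflate n s) ` set ((lsubst ^^ n) [std (acute s)])"
  using subst_pow_place[of n s "[std (acute s)]"] by (simp add: place_std)

section \<open>Numbers of tiles\<close>

definition num :: "bool \<Rightarrow> tile set \<Rightarrow> nat" where
  "num k R = card {t \<in> R. acute t = k}"

lemma num_subst_single:
  assumes "is_tile s"
  shows "num True (subst {s}) = 1" "num False (subst {s}) = (if acute s then 1 else 2)"
proof -
  have eq: "{t \<in> subst {s}. acute t = k} = place (inflate 1 s) ` set (filter (\<lambda>f. acute f = k) (lchildren (std (acute s))))" for k
    using subst_pow_single[of 1 s] by (auto simp: lsubst_def)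
  have num: "num k (subst {s}) = card (set (filter (\<lambda>f. acute f = k) (lchildren (std (acute s)))))" for k
    unfolding num_def eq using place_inj[OF assms] by (intro card_image) (auto simp: inj_on_def)
  have "\<forall>k\<in>{True, False}. card (set (filter (\<lambda>f. acute f = True) (lchildren (std k)))) = 1"
    by code_simp
  then show "num True (subst {s}) = 1" unfolding num by (cases "acute s") auto
  have "\<forall>k\<in>{True, False}. card (set (filter (\<lambda>f. acute f = False) (lchildren (std k)))) = (if k then 1 else 2)"
    by code_simp
  then show "num False (subst {s}) = (if acute s then 1 else 2)" unfolding num by (cases "acute s") auto
qed

lemma num_subst:
  assumes R: "packing R" "finite R"
  shows "num True (subst R) = num True R + num False R"
    and "num False (subst R) = num True R + 2 * num False R"
proof -
  have eq: "num k (subst R) = (\<Sum>s\<in>R. num k (subst {s}))" for k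
  proof -
    have "{t \<in> subst R. acute t = k} = (\<Union>s\<in>R. {t \<in> subst {s}. acute t = k})" by (auto simp: subst_eq)
    moreover have "card \<dots> = (\<Sum>s\<in>R. card {t \<in> subst {s}. acute t = k})"
    proof (rule card_UN_disjoint[OF R(2)])
      show "\<forall>i\<in>R. finite {t \<in> subst {i}. acute t = k}" using finite_subst by auto
      show "\<forall>i\<in>R. \<forall>j\<in>R. i \<noteq> j \<longrightarrow> {t \<in> subst {i}. acute t = k} \<inter> {t \<in> subst {j}. acute t = k} = {}"
        using ancestor_unique[OF R(1), of _ _ _ 1] by auto
    qed
    ultimately show ?thesis unfolding num_def by simp
  qed
  have split: "(\<Sum>s\<in>R. if acute s then x else y) = x * num True R + y * num False R" for x y
    using R(2) by (simp add: sum.If_cases num_def Int_def conj_commute mult.commute)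
  have "(\<Sum>s\<in>R. num True (subst {s})) = (\<Sum>s\<in>R. if acute s then 1 else 1)"
    by (intro sum.cong refl) (use num_subst_single packing_tile[OF R(1)] in auto)
  then show "num True (subst R) = num True R + num False R" unfolding eq split by simp
  have "(\<Sum>s\<in>R. num False (subst {s})) = (\<Sum>s\<in>R. if acute s then 1 else 2)"
    by (intro sum.cong refl) (use num_subst_single packing_tile[OF R(1)] in auto)
  then show "num False (subst R) = num True R + 2 * num False R" unfolding eq split by simp
qed

lemma card_eq_num: "finite R \<Longrightarrow> card R = num True R + num False R"
  unfolding num_def by (subst card_Un_disjoint[symmetric]) (auto intro!: arg_cong[of _ _ card])


section \<open>Glued sides\<close>

lemma UNIV_side: "UNIV = {AB, BC, CA}"
  using side.exhaust by auto

lemma finite_side: "finite (A :: side set)"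
  by (rule finite_subset[OF subset_UNIV]) (simp add: UNIV_side)

definition glued :: "tile set \<Rightarrow> tile \<Rightarrow> side \<Rightarrow> bool" where
  "glued R t e \<longleftrightarrow> (\<exists>m\<in>set (across (acute t) e). place t m \<in> R)"

definition unglued :: "tile set \<Rightarrow> (tile \<times> side) set" where
  "unglued R = {(t, e). t \<in> R \<and> \<not> glued R t e}"

lemma subst_place_child:
  assumes "place t f \<in> R" "g \<in> set (lchildren f)" shows "place (inflate 1 t) g \<in> subst R"
  using assms unfolding subst_eq place_inflate by (force simp: dissect_place)

lemma glued_subst:
  assumes "glued R t e" "(i, e1) \<in> set (subsides (acute t) e)"
  shows "glued (subst R) (place (inflate 1 t) (lchildren (std (acute t)) ! i)) e1"
proof -
  obtain f where f: "f \<in> set (across (acute t) e)" "place t f \<in> R" using assms(1) unfolding glued_def by blast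
  have "\<exists>m\<in>set (across (acute (lchildren (std (acute t)) ! i)) e1).
      lplace (lchildren (std (acute t)) ! i) m \<in> set (lchildren f)"
    using glue_outer f(1) assms(2) by (cases "acute t"; cases e) fastforce+
  then show ?thesis unfolding glued_def using subst_place_child[OF f(2)] by (auto simp: place_place)
qed

text \<open>
  A side that is not glued is part of such a side one level up, since sides arising inside a
  tile are glued and glued sides pass gluing on to their parts.
\<close>

lemma unglued_subst:
  "unglued (subst R) \<subseteq> (\<Union>(t, e)\<in>unglued R.
     (\<lambda>(i, e1). (place (inflate 1 t) (lchildren (std (acute t)) ! i), e1)) ` set (subsides (acute t) e))"
proof clarify
  fix t1 e1 assume t1: "(t1, e1) \<in> unglued (subst R)"
  then obtain t c where t: "t \<in> R" "c \<in> dissect t" "t1 = inflate 1 c"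
    by (auto simp: unglued_def subst_eq)
  have "dissect t = place t ` set (lchildren (std (acute t)))"
    using dissect_place[of t "std (acute t)"] by (simp add: place_std)
  then obtain i where i: "i < length (lchildren (std (acute t)))"
    and t1i: "t1 = place (inflate 1 t) (lchildren (std (acute t)) ! i)"
    using t(2,3) by (auto simp: in_set_conv_nth place_inflate)
  let ?c = "lchildren (std (acute t)) ! i"
  have "\<not> (\<exists>m\<in>set (across (acute ?c) e1). lplace ?c m \<in> set (lchildren (std (acute t))))"
  proof
    assume "\<exists>m\<in>set (across (acute ?c) e1). lplace ?c m \<in> set (lchildren (std (acute t)))"
    then have "glued (subst R) t1 e1"
      unfolding glued_def t1i using subst_place_child[of t "std (acute t)" R] t(1)
      by (auto simp: place_place place_std)
    then show False using t1 by (simp add: unglued_def)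
  qed
  moreover have "acute t \<in> {True, False}" "e1 \<in> {AB, BC, CA}" using UNIV_side by auto
  note glue_inner[rule_format, OF this(1) i this(2)]
  ultimately obtain e0 where e0: "(i, e1) \<in> set (subsides (acute t) e0)" by blast
  have "(t, e0) \<in> unglued R"
    using glued_subst[OF _ e0] t1 t(1) t1i by (auto simp: unglued_def)
  then show "(t1, e1) \<in> (\<Union>(t, e)\<in>unglued R.
     (\<lambda>(i, e1). (place (inflate 1 t) (lchildren (std (acute t)) ! i), e1)) ` set (subsides (acute t) e))"
    using e0 t1i by force
qed

lemma finite_unglued: "finite R \<Longrightarrow> finite (unglued R)"
  by (rule finite_subset[of _ "R \<times> UNIV"]) (auto simp: unglued_def finite_side)

text \<open>
  The factor 2 is crude, since lengths only grow by \<open>\<phi>\<close>, but it is smaller than the growth rate \<open>\<phi>\<^sup>2\<close>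
  of the number of tiles, and this is all that matters.
\<close>

lemma card_unglued_subst:
  assumes "finite R" shows "card (unglued (subst R)) \<le> 2 * card (unglued R)"
proof -
  let ?F = "\<lambda>(t, e). (\<lambda>(i, e1). (place (inflate 1 t) (lchildren (std (acute t)) ! i), e1)) ` set (subsides (acute t) e)"
  have "length (subsides k e) \<le> 2" for k e by (cases k; cases e) auto
  then have 2: "card (?F p) \<le> 2" for p
    by (cases p) (auto intro: order_trans[OF card_image_le] order_trans[OF card_length])
  have "card (unglued (subst R)) \<le> card (\<Union>p\<in>unglued R. ?F p)"
    by (rule card_mono[OF _ unglued_subst]) (auto simp: finite_unglued[OF assms])
  also have "\<dots> \<le> (\<Sum>p\<in>unglued R. card (?F p))" by (rule card_UN_le[OF finite_unglued[OF assms]])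
  also have "\<dots> \<le> (\<Sum>p\<in>unglued R. 2)" by (intro sum_mono 2)
  finally show ?thesis by simp
qed

lemma card_unglued_pow: "card (unglued ((subst ^^ n) {s})) \<le> 3 * 2 ^ n"
proof (induction n)
  case 0
  have "card (unglued {s}) \<le> card ({s} \<times> (UNIV :: side set))"
    by (rule card_mono) (auto simp: unglued_def finite_side)
  then show ?case by (simp add: UNIV_side)
next
  case (Suc n)
  then show ?case using card_unglued_subst[OF finite_subst_pow[of "{s}" n]] by simp
qed

section \<open>Flowers\<close>

definition star :: "tile \<Rightarrow> tile set" where "star s = place s ` set lstar"
definition cell :: "tile \<Rightarrow> tile set" where "cell s = place s ` set lcell"

text \<open>
  The predicate is about a tile of the star and not about its centre: if it holds for \<open>s\<close> then it holds for all
  ten tiles of the star. In this form flowers can be counted through the ancestry of their star tiles.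
\<close>

definition flower :: "tile set \<Rightarrow> tile \<Rightarrow> bool" where
  "flower R s \<longleftrightarrow> \<not> acute s \<and> (\<forall>t\<in>star s. cell t \<subseteq> R)"

lemma flower_mono: "flower Q s \<Longrightarrow> Q \<subseteq> R \<Longrightarrow> flower R s"
  unfolding flower_def by blast

lemma cell_self: "\<not> acute s \<Longrightarrow> s \<in> cell s"
  using place_std[of s] unfolding cell_def lcell_def by (intro rev_image_eqI[of "std False"]) auto

lemma star_self: "\<not> acute s \<Longrightarrow> s \<in> star s"
proof -
  assume s: "\<not> acute s"
  have "std False \<in> set lstar" unfolding lstar_def by (auto intro!: image_eqI[of _ _ 0])
  then show ?thesis using place_std[of s] s unfolding star_def by (intro rev_image_eqI[of "std False"]) auto
qed

lemma flower_self: "flower R s \<Longrightarrow> s \<in> R"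
  unfolding flower_def using star_self cell_self by blast

definition lift :: "tile \<Rightarrow> tile" where "lift s = place (inflate 2 s) llift"

definition lmid :: "pt triangle" where "lmid = ldesc [1] (std False)"

lemma llift_facts:
  "\<forall>f\<in>set lstar. \<not> acute f"
  "set (map (lplace llift) lstar) = set (map (\<lambda>f. lplace f llift) lstar)"
  "\<not> acute llift" "cb llift = PB" "cb llift \<in> set (corners (lmid))"
  "lmid \<in> set (lsubst [std False])" "llift \<in> set (lsubst [lmid])"
  by code_simp+

lemma star_obtuse: "\<not> acute s \<Longrightarrow> t \<in> star s \<Longrightarrow> \<not> acute t"
  using llift_facts(1) by (auto simp: star_def)

lemma lift_obtuse: "\<not> acute (lift s)"
  using llift_facts(3) by (simp add: lift_def)

lemma star_lift: "star (lift s) = lift ` star s"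
proof -
  have "star (lift s) = place (inflate 2 s) ` set (map (lplace llift) lstar)"
    by (simp add: star_def lift_def place_place image_image)
  also have "\<dots> = lift ` star s"
    unfolding llift_facts(2) by (auto simp: star_def lift_def place_place image_image simp flip: place_inflate)
  finally show ?thesis .
qed

lemma cell_lift: "\<not> acute t \<Longrightarrow> cell (lift t) \<subseteq> (subst ^^ 2) {t}"
  using lift_cell unfolding subst_pow_single cell_def lift_def
  by (auto simp: place_place numeral_2_eq_2)

lemma lift_in: "\<not> acute t \<Longrightarrow> lift t \<in> (subst ^^ 2) {t}"
  using cell_lift[of t] cell_self[of "lift t"] llift_facts(3) by (auto simp: lift_def)

text \<open>
  Each cell of the new flower lies in the twofold substitution of a single tile of the old star.
\<close>

lemma flower_lift: "flower R s \<Longrightarrow> flower ((subst ^^ 2) R) (lift s)"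
proof -
  assume s: "flower R s"
  have "cell (lift t) \<subseteq> (subst ^^ 2) R" if t: "t \<in> star s" for t
  proof -
    have "\<not> acute t" "t \<in> R" using s t star_obtuse cell_self unfolding flower_def by blast+
    then show ?thesis using cell_lift[of t] subst_pow_mono[of "{t}" R 2] by blast
  qed
  then show ?thesis by (simp add: flower_def star_lift lift_obtuse)
qed

text \<open>
  The star tiles that descend from \<open>t\<close> and belong to flowers centred on glued sides of \<open>t\<close>.
\<close>

definition sprouts :: "tile set \<Rightarrow> tile \<Rightarrow> tile set" where
  "sprouts R t = (\<Union>e\<in>{e. glued R t e}. place (inflate 5 t) ` set (seeds (acute t) e))"

lemma seeds_facts:
  "\<forall>k\<in>{True,False}. \<forall>e\<in>{AB,BC,CA}. \<forall>f\<in>set (seeds k e). \<not> acute f \<and> cb f \<notin> {PA, PB, PC}"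
  "\<forall>k\<in>{True,False}. \<forall>e\<in>{AB,BC,CA}. \<forall>w\<in>set (words k e). \<forall>j\<in>{1,3}.
     (let f = ldesc (take (5 - j) w) (std k); g = ldesc w (std k) in
       f \<in> set ((lsubst ^^ (5 - j)) [std k]) \<and> g \<in> set ((lsubst ^^ j) [f]) \<and> cb g \<in> set (corners f))"
  "\<forall>k\<in>{True,False}. (\<forall>e\<in>{AB,BC,CA}. \<forall>e'\<in>{AB,BC,CA}. e = e' \<or> set (seeds k e) \<inter> set (seeds k e') = {})"
  "\<forall>k\<in>{True,False}. card (set (seeds k AB)) = 5 \<and> card (set (seeds k BC)) = (if k then 0 else 5) \<and> card (set (seeds k CA)) = 0"
  by code_simp+

lemma side_set: "e \<in> {AB, BC, CA}"
  using UNIV_side by auto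

lemma flower_sprout:
  assumes t: "t \<in> R" and s: "s \<in> sprouts R t" shows "flower ((subst ^^ 5) R) s"
proof -
  let ?k = "acute t" and ?T = "inflate 5 t"
  have k: "b \<in> {True, False}" for b by simp
  obtain e f where e: "glued R t e" and f: "f \<in> set (seeds ?k e)" "s = place ?T f"
    using s unfolding sprouts_def by blast
  obtain m where m: "m \<in> set (across ?k e)" "place t m \<in> R" using e unfolding glued_def by blast
  have cells: "cell (place (inflate 5 u) g) \<subseteq> (subst ^^ 5) R"
    if "u \<in> R" "g \<in> set (seeds (acute u) e)" for u g
  proof -
    have "cell (place (inflate 5 u) g) = place (inflate 5 u) ` set (map (lplace g) lcell)"
      by (simp add: cell_def place_place image_image)
    also have "\<dots> \<subseteq> (subst ^^ 5) {u}"
      unfolding subst_pow_single by (intro image_mono) (rule seed_cell[rule_format, OF k side_set that(2)])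
    also have "\<dots> \<subseteq> (subst ^^ 5) R" using that by (intro subst_pow_mono) simp
    finally show ?thesis .
  qed
  have "star s = place ?T ` set (map (lplace f) lstar)"
    by (simp add: star_def f(2) place_place image_image)
  also have "\<dots> \<subseteq> place ?T ` (set (seeds ?k e) \<union> set (map (lplace m) (seeds (acute m) e)))"
    by (intro image_mono) (rule seed_star[rule_format, OF k side_set m(1) f(1)])
  also have "\<dots> = place ?T ` set (seeds ?k e) \<union> place (inflate 5 (place t m)) ` set (seeds (acute m) e)"
    by (simp add: image_Un image_image place_place flip: place_inflate)
  finally have sub: "star s \<subseteq> \<dots>" .
  have "cell u \<subseteq> (subst ^^ 5) R" if "u \<in> star s" for u
  proof -
    have "u \<in> place ?T ` set (seeds ?k e) \<union> place (inflate 5 (place t m)) ` set (seeds (acute (place t m)) e)"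
      using subsetD[OF sub that] by simp
    then show ?thesis
      by (elim UnE imageE) (simp_all only: cells[OF t] cells[OF m(2)])
  qed
  then have "\<forall>u\<in>star s. cell u \<subseteq> (subst ^^ 5) R" by blast
  moreover have "\<not> acute s" using seeds_facts(1) f k side_set by (metis acute_place(1))
  ultimately show ?thesis unfolding flower_def by blast
qed

text \<open>
  This distinguishes lifted flowers from sprouting ones, which are centred in the interior of a side of their
  fifth ancestor. The centre of a flower is the second corner of its star tiles.
\<close>

definition corner_centred :: "nat \<Rightarrow> tile set \<Rightarrow> tile \<Rightarrow> bool" where
  "corner_centred j R s \<longleftrightarrow> (\<exists>u\<in>R. s \<in> (subst ^^ j) {u} \<and> cb s \<in> set (corners (inflate j u)))"

lemma place_in_subst_pow:
  assumes "g \<in> set ((lsubst ^^ j) [f])"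
  shows "place (inflate (j + i) t) g \<in> (subst ^^ j) {place (inflate i t) f}"
  using subst_pow_place[of j "inflate i t" "[f]"] assms by (simp add: inflate_inflate)

lemma corners_place: "corners (place s f) = map (pos s) (corners f)"
  by (simp add: place_def)

lemma sprout_corner_centred:
  assumes t: "t \<in> R" and s: "s \<in> sprouts R t" and j: "j \<in> {1, 3}"
  shows "corner_centred j ((subst ^^ (5 - j)) R) s"
proof -
  let ?k = "acute t"
  obtain e w where e: "w \<in> set (words ?k e)" and s: "s = place (inflate 5 t) (ldesc w (std ?k))"
    using s unfolding sprouts_def seeds_def by auto
  define f where "f = ldesc (take (5 - j) w) (std ?k)"
  define g where "g = ldesc w (std ?k)"
  have k: "?k \<in> {True, False}" by simp
  have "f \<in> set ((lsubst ^^ (5 - j)) [std ?k]) \<and> g \<in> set ((lsubst ^^ j) [f]) \<and> cb g \<in> set (corners f)"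
    using bspec[OF bspec[OF bspec[OF bspec[OF seeds_facts(2) k] side_set[of e]] e] j] unfolding f_def g_def Let_def .
  then have fg: "f \<in> set ((lsubst ^^ (5 - j)) [std ?k])" "g \<in> set ((lsubst ^^ j) [f])" "cb g \<in> set (corners f)"
    by auto
  have j5: "j + (5 - j) = 5" using j by auto
  let ?u = "place (inflate (5 - j) t) f"
  have "?u \<in> (subst ^^ (5 - j)) {t}" using fg(1) by (simp add: subst_pow_single)
  then have "?u \<in> (subst ^^ (5 - j)) R" using subst_pow_mono[of "{t}" R] t by blast
  moreover have "s \<in> (subst ^^ j) {?u}"
    using place_in_subst_pow[OF fg(2), of "5 - j" t] s unfolding j5 g_def by simp
  moreover have "cb s \<in> set (corners (inflate j ?u))"
    using fg(3) unfolding s g_def[symmetric] place_inflate[symmetric] inflate_inflate j5 corners_place by auto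
  ultimately show ?thesis unfolding corner_centred_def by blast
qed

lemma sprout_not_corner:
  assumes t: "is_tile t" and s: "s \<in> sprouts R t" shows "cb s \<notin> set (corners (inflate 5 t))"
proof -
  obtain e f where f: "f \<in> set (seeds (acute t) e)" "s = place (inflate 5 t) f"
    using s unfolding sprouts_def by blast
  have "acute t \<in> {True, False}" by simp
  from seeds_facts(1)[rule_format, OF this side_set f(1)] have "cb f \<notin> {PA, PB, PC}" by blast
  moreover have "set (corners (inflate 5 t)) = pos (inflate 5 t) ` {PA, PB, PC}"
    by (cases "inflate 5 t") (simp_all add: pos_corner)
  moreover have "inj (pos (inflate 5 t))" using pos_inj[OF t] golden_gt_1 by (auto simp: inj_def pos_inflate)
  ultimately show ?thesis unfolding f(2) corner_place by (simp only: inj_image_mem_iff not_False_eq_True)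
qed

lemma lift_corner_centred:
  assumes s: "\<not> acute s"
  shows "s \<in> R \<Longrightarrow> corner_centred 1 (subst R) (lift s)"
    and "corner_centred j R s \<Longrightarrow> corner_centred (j + 2) R (lift s)"
proof -
  assume "s \<in> R"
  let ?u = "place (inflate 1 s) (lmid)"
  have "?u \<in> (subst ^^ 1) {s}" using llift_facts(6) s unfolding subst_pow_single by simp
  then have "?u \<in> subst R" using subst_pow_mono[of "{s}" R 1] \<open>s \<in> R\<close> by auto
  moreover have "lift s \<in> (subst ^^ 1) {?u}"
    using place_in_subst_pow[of llift 1 "lmid" 1 s] llift_facts(7) by (simp add: lift_def numeral_2_eq_2)
  moreover have "cb (lift s) \<in> set (corners (inflate 1 ?u))"
    using llift_facts(5) unfolding place_inflate[symmetric] inflate_inflate corners_place lift_def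
    by (simp add: numeral_2_eq_2)
  ultimately show "corner_centred 1 (subst R) (lift s)" unfolding corner_centred_def by blast
next
  assume "corner_centred j R s"
  then obtain u where u: "u \<in> R" "s \<in> (subst ^^ j) {u}" "cb s \<in> set (corners (inflate j u))"
    unfolding corner_centred_def by blast
  have "lift s \<in> (subst ^^ 2) ((subst ^^ j) {u})"
    using lift_in[OF s] subst_pow_mono[of "{s}" "(subst ^^ j) {u}" 2] u(2) by blast
  then have "lift s \<in> (subst ^^ (j + 2)) {u}" by (simp add: add.commute flip: subst_pow_add)
  moreover have "cb (lift s) = golden ^ 2 *\<^sub>R cb s"
    unfolding lift_def corner_place llift_facts(4) pos_corner(2) by (simp add: inflate_def)
  then have "cb (lift s) \<in> set (corners (inflate 2 (inflate j u)))"
    using u(3) unfolding inflate_def[of 2] corner_map by auto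
  then have "cb (lift s) \<in> set (corners (inflate (j + 2) u))" by (simp add: inflate_inflate add.commute)
  ultimately show "corner_centred (j + 2) R (lift s)" unfolding corner_centred_def using u(1) by blast
qed

text \<open>
  The star tiles in \<open>S\<^sup>n(X)\<close> obtained from glued sides of \<open>S\<^bsup>n-5\<^esup>(X)\<close> or from earlier flowers in \<open>S\<^bsup>n-2\<^esup>(X)\<close>. For \<open>n < 5\<close>
  there are none; this also makes \<open>n - 2\<close> smaller than \<open>n\<close>.
\<close>

function blooms :: "tile \<Rightarrow> nat \<Rightarrow> tile set" where
  "blooms X n = (if n < 5 then {} else
     (\<Union>t\<in>(subst ^^ (n - 5)) {X}. sprouts ((subst ^^ (n - 5)) {X}) t) \<union> lift ` blooms X (n - 2))"
  by pat_completeness auto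
termination by (relation "Wellfounded.measure snd") auto

declare blooms.simps [simp del]

lemma blooms_less: "n < 5 \<Longrightarrow> blooms X n = {}"
  by (simp add: blooms.simps[of X n])

lemma blooms_step: "blooms X (m + 5) =
    (\<Union>t\<in>(subst ^^ m) {X}. sprouts ((subst ^^ m) {X}) t) \<union> lift ` blooms X (m + 3)"
  by (subst blooms.simps) (simp add: add.commute)

lemma blooms_flower: "s \<in> blooms X n \<Longrightarrow> flower ((subst ^^ n) {X}) s"
proof (induction n arbitrary: s rule: less_induct)
  case (less n)
  then have n: "\<not> n < 5" using blooms_less by auto
  then obtain m where m: "n = m + 5" by (intro that[of "n - 5"]) simp
  have p: "(subst ^^ n) {X} = (subst ^^ 5) ((subst ^^ m) {X})" "(subst ^^ n) {X} = (subst ^^ 2) ((subst ^^ (m + 3)) {X})"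
    by (simp_all add: m add.commute flip: subst_pow_add)
  consider t where "t \<in> (subst ^^ m) {X}" "s \<in> sprouts ((subst ^^ m) {X}) t"
    | s0 where "s0 \<in> blooms X (m + 3)" "s = lift s0"
    using less.prems unfolding m blooms_step by blast
  then show ?case
  proof cases
    case 1
    then show ?thesis unfolding p(1) by (rule flower_sprout)
  next
    case 2
    have "flower ((subst ^^ (m + 3)) {X}) s0" by (rule less.IH) (use 2 m in auto)
    then show ?thesis unfolding p(2) 2(2) by (rule flower_lift)
  qed
qed

text \<open>
  The two claims support each other: one lift raises the level 1 of the centre to 3, and a lifted
  flower is again centred at a corner of its parent.
\<close>

lemma blooms_corner_centred_both:
  "s \<in> blooms X (m + 5) \<Longrightarrow>
     corner_centred 1 ((subst ^^ (m + 4)) {X}) s \<and> corner_centred 3 ((subst ^^ (m + 2)) {X}) s"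
proof (induction m arbitrary: s rule: less_induct)
  case (less m)
  consider t where "t \<in> (subst ^^ m) {X}" "s \<in> sprouts ((subst ^^ m) {X}) t"
    | s0 where "s0 \<in> blooms X (m + 3)" "s = lift s0"
    using less.prems unfolding blooms_step by blast
  then show ?case
    proof cases
      case 1
      then show ?thesis
        using sprout_corner_centred[OF 1, of 1] sprout_corner_centred[OF 1, of 3]
        by (simp add: add.commute flip: subst_pow_add)
    next
      case 2
      have "\<not> m + 3 < 5" using 2(1) blooms_less by auto
      then obtain m' where m': "m = m' + 2" by (intro that[of "m - 2"]) simp
      have fl: "flower ((subst ^^ (m + 3)) {X}) s0" by (rule blooms_flower[OF 2(1)])
      then have s0: "\<not> acute s0" "s0 \<in> (subst ^^ (m + 3)) {X}" using flower_self by (auto simp: flower_def)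
      have "s0 \<in> blooms X (m' + 5)" using 2(1) by (simp add: m' add.commute)
      then have "corner_centred 1 ((subst ^^ (m' + 4)) {X}) s0"
        using less.IH[of m' s0] m' by auto
      then have "corner_centred (1 + 2) ((subst ^^ (m' + 4)) {X}) s"
        unfolding 2(2) by (rule lift_corner_centred(2)[OF s0(1)])
      moreover have "m' + 4 = m + 2" "1 + 2 = (3::nat)" by (simp_all add: m')
      ultimately have "corner_centred 3 ((subst ^^ (m + 2)) {X}) s" by (simp only:)
      moreover have "subst ((subst ^^ (m + 3)) {X}) = (subst ^^ (m + 4)) {X}"
        by (simp add: eval_nat_numeral)
      then have "corner_centred 1 ((subst ^^ (m + 4)) {X}) s"
        using lift_corner_centred(1)[OF s0] unfolding 2(2) by (simp only:)
      ultimately show ?thesis by blast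
    qed
qed

lemmas blooms_corner_centred = blooms_corner_centred_both[THEN conjunct1] blooms_corner_centred_both[THEN conjunct2]

lemma sprouts_in:
  assumes "t \<in> R" "s \<in> sprouts R t" shows "s \<in> (subst ^^ 5) {t}"
proof -
  obtain e f where f: "f \<in> set (seeds (acute t) e)" "s = place (inflate 5 t) f"
    using assms(2) unfolding sprouts_def by blast
  have k: "acute t \<in> {True, False}" by simp
  have "\<not> acute s" using seeds_facts(1)[rule_format, OF k side_set f(1)] f(2) by simp
  then have "s \<in> place (inflate 5 t) ` set (map (lplace f) lcell)"
    using cell_self[of s] by (simp add: cell_def f(2) place_place image_image)
  also have "\<dots> \<subseteq> (subst ^^ 5) {t}"
    unfolding subst_pow_single by (intro image_mono) (rule seed_cell[rule_format, OF k side_set f(1)])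
  finally show ?thesis .
qed

text \<open>A sprouting flower is centred inside a side of its fifth ancestor, a lifted one at a corner.\<close>

lemma blooms_disjoint:
  assumes X: "is_tile X"
  shows "(\<Union>t\<in>(subst ^^ m) {X}. sprouts ((subst ^^ m) {X}) t) \<inter> lift ` blooms X (m + 3) = {}"
proof (rule ccontr)
  let ?R = "(subst ^^ m) {X}"
  assume "(\<Union>t\<in>?R. sprouts ?R t) \<inter> lift ` blooms X (m + 3) \<noteq> {}"
  then obtain t s0 where t: "t \<in> ?R" "lift s0 \<in> sprouts ?R t" and s0: "s0 \<in> blooms X (m + 3)" by blast
  have "\<not> m + 3 < 5" using s0 blooms_less by auto
  then obtain m' where m': "m = m' + 2" by (intro that[of "m - 2"]) simp
  have pk: "packing ?R" by (rule packing_subst_pow[OF packing_single[OF X]])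
  have ob: "\<not> acute s0" using blooms_flower[OF s0] by (simp add: flower_def)
  have "corner_centred 3 ?R s0"
    using blooms_corner_centred(2)[of s0 X m'] s0 by (simp add: m' add.commute)
  from lift_corner_centred(2)[OF ob this]
  obtain u where u: "u \<in> ?R" "lift s0 \<in> (subst ^^ 5) {u}" "cb (lift s0) \<in> set (corners (inflate 5 u))"
    unfolding corner_centred_def by auto
  have "u = t" by (rule ancestor_unique[OF pk u(1) t(1) u(2) sprouts_in[OF t]])
  then show False using sprout_not_corner[OF packing_tile[OF pk t(1)] t(2)] u(3) by simp
qed

lemma lift_inj:
  assumes X: "packing R" and s: "s \<in> R" "s' \<in> R" "\<not> acute s" "\<not> acute s'" "lift s = lift s'"
  shows "s = s'"
  by (rule ancestor_unique[OF X s(1,2) lift_in[OF s(3)]]) (unfold s(5), rule lift_in[OF s(4)])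

lemma card_sprouts:
  assumes t: "is_tile t"
  shows "card (sprouts R t) + 5 * card {e. \<not> glued R t e} \<ge> (if acute t then 5 else 10)"
proof -
  let ?S = "\<lambda>e. set (seeds (acute t) e)"
  have k: "acute t \<in> {True, False}" by simp
  have "card (sprouts R t) = card (\<Union>e\<in>{e. glued R t e}. ?S e)"
    unfolding sprouts_def image_UN[symmetric]
    by (rule card_image) (use place_inj[OF t] in \<open>auto simp: inj_on_def\<close>)
  also have "\<dots> = (\<Sum>e\<in>{e. glued R t e}. card (?S e))"
  proof (rule card_UN_disjoint[OF finite_side], simp, intro ballI impI)
    fix e e' :: side assume "e \<noteq> e'"
    then show "?S e \<inter> ?S e' = {}" using bspec[OF bspec[OF bspec[OF seeds_facts(3) k] side_set[of e]] side_set[of e']] by blast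
  qed
  finally have 1: "card (sprouts R t) = (\<Sum>e\<in>{e. glued R t e}. card (?S e))" .
  have c: "card (?S AB) = 5" "card (?S BC) = (if acute t then 0 else 5)" "card (?S CA) = 0"
    using bspec[OF seeds_facts(4) k] by auto
  have "(\<Sum>e\<in>{e. \<not> glued R t e}. card (?S e)) \<le> (\<Sum>e\<in>{e. \<not> glued R t e}. 5)"
  proof (rule sum_mono)
    fix e show "card (?S e) \<le> 5" using c by (cases e) auto
  qed
  moreover have "(\<Sum>e\<in>UNIV. card (?S e)) = (\<Sum>e\<in>{e. glued R t e}. card (?S e)) + (\<Sum>e\<in>{e. \<not> glued R t e}. card (?S e))"
    by (subst sum.union_disjoint[symmetric]) (auto simp: finite_side intro!: sum.cong)
  moreover have "(\<Sum>e\<in>UNIV. card (?S e)) = (if acute t then 5 else 10)"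
    unfolding UNIV_side using c by simp
  ultimately show ?thesis unfolding 1 by simp
qed

lemma card_blooms_step:
  assumes X: "is_tile X"
  shows "card (blooms X (m + 5)) + 15 * 2 ^ m
    \<ge> 5 * num True ((subst ^^ m) {X}) + 10 * num False ((subst ^^ m) {X}) + card (blooms X (m + 3))"
proof -
  let ?R = "(subst ^^ m) {X}"
  have pk: "packing ?R" by (rule packing_subst_pow[OF packing_single[OF X]])
  have fin: "finite ?R" by (simp add: finite_subst_pow)
  have fs: "finite (sprouts ?R t)" for t unfolding sprouts_def by (auto simp: finite_side)
  have fb: "finite (blooms X n)" for n
    by (rule finite_subset[of _ "(subst ^^ n) {X}"]) (auto simp: finite_subst_pow dest: blooms_flower[THEN flower_self])
  have "inj_on lift (blooms X (m + 3))"
  proof (rule inj_onI)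
    fix s s' assume s: "s \<in> blooms X (m + 3)" "s' \<in> blooms X (m + 3)" "lift s = lift s'"
    note f = blooms_flower[OF s(1)] blooms_flower[OF s(2)]
    show "s = s'"
      by (rule lift_inj[OF packing_subst_pow[OF packing_single[OF X]] flower_self[OF f(1)] flower_self[OF f(2)] _ _ s(3)])
        (use f in \<open>auto simp: flower_def\<close>)
  qed
  then have 1: "card (blooms X (m + 5)) = card (\<Union>t\<in>?R. sprouts ?R t) + card (blooms X (m + 3))"
    unfolding blooms_step using fin fs fb
    by (subst card_Un_disjoint[OF _ _ blooms_disjoint[OF X]]) (auto simp: card_image)
  have 2: "card (\<Union>t\<in>?R. sprouts ?R t) = (\<Sum>t\<in>?R. card (sprouts ?R t))"
    by (rule card_UN_disjoint[OF fin])
      (use fs ancestor_unique[OF pk _ _ sprouts_in sprouts_in] in blast)+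
  have 3: "card (unglued ?R) = (\<Sum>t\<in>?R. card {e. \<not> glued ?R t e})"
  proof -
    have "unglued ?R = Sigma ?R (\<lambda>t. {e. \<not> glued ?R t e})" by (auto simp: unglued_def)
    then show ?thesis by (simp add: card_SigmaI fin finite_side)
  qed
  have "(\<Sum>t\<in>?R. if acute t then 5 else 10) \<le> (\<Sum>t\<in>?R. card (sprouts ?R t) + 5 * card {e. \<not> glued ?R t e})"
    by (intro sum_mono card_sprouts packing_tile[OF pk])
  also have "\<dots> = card (\<Union>t\<in>?R. sprouts ?R t) + 5 * card (unglued ?R)"
    unfolding 2 3 by (simp add: sum.distrib sum_distrib_left)
  also have "\<dots> \<le> card (\<Union>t\<in>?R. sprouts ?R t) + 15 * 2 ^ m" using card_unglued_pow[of m X] by simp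
  also have "(\<Sum>t\<in>?R. if acute t then 5 else 10) = 5 * num True ?R + 10 * num False ?R"
    using fin by (simp add: sum.If_cases num_def Int_def conj_commute mult.commute)
  finally show ?thesis unfolding 1 by simp
qed

lemma num_subst_pow:
  assumes "is_tile X"
  shows "num True ((subst ^^ Suc n) {X}) = num True ((subst ^^ n) {X}) + num False ((subst ^^ n) {X})"
    and "num False ((subst ^^ Suc n) {X}) = num True ((subst ^^ n) {X}) + 2 * num False ((subst ^^ n) {X})"
  using num_subst[OF packing_subst_pow[OF packing_single[OF assms]] finite_subst_pow[of "{X}" n]] by simp_all

lemma num_single: "num k {X} = (if acute X = k then 1 else 0)"
proof -
  have "{t \<in> {X}. acute t = k} = (if acute X = k then {X} else {})" by auto
  then show ?thesis by (simp add: num_def)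
qed

text \<open>
  The linear form \<open>l\<^sub>n = 18 a\<^sub>n - 11 o\<^sub>n\<close> in the numbers of acute and obtuse tiles satisfies
  \<open>l\<^sub>n = l\<^bsub>n-2\<^esub> + 5 a\<^bsub>n-5\<^esub> + 10 o\<^bsub>n-5\<^esub>\<close> exactly. The last term absorbs the sides that are not glued, and
  the initial values, where there are no blooms yet.
\<close>

lemma card_blooms:
  assumes X: "is_tile X"
  shows "real (card (blooms X n)) \<ge> 18 * real (num True ((subst ^^ n) {X})) - 11 * real (num False ((subst ^^ n) {X})) - 20 * 2 ^ n"
proof (induction n rule: less_induct)
  case (less n)
  note rec = num_subst_pow[OF X]
  show ?case
  proof (cases "n < 5")
    case True
    then have "n = 0 \<or> n = Suc 0 \<or> n = Suc (Suc 0) \<or> n = Suc (Suc (Suc 0)) \<or> n = Suc (Suc (Suc (Suc 0)))" by auto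
    moreover have "num k ((subst ^^ 0) {X}) = (if acute X = k then 1 else 0)" for k by (simp add: num_single)
    ultimately show ?thesis by (elim disjE) (simp_all only: rec, auto)
  next
    case False
    then obtain m where m: "n = m + 5" by (intro that[of "n - 5"]) simp
    have IH: "real (card (blooms X (m + 3))) \<ge> 18 * real (num True ((subst ^^ (m + 3)) {X}))
        - 11 * real (num False ((subst ^^ (m + 3)) {X})) - 20 * 2 ^ (m + 3)"
      by (rule less.IH) (simp add: m)
    have step: "real (card (blooms X (m + 5))) + 15 * 2 ^ m
      \<ge> 5 * real (num True ((subst ^^ m) {X})) + 10 * real (num False ((subst ^^ m) {X})) + real (card (blooms X (m + 3)))"
      using of_nat_mono[OF card_blooms_step[OF X, of m], where 'a = real] by simp
    have 5: "m + 5 = Suc (Suc (Suc (Suc (Suc m))))" "m + 3 = Suc (Suc (Suc m))" by auto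
    have pw: "(2::real) ^ (m + 3) = 8 * 2 ^ m" "(2::real) ^ (m + 5) = 32 * 2 ^ m" by (simp_all add: power_add)
    have p0: "0 \<le> (2::real) ^ m" by simp
    show ?thesis unfolding m using IH step unfolding pw 5 rec of_nat_add of_nat_mult
      by simp (use p0 in linarith)
  qed
qed


section \<open>Adjacency in packings\<close>

text \<open>
  The signed area of the parallelogram spanned by \<open>d\<close> and \<open>w\<close>; its sign tells the two sides of the line along \<open>d\<close> apart.
\<close>

definition cross :: "complex \<Rightarrow> complex \<Rightarrow> real" where
  "cross d w = Im (cnj d * w)"

lemma cross_linear:
  "cross d (v + w) = cross d v + cross d w" "cross d (v - w) = cross d v - cross d w"
  "cross d (r *\<^sub>R w) = r * cross d w"
  by (simp_all add: cross_def algebra_simps)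

lemma cross_eq_0D: "d \<noteq> 0 \<Longrightarrow> cross d w = 0 \<Longrightarrow> \<exists>r. w = r *\<^sub>R d"
proof -
  assume d: "d \<noteq> 0" and 0: "cross d w = 0"
  have "cnj d * w = of_real (Re (cnj d * w))"
    using 0 by (simp add: cross_def complex_eq_iff)
  then have "w = (Re (cnj d * w) / (cmod d)\<^sup>2) *\<^sub>R d"
    using d complex_norm_square[of d]
    by (simp add: scaleR_conv_of_real field_simps)
  then show ?thesis by blast
qed

lemma cross_nonzero:
  assumes "\<not> collinear {x, y, p}" shows "y - x \<noteq> 0" "cross (y - x) (p - x) \<noteq> 0"
proof -
  show d: "y - x \<noteq> 0" using assms by auto
  show "cross (y - x) (p - x) \<noteq> 0"
  proof
    assume "cross (y - x) (p - x) = 0"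
    then obtain r where "p - x = r *\<^sub>R (y - x)" using cross_eq_0D[OF d] by blast
    then have "p = r *\<^sub>R y + (1 - r) *\<^sub>R x" by (simp add: algebra_simps)
    then have "collinear {y, p, x}" unfolding collinear_3_expand by blast
    then show False using assms by (simp add: insert_commute)
  qed
qed

text \<open>Two triangles on the same side of a common edge overlap, near the midpoint of that edge.\<close>

lemma same_side_overlap:
  assumes p: "\<not> collinear {x, y, p}" and q: "\<not> collinear {x, y, q}"
    and side: "cross (y - x) (p - x) / cross (y - x) (q - x) > 0"
  shows "interior (convex hull {x, y, p}) \<inter> interior (convex hull {x, y, q}) \<noteq> {}"
proof -
  define \<beta> where "\<beta> = cross (y - x) (p - x) / cross (y - x) (q - x)"
  have \<beta>: "\<beta> > 0" using side by (simp add: \<beta>_def)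
  have "cross (y - x) ((p - x) - \<beta> *\<^sub>R (q - x)) = 0"
    using cross_nonzero(2)[OF q]
    unfolding cross_linear(2)[of "y - x" "p - x"] cross_linear(3) by (simp add: \<beta>_def)
  then obtain \<alpha> where \<alpha>: "(p - x) - \<beta> *\<^sub>R (q - x) = \<alpha> *\<^sub>R (y - x)"
    using cross_eq_0D[OF cross_nonzero(1)[OF q]] by blast
  (* Small enough for the barycentric coordinates of z below to be positive in both triangles. *)
  define \<epsilon> where "\<epsilon> = 1 / (4 * (1 + \<bar>\<alpha>\<bar> + \<beta>))"
  have \<epsilon>: "\<epsilon> > 0" using \<beta> by (simp add: \<epsilon>_def)
  have sum: "\<epsilon> + \<epsilon> * \<bar>\<alpha>\<bar> + \<epsilon> * \<beta> = 1 / 4"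
  proof -
    have "1 + \<bar>\<alpha>\<bar> + \<beta> > 0" using \<beta> by simp
    then have "\<epsilon> * (1 + \<bar>\<alpha>\<bar> + \<beta>) = 1 / 4" unfolding \<epsilon>_def by (simp add: divide_simps)
    then show ?thesis by (simp add: algebra_simps)
  qed
  have pos: "\<epsilon> * \<beta> > 0" "\<epsilon> * \<bar>\<alpha>\<bar> \<ge> 0" using \<epsilon> \<beta> by auto
  have ab: "\<bar>\<epsilon> * \<alpha>\<bar> = \<epsilon> * \<bar>\<alpha>\<bar>" using \<epsilon> by (simp add: abs_mult)
  have small: "\<epsilon> < 1 / 2" "1 / 2 - \<epsilon> * \<alpha> - \<epsilon> * \<beta> > 0" "1 / 2 + \<epsilon> * \<alpha> > 0"
    using sum pos \<epsilon> ab by linarith+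
  let ?z = "(1/2 - \<epsilon>) *\<^sub>R x + (1/2) *\<^sub>R y + \<epsilon> *\<^sub>R p"
  have pq: "p = x + \<alpha> *\<^sub>R (y - x) + \<beta> *\<^sub>R (q - x)" using \<alpha> by (simp add: algebra_simps)
  have z: "?z = (1/2 - \<epsilon> * \<alpha> - \<epsilon> * \<beta>) *\<^sub>R x + (1/2 + \<epsilon> * \<alpha>) *\<^sub>R y + (\<epsilon> * \<beta>) *\<^sub>R q"
    unfolding pq by (simp add: scaleR_conv_of_real field_simps)
  have "?z \<in> interior (convex hull {x, y, p})"
    unfolding interior_convex_hull_3_minimal[OF p DIM_complex] mem_Collect_eq
    by (rule exI[of _ "1/2 - \<epsilon>"], rule exI[of _ "1/2"], rule exI[of _ \<epsilon>])
      (use \<epsilon> small in auto)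
  moreover have "?z \<in> interior (convex hull {x, y, q})"
    unfolding interior_convex_hull_3_minimal[OF q DIM_complex] mem_Collect_eq z
    by (rule exI[of _ "1/2 - \<epsilon> * \<alpha> - \<epsilon> * \<beta>"], rule exI[of _ "1/2 + \<epsilon> * \<alpha>"], rule exI[of _ "\<epsilon> * \<beta>"])
      (use pos small in auto)
  ultimately show ?thesis by blast
qed

lemma tile_edge_third_corner:
  assumes t: "is_tile t" and e: "closed_segment x y \<in> edges t"
  obtains p where "region t = convex hull {x, y, p}" "\<not> collinear {x, y, p}"
proof -
  have E: "edges t = {closed_segment (ca t) (cb t), closed_segment (cb t) (cc t), closed_segment (cc t) (ca t)}"
    by (cases t) auto
  have "\<exists>p. {x, y, p} = {ca t, cb t, cc t}"
    using e unfolding E by (auto simp: closed_segment_eq doubleton_eq_iff)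
  then obtain p where p: "{x, y, p} = {ca t, cb t, cc t}" by blast
  show ?thesis by (rule that[of p]) (use tile_not_collinear[OF t] p in \<open>simp_all add: region_hull\<close>)
qed

text \<open>
  Of three triangles with a common edge two lie on the same side of it.
\<close>

lemma common_edge_at_most_two:
  assumes F: "packing F" and t: "t1 \<in> F" "t2 \<in> F" "t3 \<in> F" "t1 \<noteq> t2" "t1 \<noteq> t3" "t2 \<noteq> t3"
    and e: "e \<in> edges t1" "e \<in> edges t2" "e \<in> edges t3"
  shows False
proof -
  have tile: "is_tile t1" "is_tile t2" "is_tile t3" using packing_tile[OF F] t by auto
  obtain x y where xy: "e = closed_segment x y" using e(1) by (cases t1) auto
  obtain p1 where p1: "region t1 = convex hull {x, y, p1}" "\<not> collinear {x, y, p1}"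
    using tile_edge_third_corner[OF tile(1)] e(1) xy by metis
  obtain p2 where p2: "region t2 = convex hull {x, y, p2}" "\<not> collinear {x, y, p2}"
    using tile_edge_third_corner[OF tile(2)] e(2) xy by metis
  obtain p3 where p3: "region t3 = convex hull {x, y, p3}" "\<not> collinear {x, y, p3}"
    using tile_edge_third_corner[OF tile(3)] e(3) xy by metis
  let ?s = "\<lambda>p. cross (y - x) (p - x)"
  have "?s p1 \<noteq> 0" "?s p2 \<noteq> 0" "?s p3 \<noteq> 0" using cross_nonzero(2) p1 p2 p3 by auto
  then have "?s p1 / ?s p2 > 0 \<or> ?s p1 / ?s p3 > 0 \<or> ?s p2 / ?s p3 > 0"
    unfolding zero_less_divide_iff by linarith
  then show False
    using same_side_overlap[OF p1(2) p2(2)] same_side_overlap[OF p1(2) p3(2)] same_side_overlap[OF p2(2) p3(2)]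
      F t unfolding packing_def p1(1)[symmetric] p2(1)[symmetric] p3(1)[symmetric] by blast
qed

lemma symp_adjacent: "symp adjacent"
  by (auto simp: symp_def adjacent_def)

definition tri_edges :: "'p triangle \<Rightarrow> 'p set list" where
  "tri_edges t = [{ca t, cb t}, {cb t, cc t}, {cc t, ca t}]"

lemma edges_tri_edges: "edges t = (\<lambda>e. convex hull e) ` set (tri_edges t)"
  by (cases t) (simp_all add: tri_edges_def segment_convex_hull)

lemma tri_edges_place: "tri_edges (place s f) = map (\<lambda>e. pos s ` e) (tri_edges f)"
  by (simp add: tri_edges_def)

text \<open>\<open>L\<close> lists the tiles across the three edges of \<open>f\<close>.\<close>

definition encloses :: "pt triangle list \<Rightarrow> pt triangle \<Rightarrow> bool" where
  "encloses L f \<longleftrightarrow> distinct (f # L) \<and> length L = 3 \<and>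
     (\<forall>e\<in>set (tri_edges f). \<exists>g\<in>set L. e \<in> set (tri_edges g)) \<and>
     (\<forall>g\<in>set L. \<exists>e\<in>set (tri_edges f). e \<in> set (tri_edges g))"

lemma place_inj0: "is_tile s \<Longrightarrow> place s f = place s g \<longleftrightarrow> f = g"
  using place_inj[of s 0] by simp

text \<open>
  If a known tile lies across each of the three edges, then there is no room for further neighbours.
\<close>

lemma neighbours_of_enclosed:
  assumes F: "packing F" and s: "is_tile s" and L: "encloses L f"
    and in_F: "place s f \<in> F" "place s ` set L \<subseteq> F"
  shows "{u \<in> F. adjacent u (place s f)} = place s ` set L"
proof (intro equalityI subsetI)
  have neq: "place s g \<noteq> place s f" if "g \<in> set L" for g
    using L that place_inj0[OF s] by (auto simp: encloses_def)
  {
    fix u assume "u \<in> {u \<in> F. adjacent u (place s f)}"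
    then obtain E where u: "u \<in> F" "u \<noteq> place s f" and E: "E \<in> edges u" "E \<in> edges (place s f)"
      by (auto simp: adjacent_def)
    obtain e where e: "e \<in> set (tri_edges f)" "E = convex hull (pos s ` e)"
      using E(2) unfolding edges_tri_edges tri_edges_place by auto
    obtain g where g: "g \<in> set L" "e \<in> set (tri_edges g)" using L e(1) unfolding encloses_def by blast
    have Eg: "E \<in> edges (place s g)" unfolding edges_tri_edges tri_edges_place e(2) using g(2) by auto
    have "u = place s g"
    proof (rule ccontr)
      assume "u \<noteq> place s g"
      moreover have "place s g \<in> F" using g(1) in_F(2) by blast
      ultimately show False
        using common_edge_at_most_two[OF F u(1) in_F(1) _ u(2) _ neq[OF g(1), symmetric] E Eg] by simp
    qed
    then show "u \<in> place s ` set L" using g(1) by blast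
  next
    fix u assume "u \<in> place s ` set L"
    then obtain g where g: "g \<in> set L" "u = place s g" by blast
    obtain e where e: "e \<in> set (tri_edges f)" "e \<in> set (tri_edges g)" using L g(1) unfolding encloses_def by blast
    have "convex hull (pos s ` e) \<in> edges u \<inter> edges (place s f)"
      using e unfolding g(2) edges_tri_edges tri_edges_place by auto
    then show "u \<in> {u \<in> F. adjacent u (place s f)}"
      using g in_F(2) neq[OF g(1)] by (auto simp: adjacent_def)
  }
qed

section \<open>The eigenfunctions of a flower\<close>

abbreviation delta :: "'v \<Rightarrow> 'v \<Rightarrow> complex" where "delta d \<equiv> indicator {d}"

lemma laplacian_delta:
  assumes F: "finite F" "symp adj" "\<not> adj d d" and d: "d \<in> F" and v: "v \<in> F"
    and nb: "{u \<in> F. adj u d} = set L" "distinct L"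
  shows "laplacian F adj (delta d) v = of_nat (length L) * delta d v - (\<Sum>n\<leftarrow>L. delta n v)"
proof (cases "v = d")
  case True
  have "laplacian F adj (delta d) v = (\<Sum>u\<in>set L. 1)"
    unfolding laplacian_def True nb(1) using F(3) nb by (intro sum.cong) (auto simp: indicator_def)
  also have "\<dots> = of_nat (length L)" using nb(2) by (simp add: distinct_card)
  finally have 1: "laplacian F adj (delta d) v = of_nat (length L)" .
  have "d \<notin> set L" using nb(1) F(3) by auto
  then have "(\<Sum>n\<leftarrow>L. delta n v) = (0::complex)" unfolding True
    using nb(2) by (simp add: sum_list_distinct_conv_sum_set indicator_def)
  then show ?thesis using 1 True by simp
next
  case False
  have "laplacian F adj (delta d) v = (\<Sum>u | u \<in> F \<and> adj u v. - delta d u)"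
    unfolding laplacian_def using False by (intro sum.cong) (auto simp: indicator_def)
  also have "\<dots> = (\<Sum>u | u \<in> F \<and> adj u v. if u = d then - 1 else 0)"
    by (intro sum.cong) (auto simp: indicator_def)
  also have "\<dots> = (if adj d v then - 1 else 0)" using F(1) d by simp
  also have "adj d v \<longleftrightarrow> v \<in> set L" unfolding nb(1)[symmetric] using v F(2) by (auto dest: sympD)
  also have "(if v \<in> set L then - 1 else 0) = - (\<Sum>n\<leftarrow>L. delta n v)"
  proof -
    have "(\<Sum>n\<leftarrow>L. delta n v) = (\<Sum>n\<in>set L. if n = v then 1 else (0::complex))"
      using nb(2) unfolding sum_list_distinct_conv_sum_set[OF nb(2)]
      by (intro sum.cong) (auto simp: indicator_def)
    then show ?thesis by simp
  qed
  finally have "laplacian F adj (delta d) v = - (\<Sum>n\<leftarrow>L. delta n v)" .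
  moreover have "delta d v = (0::complex)" using False by simp
  ultimately show ?thesis by simp
qed

lemma laplacian_sum:
  "laplacian F adj (\<lambda>v. \<Sum>i\<in>I. k i * \<phi> i v) v = (\<Sum>i\<in>I. k i * laplacian F adj (\<phi> i) v)"
  unfolding laplacian_def sum_subtractf[symmetric] right_diff_distrib[symmetric] sum_distrib_left
  by (subst sum.swap) (simp add: right_diff_distrib sum_subtractf)

lemma laplacian_diff:
  "laplacian F adj (\<lambda>v. \<phi> v - \<psi> v) v = laplacian F adj \<phi> v - laplacian F adj \<psi> v"
  unfolding laplacian_def sum_subtractf[symmetric] by (intro sum.cong) auto

text \<open>
  The two explicit tiles are the star tile in the coordinates relative to its wings: either wing determines
  the star tile of its cell, hence the star.
\<close>

lemma wing_facts:
  "encloses [link1, link2, lplace flipBC acute_wing_coords] acute_wing_coords"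
  "encloses [link1, link2, lplace flipAB obtuse_wing_coords] obtuse_wing_coords"
  "\<forall>f\<in>set lstar. lplace f flipAB \<in> set lstar \<and> lplace f flipBC \<in> set lstar"
  "lplace flipAB flipAB = std False" "lplace flipBC flipBC = std False"
  "acute acute_wing_coords" "\<not> acute obtuse_wing_coords"
  "lplace acute_wing_coords (Obtuse ((1, 0), (1, 0)) ((0, 0), (1, 1)) ((0, 0), (1, 0))) = std False"
  "lplace obtuse_wing_coords (Obtuse ((1, 0), (0, 0)) ((0, 1), (1, -1)) ((0, 0), (1, -1))) = std False"
  "\<not> acute flipAB" "\<not> acute flipBC"
  unfolding encloses_def by code_simp+

definition acute_wing where "acute_wing t = place t acute_wing_coords"
definition obtuse_wing where "obtuse_wing t = place t obtuse_wing_coords"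

lemma star_place_flip:
  assumes "t \<in> star s" shows "place t flipAB \<in> star s" "place t flipBC \<in> star s"
  using assms wing_facts(3) unfolding star_def by (auto simp: place_place)

lemma flip_flip:
  assumes "\<not> acute t" shows "place (place t flipAB) flipAB = t" "place (place t flipBC) flipBC = t"
  using place_std[of t] assms by (simp_all add: place_place wing_facts)

lemma wing_inj:
  assumes "\<not> acute t" "\<not> acute t'"
  shows "acute_wing t = acute_wing t' \<longleftrightarrow> t = t'" "obtuse_wing t = obtuse_wing t' \<longleftrightarrow> t = t'"
proof -
  have *: "t = place (acute_wing t) (Obtuse ((1, 0), (1, 0)) ((0, 0), (1, 1)) ((0, 0), (1, 0)))"
    "t = place (obtuse_wing t) (Obtuse ((1, 0), (0, 0)) ((0, 1), (1, -1)) ((0, 0), (1, -1)))" if "\<not> acute t" for t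
    using place_std[of t] that by (simp_all add: acute_wing_def obtuse_wing_def place_place wing_facts)
  show "acute_wing t = acute_wing t' \<longleftrightarrow> t = t'" using *(1)[OF assms(1)] *(1)[OF assms(2)] by metis
  show "obtuse_wing t = obtuse_wing t' \<longleftrightarrow> t = t'" using *(2)[OF assms(1)] *(2)[OF assms(2)] by metis
qed

lemma wings_differ: "acute_wing t \<noteq> obtuse_wing t'"
proof
  assume "acute_wing t = obtuse_wing t'"
  then have "acute (acute_wing t) = acute (obtuse_wing t')" by simp
  then show False by (simp add: acute_wing_def obtuse_wing_def wing_facts)
qed

text \<open>
  The weights \<open>\<epsilon>\<close> are 1 for the eigenvalue 2, and the orientations of the star tiles for the eigenvalue 4.
\<close>

definition flower_fun :: "(tile \<Rightarrow> complex) \<Rightarrow> tile set \<Rightarrow> tile \<Rightarrow> complex" where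
  "flower_fun \<epsilon> P = (\<lambda>v. \<Sum>t\<in>P. \<epsilon> t * (delta (acute_wing t) v - delta (obtuse_wing t) v))"

lemma cell_simps: "cell t = {place t (std False), place t link1, obtuse_wing t, acute_wing t, place t link2}"
  by (auto simp: cell_def lcell_def acute_wing_def obtuse_wing_def)

lemma finite_star: "finite (star s)"
  by (simp add: star_def)

lemma flower_fun_nonzero:
  assumes s: "\<not> acute s" and t: "t \<in> star s"
  shows "flower_fun \<epsilon> (star s) (acute_wing t) = \<epsilon> t"
proof -
  have "flower_fun \<epsilon> (star s) (acute_wing t) = (\<Sum>u\<in>star s. if u = t then \<epsilon> t else 0)"
    unfolding flower_fun_def
  proof (intro sum.cong refl)
    fix u assume u: "u \<in> star s"
    show "\<epsilon> u * (delta (acute_wing u) (acute_wing t) - delta (obtuse_wing u) (acute_wing t)) = (if u = t then \<epsilon> t else 0)"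
      using wing_inj(1)[OF star_obtuse[OF s u] star_obtuse[OF s t]] wings_differ[of t u] by auto
  qed
  then show ?thesis using t by (simp add: finite_star)
qed

lemma flower_fun_support:
  assumes "flower_fun \<epsilon> P v \<noteq> 0" shows "\<exists>t\<in>P. v = acute_wing t \<or> v = obtuse_wing t"
proof (rule ccontr)
  assume "\<not> ?thesis"
  then have "flower_fun \<epsilon> P v = 0" unfolding flower_fun_def by (intro sum.neutral) auto
  then show False using assms by simp
qed

lemma star_eq: "t \<in> star s \<Longrightarrow> star t = star s"
proof -
  assume "t \<in> star s"
  then obtain f where f: "f \<in> set lstar" "t = place s f" unfolding star_def by blast
  have "star t = place s ` set (map (lplace f) lstar)" unfolding star_def f(2) by (simp add: place_place image_image)
  also have "\<dots> = star s" using star_closed f(1) by (simp add: star_def)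
  finally show ?thesis .
qed

text \<open>
  A common tile of the supports would be a wing of a tile that belongs to both stars.
\<close>

lemma flower_fun_disjoint:
  assumes s: "\<not> acute s" "\<not> acute s'" and "star s \<noteq> star s'"
  shows "flower_fun \<epsilon> (star s) v = 0 \<or> flower_fun \<epsilon> (star s') v = 0"
proof (rule ccontr)
  assume "\<not> ?thesis"
  then obtain t t' where t: "t \<in> star s" "t' \<in> star s'" and "v = acute_wing t \<or> v = obtuse_wing t" "v = acute_wing t' \<or> v = obtuse_wing t'"
    using flower_fun_support by metis
  then have "t = t'"
    using wing_inj[OF star_obtuse[OF s(1) t(1)] star_obtuse[OF s(2) t(2)]] wings_differ by metis
  then have "star s = star s'" using star_eq[OF t(1)] star_eq[OF t(2)] by simp
  then show False using assms(3) by simp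
qed

text \<open>
  The two wings of a cell have the same links, so the contributions of the links cancel. What remains are the
  mirror images of the wings, which belong to adjacent cells.
\<close>

lemma laplacian_wing_difference:
  assumes F: "packing F" "finite F" and t: "t \<in> F" "\<not> acute t" "cell t \<subseteq> F"
    and nb: "acute_wing (place t flipBC) \<in> F" "obtuse_wing (place t flipAB) \<in> F" and v: "v \<in> F"
  shows "laplacian F adjacent (\<lambda>v. delta (acute_wing t) v - delta (obtuse_wing t) v) v
    = 3 * (delta (acute_wing t) v - delta (obtuse_wing t) v) - (delta (acute_wing (place t flipBC)) v - delta (obtuse_wing (place t flipAB)) v)"
proof -
  have tile: "is_tile t" by (rule packing_tile[OF F(1) t(1)])
  have irr: "\<not> adjacent d d" for d by (simp add: adjacent_def)
  have *: "laplacian F adjacent (delta (place t f)) v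
      = 3 * delta (place t f) v - (\<Sum>n\<leftarrow>map (place t) L. delta n v)"
    if L: "encloses L f" and in_F: "place t f \<in> F" "place t ` set L \<subseteq> F" for f L
  proof -
    have "distinct (map (place t) L)" "length L = 3"
      using L place_inj0[OF tile] by (auto simp: encloses_def distinct_map inj_on_def)
    then show ?thesis
      using laplacian_delta[OF F(2) symp_adjacent irr in_F(1) v, of "map (place t) L"]
        neighbours_of_enclosed[OF F(1) tile L in_F] by simp
  qed
  have A: "laplacian F adjacent (delta (acute_wing t)) v = 3 * delta (acute_wing t) v
      - (delta (place t link1) v + delta (place t link2) v + delta (acute_wing (place t flipBC)) v)"
    unfolding acute_wing_def
    by (subst *[OF wing_facts(1)])
      (use t(3) nb(1) in \<open>simp_all add: cell_simps acute_wing_def place_place add.assoc\<close>)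
  have O: "laplacian F adjacent (delta (obtuse_wing t)) v = 3 * delta (obtuse_wing t) v
      - (delta (place t link1) v + delta (place t link2) v + delta (obtuse_wing (place t flipAB)) v)"
    unfolding obtuse_wing_def
    by (subst *[OF wing_facts(2)])
      (use t(3) nb(2) in \<open>simp_all add: cell_simps obtuse_wing_def place_place add.assoc\<close>)
  show ?thesis unfolding laplacian_diff A O by (simp add: algebra_simps)
qed

text \<open>
  A reflection permutes the star and multiplies the weights by \<open>\<eta>\<close>, so passing to the mirror images of the
  wings multiplies the function by \<open>\<eta>\<close>, and the eigenvalue is \<open>3 - \<eta>\<close>.
\<close>

lemma flower_fun_eigenfunction:
  assumes F: "packing F" "finite F" and s: "flower F s"
    and \<epsilon>: "\<And>t. t \<in> star s \<Longrightarrow> \<epsilon> (place t flipAB) = \<eta> * \<epsilon> t"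
      "\<And>t. t \<in> star s \<Longrightarrow> \<epsilon> (place t flipBC) = \<eta> * \<epsilon> t"
    and \<eta>: "\<eta> * \<eta> = 1" "of_real E = 3 - \<eta>"
  shows "flower_fun \<epsilon> (star s) \<in> eigenspace F adjacent E"
proof -
  have ob: "\<not> acute t" and cellF: "cell t \<subseteq> F" if "t \<in> star s" for t
    using s star_obtuse that unfolding flower_def by blast+
  have wF: "acute_wing t \<in> F" "obtuse_wing t \<in> F" "t \<in> F" if "t \<in> star s" for t
    using cellF[OF that] cell_self[OF ob[OF that]] by (auto simp: cell_simps)
  have "flower_fun \<epsilon> (star s) v = 0" if "v \<notin> F" for v
    using flower_fun_support wF that by metis
  then have l2: "flower_fun \<epsilon> (star s) \<in> l2 F" by (simp add: l2_def)
  have flip: "(\<Sum>t\<in>star s. \<epsilon> t * \<phi> (place t f)) = \<eta> * (\<Sum>t\<in>star s. \<epsilon> t * \<phi> t)"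
    if f: "\<And>t. t \<in> star s \<Longrightarrow> place t f \<in> star s" "\<And>t. t \<in> star s \<Longrightarrow> place (place t f) f = t"
      "\<And>t. t \<in> star s \<Longrightarrow> \<epsilon> (place t f) = \<eta> * \<epsilon> t" for f and \<phi> :: "tile \<Rightarrow> complex"
  proof -
    have "(\<Sum>t\<in>star s. \<epsilon> t * \<phi> (place t f)) = (\<Sum>t\<in>star s. \<epsilon> (place t f) * \<phi> t)"
      by (rule sum.reindex_bij_witness[of _ "\<lambda>t. place t f" "\<lambda>t. place t f"]) (auto simp: f)
    also have "\<dots> = (\<Sum>t\<in>star s. \<eta> * (\<epsilon> t * \<phi> t))" by (intro sum.cong) (auto simp: f)
    finally show ?thesis by (simp add: sum_distrib_left)
  qed
  have "laplacian F adjacent (flower_fun \<epsilon> (star s)) v = of_real E * flower_fun \<epsilon> (star s) v" if v: "v \<in> F" for v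
  proof -
    have "laplacian F adjacent (flower_fun \<epsilon> (star s)) v
      = (\<Sum>t\<in>star s. \<epsilon> t * (3 * (delta (acute_wing t) v - delta (obtuse_wing t) v)
          - (delta (acute_wing (place t flipBC)) v - delta (obtuse_wing (place t flipAB)) v)))"
      unfolding flower_fun_def laplacian_sum
      using laplacian_wing_difference[OF F _ _ _ _ _ v] wF ob cellF star_place_flip
      by (intro sum.cong refl) simp
    also have "\<dots> = 3 * flower_fun \<epsilon> (star s) v
        - ((\<Sum>t\<in>star s. \<epsilon> t * delta (acute_wing (place t flipBC)) v) - (\<Sum>t\<in>star s. \<epsilon> t * delta (obtuse_wing (place t flipAB)) v))"
      unfolding flower_fun_def sum_distrib_left sum_subtractf[symmetric]
      by (intro sum.cong refl) (simp add: algebra_simps)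
    also have "(\<Sum>t\<in>star s. \<epsilon> t * delta (acute_wing (place t flipBC)) v) = \<eta> * (\<Sum>t\<in>star s. \<epsilon> t * delta (acute_wing t) v)"
      by (rule flip) (use star_place_flip(2) flip_flip(2) ob \<epsilon>(2) in auto)
    also have "(\<Sum>t\<in>star s. \<epsilon> t * delta (obtuse_wing (place t flipAB)) v) = \<eta> * (\<Sum>t\<in>star s. \<epsilon> t * delta (obtuse_wing t) v)"
      by (rule flip) (use star_place_flip(1) flip_flip(1) ob \<epsilon>(1) in auto)
    also have "\<eta> * (\<Sum>t\<in>star s. \<epsilon> t * delta (acute_wing t) v) - \<eta> * (\<Sum>t\<in>star s. \<epsilon> t * delta (obtuse_wing t) v)
        = \<eta> * flower_fun \<epsilon> (star s) v"
      unfolding flower_fun_def right_diff_distrib sum_subtractf ..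
    finally show ?thesis unfolding \<eta>(2) by (simp add: algebra_simps)
  qed
  then show ?thesis using l2 by (simp add: eigenspace_def)
qed

text \<open>The reflections \<open>flipAB\<close> and \<open>flipBC\<close> reverse the orientation, i.e. change the color.\<close>

definition orientation :: "tile \<Rightarrow> complex" where
  "orientation t = of_real (sgn (cross (cb t - ca t) (cc t - ca t)))"

lemma cross_commute: "cross v u = - cross u v" "cross u u = 0"
  by (simp_all add: cross_def)

lemma orientation_flip:
  "orientation (place t flipAB) = - orientation t" "orientation (place t flipBC) = - orientation t"
proof -
  have f: "flipAB = Obtuse PA PB ((1, -1), (-1, 0))" "flipBC = Obtuse ((1, 0), (1, 0)) PB PC"
    by (simp_all add: flipAB_def flipBC_def)
  define a u v where auv: "a = ca t" "u = cb t - ca t" "v = cc t - ca t"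
  have p: "pos t p = a + gval (fst p) *\<^sub>R u + gval (snd p) *\<^sub>R v" for p by (simp add: pos_def auv)
  have "cross (pos t PB - pos t PA) (pos t ((1, -1), (-1, 0)) - pos t PA) = - cross u v"
    unfolding p by (simp add: PA_def PB_def gval_def cross_linear cross_commute(1)[of v u] cross_commute(2))
  then show "orientation (place t flipAB) = - orientation t"
    by (simp add: orientation_def f auv sgn_minus)
  have "cross (pos t PB - pos t ((1, 0), (1, 0))) (pos t PC - pos t ((1, 0), (1, 0))) = cross (- v) (- u)"
    unfolding p by (simp add: PB_def PC_def gval_def)
  also have "\<dots> = - cross u v" by (simp add: cross_def)
  finally show "orientation (place t flipBC) = - orientation t"
    by (simp add: orientation_def f auv sgn_minus)
qed

lemma orientation_nonzero: "is_tile t \<Longrightarrow> orientation t \<noteq> 0"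
  using cross_nonzero(2)[OF tile_not_collinear] by (auto simp: orientation_def sgn_if)

lemma eigenvalue_measure_flowers:
  assumes F: "packing F" "finite F" and E: "E \<in> {2, 4}"
  shows "measure (eigenvalue_measure F adjacent) {E} \<ge> real (card {s. flower F s}) / 10 / real (card F)"
proof -
  let ?I = "star ` {s. flower F s}"
  define \<epsilon> where "\<epsilon> t = (if E = 2 then 1 else orientation t)" for t
  define \<eta> :: complex where "\<eta> = (if E = 2 then 1 else - 1)"
  have fin: "finite {s. flower F s}" by (rule finite_subset[OF _ F(2)]) (use flower_self in auto)
  have "measure (eigenvalue_measure F adjacent) {E} \<ge> real (card ?I) / real (card F)"
  proof (rule eigenvalue_measure_singleton_ge[where \<psi> = "flower_fun \<epsilon>"])
    show "finite F" "symp adjacent" "finite ?I" using F symp_adjacent fin by auto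
    fix P assume "P \<in> ?I"
    then obtain s where s: "flower F s" "P = star s" by blast
    show "flower_fun \<epsilon> P \<in> eigenspace F adjacent E"
      unfolding s(2) by (rule flower_fun_eigenfunction[OF F s(1), where \<eta> = \<eta>])
        (use E in \<open>auto simp: \<epsilon>_def \<eta>_def orientation_flip\<close>)
    have ob: "\<not> acute s" using s(1) by (simp add: flower_def)
    have "\<epsilon> s \<noteq> 0" using orientation_nonzero[OF packing_tile[OF F(1) flower_self[OF s(1)]]] by (simp add: \<epsilon>_def)
    then have "flower_fun \<epsilon> P (acute_wing s) \<noteq> 0"
      unfolding s(2) using flower_fun_nonzero[OF ob star_self[OF ob]] by simp
    then show "flower_fun \<epsilon> P \<noteq> (\<lambda>_. 0)" by auto
  next
    fix P P' v assume P: "P \<in> ?I" "P' \<in> ?I" "P \<noteq> P'"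
    then obtain s s' where s: "P = star s" "flower F s" "P' = star s'" "flower F s'" by blast
    show "flower_fun \<epsilon> P v = 0 \<or> flower_fun \<epsilon> P' v = 0"
      unfolding s(1,3) by (rule flower_fun_disjoint) (use s P(3) in \<open>simp_all add: flower_def\<close>)
  qed
  moreover have "card {s. flower F s} \<le> 10 * card ?I"
  proof -
    have 10: "card (star s) \<le> 10" for s
      unfolding star_def by (rule order_trans[OF card_image_le order_trans[OF card_length]]) (simp_all add: lstar_def)
    have "{s. flower F s} \<subseteq> \<Union>?I" using star_self by (auto simp: flower_def)
    then have "card {s. flower F s} \<le> card (\<Union>?I)" using fin finite_star by (intro card_mono) auto
    also have "\<dots> \<le> (\<Sum>P\<in>?I. card P)" by (rule card_Union_le_sum_card)
    also have "\<dots> \<le> (\<Sum>P\<in>?I. 10)" by (intro sum_mono) (use 10 in auto)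
    finally show ?thesis by simp
  qed
  then have "real (card {s. flower F s}) / 10 / real (card F) \<le> real (card ?I) / real (card F)"
    by (intro divide_right_mono) auto
  ultimately show ?thesis by linarith
qed


section \<open>Density of flowers in inflated tiles\<close>

text \<open>
  This is \<open>\<surd>5 \<phi>\<^sup>-\<^sup>7\<close>, the limit of \<open>(18 a\<^sub>n - 11 o\<^sub>n) / (a\<^sub>n + o\<^sub>n)\<close> when \<open>o\<^sub>n / a\<^sub>n\<close> tends to \<open>\<phi>\<close>.
\<close>

definition kappa :: real where "kappa = (65 - 29 * sqrt 5) / 2"

lemma kappa_golden: "18 - 11 * golden = kappa * (1 + golden)"
  by (simp add: kappa_def golden_def field_simps)

lemma kappa_bounds: "0 < kappa" "kappa < 1"
proof -
  have "29 * sqrt 5 < 65"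
    by (rule power2_less_imp_less) (simp_all add: power_mult_distrib)
  moreover have "63 < 29 * sqrt 5"
    by (rule power2_less_imp_less) (simp_all add: power_mult_distrib)
  ultimately show "0 < kappa" "kappa < 1" by (simp_all add: kappa_def)
qed

text \<open>
  If \<open>a\<close> and \<open>o\<close> are the numbers of acute and obtuse tiles, substitution multiplies \<open>o - \<phi> a\<close> by the contracting
  eigenvalue \<open>2 - \<phi>\<close>.
\<close>

lemma num_golden_ratio:
  assumes X: "is_tile X"
  shows "\<bar>real (num False ((subst ^^ n) {X})) - golden * real (num True ((subst ^^ n) {X}))\<bar> \<le> 2"
proof (induction n)
  case 0
  then show ?case using golden_gt_1 golden_lt_2 by (simp add: num_single)
next
  case (Suc n)
  let ?a = "real (num True ((subst ^^ n) {X}))" and ?o = "real (num False ((subst ^^ n) {X}))"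
  have "golden * golden * ?a = (golden + 1) * ?a" by (simp add: golden_sq)
  then have "(?a + 2 * ?o) - golden * (?a + ?o) = (2 - golden) * (?o - golden * ?a)"
    by (simp add: algebra_simps)
  then have "\<bar>(?a + 2 * ?o) - golden * (?a + ?o)\<bar> = (2 - golden) * \<bar>?o - golden * ?a\<bar>"
    using golden_lt_2 by (simp add: abs_mult)
  also have "\<dots> \<le> 1 * 2" by (intro mult_mono Suc.IH) (use golden_gt_1 in auto)
  finally show ?case unfolding num_subst_pow[OF X] by simp
qed

lemma card_subst_pow_growth:
  assumes X: "is_tile X"
  shows "real (card ((subst ^^ Suc n) {X})) \<ge> (5 / 2) ^ n"
proof -
  have "num True ((subst ^^ Suc n) {X}) \<le> num False ((subst ^^ Suc n) {X}) \<and>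
    real (num True ((subst ^^ Suc n) {X}) + num False ((subst ^^ Suc n) {X})) \<ge> (5 / 2) ^ n"
  proof (induction n)
    case 0
    show ?case unfolding num_subst_pow[OF X] by (simp add: num_single)
  next
    case (Suc n)
    let ?a = "num True ((subst ^^ Suc n) {X})" and ?o = "num False ((subst ^^ Suc n) {X})"
    have "(5 / 2) ^ Suc n \<le> 5 / 2 * real (?a + ?o)" using Suc.IH by simp
    also have "\<dots> \<le> real (?a + ?o + (?a + 2 * ?o))" using Suc.IH by simp
    finally show ?case unfolding num_subst_pow[OF X, of "Suc n"] by simp
  qed
  then show ?thesis using card_eq_num[OF finite_subst_pow[of "{X}" "Suc n"]] by simp
qed

text \<open>
  The error terms of \<open>card_blooms\<close> and \<open>num_golden_ratio\<close> are of order \<open>2\<^sup>k\<close>, whereas the number of tiles exceeds a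
  multiple of \<open>(5/2)\<^sup>k\<close>.
\<close>

lemma blooms_density:
  assumes "\<gamma> < kappa"
  shows "\<exists>k. \<forall>X. is_tile X \<longrightarrow> real (card (blooms X k)) \<ge> \<gamma> * real (card ((subst ^^ k) {X}))"
proof -
  have "(kappa - \<gamma>) / 88 > 0" using assms by simp
  then obtain j where j: "(4 / 5 :: real) ^ j < (kappa - \<gamma>) / 88"
    using real_arch_pow_inv[OF \<open>(kappa - \<gamma>) / 88 > 0\<close>, of "4/5"] by auto
  have "(4 / 5 :: real) ^ j * (5 / 2) ^ j = 2 ^ j" by (simp flip: power_mult_distrib)
  then have small: "88 * 2 ^ j \<le> (kappa - \<gamma>) * (5 / 2) ^ j"
    using mult_right_mono[of "(4 / 5 :: real) ^ j" "(kappa - \<gamma>) / 88" "(5 / 2) ^ j"] j by simp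
  show ?thesis
  proof (intro exI[of _ "Suc j"] allI impI)
    fix X assume X: "is_tile X"
    define a b N where "a = real (num True ((subst ^^ Suc j) {X}))" "b = real (num False ((subst ^^ Suc j) {X}))"
      and N: "N = real (card ((subst ^^ Suc j) {X}))"
    note ao = this(1,2)
    have Nao: "N = a + b" unfolding N ao using card_eq_num[OF finite_subst_pow[of "{X}" "Suc j"]] by simp
    define d where "d = b - golden * a"
    have d: "\<bar>d\<bar> \<le> 2" unfolding d_def ao by (rule num_golden_ratio[OF X])
    have "18 * a - 11 * b - kappa * N = a * (18 - 11 * golden - kappa * (1 + golden)) - (11 + kappa) * d"
      by (simp add: Nao d_def algebra_simps)
    also have "\<dots> = - ((11 + kappa) * d)" by (simp add: kappa_golden)
    also have "\<dots> \<ge> - 24"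
    proof -
      have "(11 + kappa) * \<bar>d\<bar> \<le> 12 * 2" by (intro mult_mono d) (use kappa_bounds in auto)
      moreover have "\<bar>(11 + kappa) * d\<bar> = (11 + kappa) * \<bar>d\<bar>" using kappa_bounds by (simp add: abs_mult)
      ultimately show ?thesis by (simp add: abs_le_iff)
    qed
    finally have "18 * a - 11 * b \<ge> kappa * N - 24" by simp
    moreover have "real (card (blooms X (Suc j))) \<ge> 18 * a - 11 * b - 20 * 2 ^ Suc j"
      unfolding ao by (rule card_blooms[OF X])
    moreover have "(1::real) \<le> 2 ^ j" by simp
    (* 24 + 20 * 2 ^ Suc j is at most 88 * 2 ^ j. *)
    ultimately have "real (card (blooms X (Suc j))) \<ge> kappa * N - 88 * 2 ^ j"
      unfolding power_Suc by linarith
    moreover have "(kappa - \<gamma>) * (5 / 2) ^ j \<le> (kappa - \<gamma>) * N"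
      using card_subst_pow_growth[OF X, of j] assms unfolding N by (intro mult_left_mono) auto
    ultimately show "\<gamma> * real (card ((subst ^^ Suc j) {X})) \<le> real (card (blooms X (Suc j)))"
      using small unfolding N[symmetric] by (simp add: algebra_simps)
  qed
qed

section \<open>Counting tiles by area\<close>

text \<open>
  Every tile contains a disc of this radius around its centroid, which has coordinates \<open>(1/3, 1/3)\<close>: within the disc the
  coordinates change by less than \<open>1/10\<close>.
\<close>

definition inrad :: real where "inrad = sqrt (1 - golden / 2) / 10"

lemma inrad_pos: "inrad > 0"
  using golden_lt_2 by (simp add: inrad_def)

lemma plane_coordinates:
  assumes s: "is_tile s" shows "\<exists>x y. z = rpos s x y"
proof -
  define u v w where uvw: "u = cb s - ca s" "v = cc s - ca s" "w = z - ca s"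
  have c: "cross u v \<noteq> 0" unfolding uvw by (rule cross_nonzero(2)[OF tile_not_collinear[OF s]])
  have "cross u v *\<^sub>R w = cross w v *\<^sub>R u + cross u w *\<^sub>R v"
    by (simp add: complex_eq_iff cross_def algebra_simps)
  then have "w = (cross w v / cross u v) *\<^sub>R u + (cross u w / cross u v) *\<^sub>R v"
    using c by (metis (no_types, lifting) divide_inverse_commute scaleR_add_right scaleR_scaleR scaleR_one left_inverse)
  then have "z = rpos s (cross w v / cross u v) (cross u w / cross u v)"
    unfolding rpos_def uvw by (simp add: algebra_simps)
  then show ?thesis by blast
qed

lemma ball_subset_tile:
  assumes s: "is_tile s" shows "ball (rpos s (1/3) (1/3)) inrad \<subseteq> interior (region s)"
proof
  fix z assume z: "z \<in> ball (rpos s (1/3) (1/3)) inrad"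
  obtain x y where xy: "z = rpos s x y" using plane_coordinates[OF s] by blast
  have "rpos s x y - rpos s (1/3) (1/3) = (x - 1/3) *\<^sub>R (cb s - ca s) + (y - 1/3) *\<^sub>R (cc s - ca s)"
    by (simp add: rpos_def scaleR_conv_of_real algebra_simps)
  moreover have "norm (rpos s x y - rpos s (1/3) (1/3)) < inrad"
    using z by (simp add: xy dist_norm norm_minus_commute)
  ultimately have "(norm ((x - 1/3) *\<^sub>R (cb s - ca s) + (y - 1/3) *\<^sub>R (cc s - ca s)))\<^sup>2 < inrad\<^sup>2"
    by (intro power_strict_mono) auto
  also have "inrad\<^sup>2 = (1 - golden / 2) * (1 / 100)"
    using golden_lt_2 by (simp add: inrad_def power_divide)
  finally have "(1 - golden / 2) * ((x - 1/3)\<^sup>2 + (y - 1/3)\<^sup>2) < (1 - golden / 2) * (1 / 100)"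
    using norm_leg_combination(2)[OF s, of "x - 1/3" "y - 1/3"] by linarith
  then have sq: "(x - 1/3)\<^sup>2 + (y - 1/3)\<^sup>2 < (1 / 10)\<^sup>2"
    using golden_lt_2 by (simp add: power2_eq_square)
  have "\<bar>x - 1/3\<bar> < 1 / 10" "\<bar>y - 1/3\<bar> < 1 / 10"
    by (rule power2_less_imp_less; use sq zero_le_power2[of "x - 1/3"] zero_le_power2[of "y - 1/3"] in \<open>simp only: power2_abs; linarith\<close>)+
  then have "0 < x" "0 < y" "x + y < 1" by linarith+
  then show "z \<in> interior (region s)" unfolding interior_region_rpos[OF s] xy by blast
qed

lemma region_subset_cball:
  assumes s: "is_tile s" shows "region s \<subseteq> cball (ca s) 1"
proof
  fix z assume "z \<in> region s"
  then obtain x y where xy: "0 \<le> x" "0 \<le> y" "x + y \<le> 1" "z = rpos s x y" unfolding region_rpos by blast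
  have n: "norm (cb s - ca s) = 1" "norm (cc s - ca s) = 1"
    using s unfolding is_tile_iff by (simp_all add: norm_eq_sqrt_inner)
  have "norm (z - ca s) \<le> norm (x *\<^sub>R (cb s - ca s)) + norm (y *\<^sub>R (cc s - ca s))"
    unfolding xy(4) rpos_def by (metis add.assoc add_diff_cancel_left' norm_triangle_ineq)
  also have "\<dots> \<le> 1" using xy n by simp
  finally show "z \<in> cball (ca s) 1" by (simp add: dist_norm norm_minus_commute)
qed

text \<open>
  The tiles contain disjoint discs of radius \<open>inrad\<close>, whose total area is bounded by that of the annulus.
\<close>

lemma card_packing_annulus:
  assumes Q: "packing Q" "finite Q" and r: "0 \<le> r1" "r1 \<le> r2"
    and sub: "\<And>t. t \<in> Q \<Longrightarrow> region t \<subseteq> cball u r2 - ball u r1"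
  shows "real (card Q) * inrad\<^sup>2 \<le> r2\<^sup>2 - r1\<^sup>2"
proof -
  let ?c = "\<lambda>t. rpos t (1/3) (1/3)"
  define V where "V = unit_ball_vol (real DIM(complex))"
  have V: "V > 0" by (simp add: V_def)
  have ball: "measure lborel (ball c r) = V * r\<^sup>2" if "r \<ge> 0" for c :: complex and r
    using content_ball[OF that, of c] by (simp add: V_def)
  have cball: "measure lborel (cball c r) = V * r\<^sup>2" if "r \<ge> 0" for c :: complex and r
    using content_cball[OF that, of c] by (simp add: V_def)
  have int: "ball (?c t) inrad \<subseteq> interior (region t)" if "t \<in> Q" for t
    by (rule ball_subset_tile[OF packing_tile[OF Q(1) that]])
  have disj: "disjoint_family_on (\<lambda>t. ball (?c t) inrad) Q"
    unfolding disjoint_family_on_def using int packing_eqI[OF Q(1)] by blast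
  have "real (card Q) * (V * inrad\<^sup>2) = (\<Sum>t\<in>Q. measure lborel (ball (?c t) inrad))"
    using inrad_pos by (simp add: ball)
  also have "\<dots> = measure lborel (\<Union>t\<in>Q. ball (?c t) inrad)"
    by (rule measure_finite_Union[OF Q(2) _ disj, symmetric]) (use emeasure_lborel_ball_finite in \<open>auto simp: less_le\<close>)
  also have "\<dots> \<le> measure lborel (cball u r2 - ball u r1)"
  proof (rule measure_mono_fmeasurable)
    show "(\<Union>t\<in>Q. ball (?c t) inrad) \<subseteq> cball u r2 - ball u r1"
      using int sub interior_subset by blast
    show "(\<Union>t\<in>Q. ball (?c t) inrad) \<in> sets lborel"
      by (intro sets.finite_UN Q(2)) auto
    show "cball u r2 - ball u r1 \<in> fmeasurable lborel"
      by (rule fmeasurableI2[of "cball u r2"]) (auto intro: fmeasurable_compact)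
  qed
  also have "\<dots> = measure lborel (cball u r2) - measure lborel (ball u r1)"
    by (rule measure_Diff) (use r emeasure_lborel_cball_finite[of u r2] in \<open>auto simp: less_le\<close>)
  also have "\<dots> = V * (r2\<^sup>2 - r1\<^sup>2)" using r by (simp add: ball cball algebra_simps)
  finally have "V * (real (card Q) * inrad\<^sup>2) \<le> V * (r2\<^sup>2 - r1\<^sup>2)" by (simp add: mult_ac)
  then show ?thesis using V by simp
qed

lemma finite_tiles_in_ball:
  assumes T: "packing T" shows "finite (tiles_in_ball T n)"
proof (rule ccontr)
  assume inf: "infinite (tiles_in_ball T n)"
  obtain N :: nat where N: "real N * inrad\<^sup>2 > (real n + 2)\<^sup>2"
    using reals_Archimedean3[of "inrad\<^sup>2" ] inrad_pos by (metis zero_less_power)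
  obtain Q where Q: "Q \<subseteq> tiles_in_ball T n" "finite Q" "card Q = N"
    using infinite_arbitrarily_large[OF inf] by blast
  have QT: "packing Q" by (rule packing_subset[OF T]) (use Q(1) in \<open>auto simp: tiles_in_ball_def\<close>)
  have "region t \<subseteq> cball 0 (real n + 2) - ball 0 0" if "t \<in> Q" for t
  proof
    fix x assume x: "x \<in> region t"
    have t: "region t \<subseteq> cball (ca t) 1" by (rule region_subset_cball[OF packing_tile[OF QT that]])
    have "region t \<inter> cball 0 (real n) \<noteq> {}" using Q(1) that unfolding tiles_in_ball_def by blast
    then obtain y where y: "y \<in> region t" "norm y \<le> real n" by auto
    have "dist (ca t) x \<le> 1" "dist (ca t) y \<le> 1" using t x y by auto
    then have "norm x \<le> real n + 2" using y(2) by norm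
    then show "x \<in> cball 0 (real n + 2) - ball 0 0" by simp
  qed
  from card_packing_annulus[OF QT Q(2) _ _ this] N Q(3) show False by simp
qed

text \<open>
  The tiles cover the disc, and each is contained in a disc of radius 1.
\<close>

lemma card_tiles_in_ball_ge:
  assumes T: "tiling T" shows "real (card (tiles_in_ball T n)) \<ge> (real n)\<^sup>2"
proof -
  let ?F = "tiles_in_ball T n"
  have fin: "finite ?F" by (rule finite_tiles_in_ball[OF tiling_packing[OF T]])
  define V where "V = unit_ball_vol (real DIM(complex))"
  have V: "V > 0" by (simp add: V_def)
  have cball: "measure lborel (cball c r) = V * r\<^sup>2" if "r \<ge> 0" for c :: complex and r
    using content_cball[OF that, of c] by (simp add: V_def)
  have "cball 0 (real n) \<subseteq> (\<Union>t\<in>?F. cball (ca t) 1)"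
  proof
    fix z :: complex assume z: "z \<in> cball 0 (real n)"
    obtain t where t: "t \<in> T" "z \<in> region t" using T unfolding tiling_def by blast
    have "t \<in> ?F" using t z by (auto simp: tiles_in_ball_def)
    moreover have "z \<in> cball (ca t) 1"
      using region_subset_cball[OF packing_tile[OF tiling_packing[OF T] t(1)]] t(2) by blast
    ultimately show "z \<in> (\<Union>t\<in>?F. cball (ca t) 1)" by blast
  qed
  then have "measure lborel (cball (0::complex) (real n)) \<le> measure lborel (\<Union>t\<in>?F. cball (ca t) 1)"
    by (intro measure_mono_fmeasurable fmeasurable.finite_UN[OF fin] fmeasurable_compact) auto
  also have "\<dots> \<le> (\<Sum>t\<in>?F. measure lborel (cball (ca t) 1))"
    by (rule measure_UNION_le[OF fin]) auto
  finally have "V * (real n)\<^sup>2 \<le> V * real (card ?F)" by (simp add: cball mult.commute)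
  then show ?thesis using V by simp
qed

section \<open>Density of flowers in balls\<close>

lemma place_map_affine:
  fixes w u :: complex
  shows "place (map_triangle (\<lambda>z. w * z + u) s) f = map_triangle (\<lambda>z. w * z + u) (place s f)"
proof -
  have 1: "pos (map_triangle (\<lambda>z. w * z + u) s) = (\<lambda>z. w * z + u) \<circ> pos s"
    by (rule ext) (simp add: pos_def scaleR_conv_of_real algebra_simps)
  have "place (map_triangle (\<lambda>z. w * z + u) s) f = map_triangle (pos (map_triangle (\<lambda>z. w * z + u) s)) f"
    by (rule fun_cong[OF place_def])
  also have "\<dots> = map_triangle (\<lambda>z. w * z + u) (place s f)"
    unfolding 1 by (simp add: place_def triangle.map_comp)
  finally show ?thesis .
qed

lemma rpos_map_affine:
  fixes w u :: complex
  shows "rpos (map_triangle (\<lambda>z. w * z + u) s) x y = w * rpos s x y + u"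
  by (simp add: rpos_def scaleR_conv_of_real algebra_simps)

lemma region_map_affine:
  fixes w u :: complex
  shows "region (map_triangle (\<lambda>z. w * z + u) s) = (\<lambda>z. w * z + u) ` region s"
  unfolding region_rpos rpos_map_affine by auto

lemma flower_map_affine:
  assumes "flower R s"
  shows "flower (map_triangle (\<lambda>z. w * z + u) ` R) (map_triangle (\<lambda>z. w * z + u) s)"
  using assms unfolding flower_def star_def cell_def by (auto simp: place_map_affine)

lemma flowers_of_supertile:
  assumes "is_tile X" "(subst ^^ k) {X} \<subseteq> R"
  shows "blooms X k \<subseteq> {s \<in> (subst ^^ k) {X}. flower R s}"
  using blooms_flower[of _ X k] flower_self flower_mono[OF _ assms(2)] by blast

text \<open>
  \<open>Q\<close> is the part of a substituted packing seen from a disc of radius \<open>n\<close>. The patches \<open>S\<^sup>k(X)\<close> that are contained in \<open>Q\<close> have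
  enough flowers. Those meeting \<open>Q\<close> but not contained in it have points within distance \<open>n\<close> of the centre of the disc and
  points at distance at least \<open>n\<close>; having diameter at most \<open>2 \<phi>\<^sup>k\<close>, they lie in an annulus whose area is
  proportional to \<open>n\<close>.
\<close>

lemma flowers_in_disc:
  assumes R: "packing R" "finite R" and Q: "Q \<subseteq> (subst ^^ k) R"
    and near: "\<And>t. t \<in> Q \<Longrightarrow> region t \<inter> cball u n \<noteq> {}"
    and full: "\<And>t. t \<in> (subst ^^ k) R \<Longrightarrow> interior (region t) \<inter> ball u n \<noteq> {} \<Longrightarrow> t \<in> Q"
    and dens: "\<And>X. is_tile X \<Longrightarrow> real (card (blooms X k)) \<ge> \<gamma> * real (card ((subst ^^ k) {X}))"
    and \<gamma>: "\<gamma> \<ge> 0" and n: "n \<ge> 2 * golden ^ k"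
  shows "real (card {s. flower Q s}) \<ge> \<gamma> * (real (card Q) - 8 * golden ^ k * n / inrad\<^sup>2)"
proof -
  let ?M = "(subst ^^ k) R" and ?S = "\<lambda>X. (subst ^^ k) {X}"
  have tile: "is_tile X" if "X \<in> R" for X by (rule packing_tile[OF R(1) that])
  have M: "packing ?M" "finite ?M" using packing_subst_pow[OF R(1)] finite_subst_pow[OF R(2)] by auto
  have MS: "?M = (\<Union>X\<in>R. ?S X)" by (rule subst_pow_eq_UN)
  have finS: "finite (?S X)" for X by (simp add: finite_subst_pow)
  have finQ: "finite Q" using Q M(2) finite_subset by blast
  define In where "In = {X \<in> R. ?S X \<subseteq> Q}"
  define Out where "Out = {X \<in> R. \<not> ?S X \<subseteq> Q \<and> ?S X \<inter> Q \<noteq> {}}"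
  define B where "B = (\<Union>X\<in>Out. ?S X)"
  have finI: "finite In" "finite Out" using R(2) by (auto simp: In_def Out_def)
  have BM: "B \<subseteq> ?M" unfolding B_def MS by (auto simp: Out_def)
  have disj: "?S X \<inter> ?S Y = {}" if "X \<in> R" "Y \<in> R" "X \<noteq> Y" for X Y
    using ancestor_unique[OF R(1) that(1,2)] that(3) by blast
  have "Q \<subseteq> (\<Union>X\<in>In. ?S X) \<union> B"
  proof
    fix t assume t: "t \<in> Q"
    then obtain X where "X \<in> R" "t \<in> ?S X" using Q MS by blast
    then show "t \<in> (\<Union>X\<in>In. ?S X) \<union> B" using t unfolding B_def In_def Out_def by blast
  qed
  then have "card Q \<le> card ((\<Union>X\<in>In. ?S X) \<union> B)"
    by (intro card_mono) (use finI finS in \<open>auto simp: B_def\<close>)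
  also have "\<dots> \<le> card (\<Union>X\<in>In. ?S X) + card B" by (rule card_Un_le)
  also have "card (\<Union>X\<in>In. ?S X) \<le> (\<Sum>X\<in>In. card (?S X))" by (rule card_UN_le[OF finI(1)])
  finally have cQ: "real (card Q) \<le> real (\<Sum>X\<in>In. card (?S X)) + real (card B)" by linarith
  have "region t \<subseteq> cball u (n + 2 * golden ^ k) - ball u (n - 2 * golden ^ k)" if t: "t \<in> B" for t
  proof -
    obtain X where X: "X \<in> Out" "t \<in> ?S X" using t unfolding B_def by blast
    have XR: "X \<in> R" using X(1) by (simp add: Out_def)
    have reg: "region t' \<subseteq> cball (golden ^ k *\<^sub>R ca X) (golden ^ k)" if t': "t' \<in> ?S X" for t'
    proof
      fix z assume "z \<in> region t'"
      then obtain x where x: "x \<in> region X" "z = golden ^ k *\<^sub>R x"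
        using subst_pow_region(1)[OF tile[OF XR] t'] by blast
      have "dist (ca X) x \<le> 1" using region_subset_cball[OF tile[OF XR]] x(1) by auto
      then have "golden ^ k * dist (ca X) x \<le> golden ^ k * 1"
        using golden_gt_1 by (intro mult_left_mono) auto
      then show "z \<in> cball (golden ^ k *\<^sub>R ca X) (golden ^ k)"
        using golden_gt_1 unfolding x(2) mem_cball dist_norm scaleR_diff_right[symmetric] norm_scaleR by simp
    qed
    obtain t1 where t1: "t1 \<in> ?S X" "t1 \<in> Q" using X(1) unfolding Out_def by blast
    obtain p where p: "p \<in> region t1" "dist u p \<le> n" using near[OF t1(2)] by auto
    obtain t2 where t2: "t2 \<in> ?S X" "t2 \<notin> Q" using X(1) unfolding Out_def by blast
    have t2M: "t2 \<in> ?M" using t2 XR MS by blast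
    obtain q where q: "q \<in> interior (region t2)"
      using tile_interior_nonempty[OF packing_tile[OF M(1) t2M]] by blast
    have qn: "dist u q \<ge> n" using full[OF t2M] t2(2) q by (meson disjoint_iff linorder_not_le mem_ball)
    have q': "q \<in> region t2" using q interior_subset by blast
    show ?thesis
    proof
      fix x assume x: "x \<in> region t"
      let ?c = "golden ^ k *\<^sub>R ca X"
      have d: "dist ?c x \<le> golden ^ k" "dist ?c p \<le> golden ^ k" "dist ?c q \<le> golden ^ k"
        using reg[OF X(2)] reg[OF t1(1)] reg[OF t2(1)] x p(1) q' by auto
      have "dist u x \<le> dist u p + dist ?c p + dist ?c x"
        using dist_triangle[of u x p] dist_triangle[of p x ?c] dist_commute[of p ?c] by linarith
      moreover have "dist u q \<le> dist u x + dist ?c x + dist ?c q"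
        using dist_triangle[of u q x] dist_triangle[of x q ?c] dist_commute[of x ?c] by linarith
      ultimately show "x \<in> cball u (n + 2 * golden ^ k) - ball u (n - 2 * golden ^ k)"
        using d p(2) qn by auto
    qed
  qed
  then have "real (card B) * inrad\<^sup>2 \<le> (n + 2 * golden ^ k)\<^sup>2 - (n - 2 * golden ^ k)\<^sup>2"
    by (intro card_packing_annulus) (use packing_subset[OF M(1) BM] finite_subset[OF BM M(2)] n golden_gt_1 in auto)
  also have "\<dots> = 8 * golden ^ k * n" by (simp add: power2_eq_square algebra_simps)
  finally have cB: "real (card B) \<le> 8 * golden ^ k * n / inrad\<^sup>2"
    using inrad_pos by (simp add: pos_le_divide_eq)
  have finf: "finite {s. flower Q s}" by (rule finite_subset[OF _ finQ]) (use flower_self in auto)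
  have bl: "blooms X k \<subseteq> {s \<in> ?S X. flower Q s}" if "X \<in> In" for X
  proof (rule flowers_of_supertile)
    show "is_tile X" "?S X \<subseteq> Q" using that tile[of X] by (simp_all add: In_def)
  qed
  have "\<gamma> * real (\<Sum>X\<in>In. card (?S X)) \<le> (\<Sum>X\<in>In. real (card (blooms X k)))"
    unfolding of_nat_sum sum_distrib_left
  proof (rule sum_mono)
    fix X assume "X \<in> In"
    then have "is_tile X" using tile[of X] by (simp add: In_def)
    then show "\<gamma> * real (card (?S X)) \<le> real (card (blooms X k))" by (rule dens)
  qed
  also have "\<dots> = real (card (\<Union>X\<in>In. blooms X k))"
  proof -
    have "card (\<Union>X\<in>In. blooms X k) = (\<Sum>X\<in>In. card (blooms X k))"
    proof (rule card_UN_disjoint[OF finI(1)])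
      show "\<forall>X\<in>In. finite (blooms X k)"
      proof
        fix X assume "X \<in> In"
        from bl[OF this] have "blooms X k \<subseteq> ?S X" by auto
        then show "finite (blooms X k)" using finS by (rule finite_subset)
      qed
      show "\<forall>X\<in>In. \<forall>Y\<in>In. X \<noteq> Y \<longrightarrow> blooms X k \<inter> blooms Y k = {}"
      proof (intro ballI impI)
        fix X Y assume XY: "X \<in> In" "Y \<in> In" "X \<noteq> Y"
        have "?S X \<inter> ?S Y = {}" by (rule disj) (use XY in \<open>simp_all add: In_def\<close>)
        moreover have "blooms X k \<subseteq> ?S X" "blooms Y k \<subseteq> ?S Y" using bl[OF XY(1)] bl[OF XY(2)] by auto
        ultimately show "blooms X k \<inter> blooms Y k = {}" by auto
      qed
    qed
    then show ?thesis by simp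
  qed
  also have "\<dots> \<le> real (card {s. flower Q s})"
    unfolding of_nat_le_iff by (rule card_mono[OF finf]) (use bl in auto)
  finally have "\<gamma> * real (\<Sum>X\<in>In. card (?S X)) \<le> real (card {s. flower Q s})" .
  moreover have "\<gamma> * (real (card Q) - 8 * golden ^ k * n / inrad\<^sup>2) \<le> \<gamma> * real (\<Sum>X\<in>In. card (?S X))"
    using cQ cB \<gamma> by (intro mult_left_mono) auto
  ultimately show ?thesis by linarith
qed

lemma card_subst_le:
  assumes "finite R" shows "card (subst R) \<le> 3 * card R"
proof -
  have d: "finite (dissect s) \<and> card (dissect s) \<le> 3" for s
    by (cases s) (auto simp: Let_def card_insert_if)
  have "card (inflate 1 ` dissect s) \<le> 3" for s
    using d[of s] card_image_le[of "dissect s" "inflate 1"] by linarith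
  then have "(\<Sum>t\<in>R. card (inflate 1 ` dissect t)) \<le> (\<Sum>t\<in>R. 3)" by (intro sum_mono)
  then show ?thesis
    using card_UN_le[OF assms, of "\<lambda>t. inflate 1 ` dissect t"] unfolding subst_eq by simp
qed

lemma card_subst_pow_le: "finite R \<Longrightarrow> card ((subst ^^ n) R) \<le> 3 ^ n * card R"
proof (induction n)
  case (Suc n)
  then show ?case using card_subst_le[OF finite_subst_pow[OF Suc.prems, of n]] by simp
qed simp

lemma open_meets_region:
  assumes t: "is_tile t" and U: "open U" "U \<inter> region t \<noteq> {}" shows "U \<inter> interior (region t) \<noteq> {}"
proof -
  have "closure (interior (region t)) = closure (region t)"
    by (rule convex_closure_interior) (use tile_interior_nonempty[OF t] in \<open>auto simp: region_hull\<close>)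
  then have "U \<inter> closure (interior (region t)) \<noteq> {}" using U(2) closure_subset by fastforce
  then show ?thesis using open_Int_closure_eq_empty[OF U(1)] by blast
qed

text \<open>
  The tiles meeting the disc occur, up to a motion \<open>g\<close>, in some \<open>S\<^sup>m(P)\<close>. As \<open>S\<^sup>m(P)\<close> has at most \<open>3\<^sup>m\<close>
  tiles, \<open>m \<ge> k\<close>. A tile of \<open>S\<^sup>m(P)\<close> whose interior meets the moved disc overlaps the image of a tile of \<open>T\<close>, and
  therefore equals it.
\<close>

lemma flowers_in_robinson_tiling:
  assumes T: "robinson_tiling T" and \<gamma>: "0 \<le> \<gamma>"
    and dens: "\<And>X. is_tile X \<Longrightarrow> real (card (blooms X k)) \<ge> \<gamma> * real (card ((subst ^^ k) {X}))"
    and n: "real n \<ge> 2 * golden ^ k" "card (tiles_in_ball T n) > 3 ^ k"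
  shows "real (card {s. flower (tiles_in_ball T n) s})
    \<ge> \<gamma> * (real (card (tiles_in_ball T n)) - 8 * golden ^ k * real n / inrad\<^sup>2)"
proof -
  let ?F = "tiles_in_ball T n"
  have til: "tiling T" using T by (simp add: robinson_tiling_def)
  have finF: "finite ?F" by (rule finite_tiles_in_ball[OF tiling_packing[OF til]])
  have FT: "?F \<subseteq> T" by (auto simp: tiles_in_ball_def)
  obtain P m where P: "is_tile P" "occurs_in ?F ((subst ^^ m) {P})"
    using T finF FT unfolding robinson_tiling_def by blast
  obtain w u where w: "cmod w = 1" and sub: "map_triangle (\<lambda>z. w * z + u) ` ?F \<subseteq> (subst ^^ m) {P}"
    using P(2) unfolding occurs_in_def by blast
  define g where "g = (\<lambda>z. w * z + u)"
  define G where "G = map_triangle g"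
  define w' where "w' = cnj w"
  define G' where "G' = map_triangle (\<lambda>z. w' * z + (- w' * u))"
  have ww: "w' * w = 1" "w * w' = 1" using w complex_norm_square[of w] by (simp_all add: w'_def mult.commute)
  have g': "w' * g z + (- w' * u) = z" for z
    using ww(1) by (simp add: g_def algebra_simps flip: mult.assoc)
  have gg: "g (w' * z + (- w' * u)) = z" for z
    using ww(2) by (simp add: g_def algebra_simps flip: mult.assoc)
  have GG: "G' (G t) = t" "G (G' t) = t" for t
    by (simp_all add: G_def G'_def triangle.map_comp comp_def g'[simplified] gg[simplified] triangle.map_ident)
  have dist_g: "dist (g x) (g y) = dist x y" for x y
    by (simp add: g_def dist_norm norm_mult w flip: right_diff_distrib)
  have regG: "region (G t) = g ` region t" for t unfolding G_def g_def by (rule region_map_affine)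
  have injG: "inj G" "inj G'" by (rule inj_on_inverseI, rule GG)+
  have subG: "G ` ?F \<subseteq> (subst ^^ m) {P}" using sub by (simp add: G_def g_def)
  have cardF: "card (G ` ?F) = card ?F" by (rule card_image[OF inj_on_subset[OF injG(1)]]) simp
  have "k \<le> m"
  proof (rule ccontr)
    assume "\<not> k \<le> m"
    have "card ?F \<le> card ((subst ^^ m) {P})"
      unfolding cardF[symmetric] by (rule card_mono[OF _ subG]) (simp add: finite_subst_pow)
    also have "\<dots> \<le> 3 ^ m" using card_subst_pow_le[of "{P}" m] by simp
    also have "\<dots> \<le> 3 ^ k" using \<open>\<not> k \<le> m\<close> by (intro power_increasing) auto
    finally show False using n(2) by simp
  qed
  define R where "R = (subst ^^ (m - k)) {P}"
  have R: "packing R" "finite R"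
    unfolding R_def by (auto intro: packing_subst_pow packing_single P(1) finite_subst_pow)
  have MR: "(subst ^^ m) {P} = (subst ^^ k) R"
    unfolding R_def subst_pow_add[symmetric] using \<open>k \<le> m\<close> by simp
  have M: "packing ((subst ^^ k) R)" by (rule packing_subst_pow[OF R(1)])
  have "real (card {s. flower (G ` ?F) s}) \<ge> \<gamma> * (real (card (G ` ?F)) - 8 * golden ^ k * real n / inrad\<^sup>2)"
  proof (rule flowers_in_disc[OF R subG[unfolded MR] _ _ dens \<gamma> n(1)])
    show "region t \<inter> cball (g 0) (real n) \<noteq> {}" if t: "t \<in> G ` ?F" for t
    proof -
      obtain t0 z where "t = G t0" "z \<in> region t0" "z \<in> cball 0 (real n)"
        using t unfolding tiles_in_ball_def by blast
      then have "g z \<in> region t \<inter> cball (g 0) (real n)" using dist_g by (simp add: regG)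
      then show ?thesis by blast
    qed
  next
    fix t assume t: "t \<in> (subst ^^ k) R" "interior (region t) \<inter> ball (g 0) (real n) \<noteq> {}"
    then obtain q where q: "q \<in> interior (region t)" "dist (g 0) q < real n" by auto
    define q0 where "q0 = w' * q + (- w' * u)"
    have gq: "g q0 = q" unfolding q0_def by (rule gg)
    have "dist 0 q0 < real n" using q(2) dist_g[of 0 q0] gq by simp
    obtain t0 where t0: "t0 \<in> T" "q0 \<in> region t0" using til unfolding tiling_def by blast
    then have "t0 \<in> ?F" using \<open>dist 0 q0 < real n\<close> unfolding tiles_in_ball_def by force
    then have Gt0: "G t0 \<in> (subst ^^ k) R" using subG MR by blast
    have "q \<in> region (G t0)" unfolding regG using t0(2) gq by blast
    then have "interior (region t) \<inter> interior (region (G t0)) \<noteq> {}"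
      by (intro open_meets_region[OF packing_tile[OF M Gt0]]) (use q in auto)
    then have "t = G t0" using M t(1) Gt0 unfolding packing_def by blast
    then show "t \<in> G ` ?F" using \<open>t0 \<in> ?F\<close> by blast
  qed
  moreover have "card {s. flower (G ` ?F) s} \<le> card {s. flower ?F s}"
  proof -
    have "G' ` {s. flower (G ` ?F) s} \<subseteq> {s. flower ?F s}"
    proof clarify
      fix s assume "flower (G ` ?F) s"
      then have "flower (G' ` (G ` ?F)) (G' s)" unfolding G'_def by (rule flower_map_affine)
      then show "flower ?F (G' s)" by (simp add: image_image GG)
    qed
    moreover have "finite {s. flower ?F s}" by (rule finite_subset[OF _ finF]) (use flower_self in auto)
    moreover have "card (G' ` {s. flower (G ` ?F) s}) = card {s. flower (G ` ?F) s}"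
      by (rule card_image[OF inj_on_subset[OF injG(2)]]) simp
    ultimately show ?thesis by (metis card_mono)
  qed
  ultimately show ?thesis unfolding cardF by linarith
qed


section \<open>The jumps of the integrated density of states\<close>

text \<open>
  The number of tiles meeting the disc of radius \<open>n\<close> is at least \<open>n\<^sup>2\<close>, so an error proportional to \<open>n\<close> is negligible.
\<close>

lemma eventually_atom_ge:
  assumes T: "robinson_tiling T" and E: "E \<in> {2, 4}" and x: "0 < x" "x < kappa / 10"
  shows "\<forall>\<^sub>F n in sequentially. measure (eigenvalue_measure (tiles_in_ball T n) adjacent) {E} \<ge> x"
proof -
  have til: "tiling T" using T by (simp add: robinson_tiling_def)
  obtain \<gamma> where \<gamma>: "10 * x < \<gamma>" "\<gamma> < kappa" using dense[of "10 * x" kappa] x by auto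
  then have \<gamma>0: "0 \<le> \<gamma>" using x by linarith
  obtain k where k: "\<And>X. is_tile X \<Longrightarrow> real (card (blooms X k)) \<ge> \<gamma> * real (card ((subst ^^ k) {X}))"
    using blooms_density[OF \<gamma>(2)] by blast
  define C where "C = 8 * golden ^ k / inrad\<^sup>2"
  have "\<forall>\<^sub>F n in sequentially. real n \<ge> 2 * golden ^ k" "\<forall>\<^sub>F n in sequentially. real n \<ge> \<gamma> * C / (\<gamma> - 10 * x)"
    "\<forall>\<^sub>F n in sequentially. real n \<ge> 3 ^ k + 1"
    using filterlim_real_sequentially unfolding filterlim_at_top by blast+
  then show ?thesis
  proof eventually_elim
    case (elim n)
    let ?F = "tiles_in_ball T n"
    define N where "N = real (card ?F)"
    have n1: "real n \<ge> 1" using elim(3) by (smt (verit) zero_le_power)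
    have N: "N \<ge> (real n)\<^sup>2" unfolding N_def by (rule card_tiles_in_ball_ge[OF til])
    have "real n * 1 \<le> real n * real n" using n1 by (intro mult_left_mono) auto
    then have Nn: "N \<ge> real n" using N by (simp add: power2_eq_square)
    moreover have "real (3 ^ k) = 3 ^ k" by simp
    ultimately have "real (3 ^ k) < real (card ?F)" using elim(3) unfolding N_def by linarith
    then have big: "card ?F > 3 ^ k" unfolding of_nat_less_iff .
    have "\<gamma> * C \<le> (\<gamma> - 10 * x) * real n"
      using elim(2) \<gamma>(1) by (simp add: pos_divide_le_eq mult.commute)
    then have "\<gamma> * C * real n \<le> (\<gamma> - 10 * x) * (real n)\<^sup>2"
      using mult_right_mono[of "\<gamma> * C" "(\<gamma> - 10 * x) * real n" "real n"] by (simp add: power2_eq_square mult.assoc)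
    also have "\<dots> \<le> (\<gamma> - 10 * x) * N" using N \<gamma>(1) by (intro mult_left_mono) auto
    finally have "10 * x * N \<le> \<gamma> * (N - C * real n)" by (simp add: algebra_simps)
    also have "\<dots> \<le> real (card {s. flower ?F s})"
      using flowers_in_robinson_tiling[OF T \<gamma>0 k elim(1) big] unfolding N_def C_def by simp
    finally have "x \<le> real (card {s. flower ?F s}) / 10 / N"
      using Nn n1 by (simp add: field_simps)
    also have "\<dots> \<le> measure (eigenvalue_measure ?F adjacent) {E}"
      unfolding N_def
    proof (rule eigenvalue_measure_flowers[OF _ _ E])
      show "packing ?F" by (rule packing_subset[OF tiling_packing[OF til]]) (auto simp: tiles_in_ball_def)
      show "finite ?F" by (rule finite_tiles_in_ball[OF tiling_packing[OF til]])
    qed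
    finally show ?case .
  qed
qed

theorem theorem1p5:
  fixes T :: "tile set" and \<nu> :: "real measure" and E :: real
  assumes "robinson_tiling T"
    and "is_dos_measure T \<nu>"
    and "E \<in> {2, 4}"
  shows "Lim (at_right E) (cdf \<nu>) - Lim (at_left E) (cdf \<nu>) \<ge> (65 - 29 * sqrt 5) / 20"
proof -
  have \<nu>: "real_distribution \<nu>" using assms(2) by (simp add: is_dos_measure_def)
  have fin: "finite (tiles_in_ball T n)" for n
    by (rule finite_tiles_in_ball[OF tiling_packing]) (use assms(1) in \<open>simp add: robinson_tiling_def\<close>)
  have "kappa / 10 \<le> measure \<nu> {E}"
  proof (rule dense_le)
    fix x assume x: "x < kappa / 10"
    show "x \<le> measure \<nu> {E}"
    proof (cases "0 < x")
      case True
      show ?thesis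
      proof (rule atom_of_weak_limit_ge[OF \<nu>])
        show "finite_measure (eigenvalue_measure (tiles_in_ball T n) adjacent)" for n
          by (rule finite_measure_eigenvalue_measure[OF fin symp_adjacent])
        show "sets (eigenvalue_measure (tiles_in_ball T n) adjacent) = sets borel" for n
          by (rule sets_eigenvalue_measure)
        show "\<forall>\<^sub>F n in sequentially. measure (eigenvalue_measure (tiles_in_ball T n) adjacent) {E} \<ge> x"
          by (rule eventually_atom_ge[OF assms(1,3) True x])
      qed (use assms(2) in \<open>simp add: is_dos_measure_def\<close>)
    next
      case False
      then show ?thesis using measure_nonneg[of \<nu> "{E}"] by linarith
    qed
  qed
  also have "measure \<nu> {E} = Lim (at_right E) (cdf \<nu>) - Lim (at_left E) (cdf \<nu>)"
    by (rule cdf_jump_eq_atom[OF \<nu>, symmetric])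
  finally show ?thesis by (simp add: kappa_def)
qed

end
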